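(* Let $N=\binom{n}{3n/4}$. There is a constant $\varepsilon_0>0$ such that any two-sided, adaptive algorithm (with access to $\mathrm{MQ}(f)$ and $\mathrm{Samp}(f)$) for testing whether a function $f:\{0,1\}^n\to\{0,1\}$ with $|f^{-1}(1)|=\Theta(N)$ is monotone or has relative distance at least $\varepsilon_0$ from monotone functions must make $\tilde{\Omega}((\log N)^{2/3})$ queries.
   Context: $n$ is divisible by $4$. $\mathrm{rel\text{-}dist}(f,g)=|f^{-1}(1)\triangle g^{-1}(1)|/|f^{-1}(1)|$; distance to the class of monotone functions is the minimum over that class. $\mathrm{MQ}(f)$ returns $f(x)$ on query $x$; $\mathrm{Samp}(f)$ returns an independent uniform element of $f^{-1}(1)$. A tester accepts monotone $f$ with probability at least $2/3$ and rejects $f$ at relative distance at least $\varepsilon_0$ with probability at least $2/3$ (two-sided error allowed). Queries count calls to both oracles. *)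

theory Defs
  imports "HOL-Probability.Probability"
begin

text \<open>
  Points of the cube are extensional functions on the index set \<open>{..<n}\<close>. Since all of them agree
  outside \<open>{..<n}\<close>, the library order \<open>\<le>\<close> on \<^typ>\<open>nat \<Rightarrow> bool\<close> restricts to the coordinatewise order.
\<close>

type_synonym point = "nat \<Rightarrow> bool"

definition cube :: "nat \<Rightarrow> point set" where
  "cube n = ({..<n} \<rightarrow>\<^sub>E UNIV)"

lemma cube_le_iff:
  assumes "x \<in> cube n" "y \<in> cube n"
  shows "x \<le> y \<longleftrightarrow> (\<forall>i<n. x i \<le> y i)"
proof -
  have "x i = y i" if "\<not> i < n" for i
    using assms that by (simp add: cube_def PiE_def extensional_def)
  then show ?thesis
    by (auto simp: le_fun_def)
qed

lemma finite_cube: "finite (cube n)"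
  by (simp add: cube_def finite_PiE)

definition ones :: "nat \<Rightarrow> (point \<Rightarrow> bool) \<Rightarrow> point set" where
  "ones n f = {x \<in> cube n. f x}"

abbreviation monotone_fun :: "nat \<Rightarrow> (point \<Rightarrow> bool) \<Rightarrow> bool" where
  "monotone_fun n f \<equiv> mono_on (cube n) f"

definition rel_dist :: "nat \<Rightarrow> (point \<Rightarrow> bool) \<Rightarrow> (point \<Rightarrow> bool) \<Rightarrow> real" where
  "rel_dist n f g = real (card (sym_diff (ones n f) (ones n g))) / real (card (ones n f))"

definition rel_dist_mono :: "nat \<Rightarrow> (point \<Rightarrow> bool) \<Rightarrow> real" where
  "rel_dist_mono n f = Min {rel_dist n f g | g. monotone_fun n g}"

text \<open>The minimum above is over a finite nonempty set of values.\<close>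

lemma rel_dist_values:
  "finite {rel_dist n f g | g. monotone_fun n g}" "{rel_dist n f g | g. monotone_fun n g} \<noteq> {}"
proof -
  have "{rel_dist n f g | g. monotone_fun n g} \<subseteq>
      (\<lambda>S. real (card (sym_diff (ones n f) S)) / real (card (ones n f))) ` Pow (cube n)"
    by (auto simp: rel_dist_def ones_def)
  then show "finite {rel_dist n f g | g. monotone_fun n g}"
    by (rule finite_subset) (simp add: finite_cube)
  have "monotone_fun n (\<lambda>_. False)"
    by (simp add: mono_on_def)
  then show "{rel_dist n f g | g. monotone_fun n g} \<noteq> {}"
    by blast
qed

text \<open>
  Deterministic adaptive algorithms are decision trees: the continuation of each oracle call may
  depend on all answers received so far. A randomized algorithm is a probability distribution on
  such trees. There are infinitely many trees, but for a fixed \<open>n\<close> and a bound on the number of calls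
  only finitely many of them differ on valid answers, so discrete distributions lose nothing.
\<close>

datatype alg =
    Output bool
  | MQ point "bool \<Rightarrow> alg"
  | Samp "point \<Rightarrow> alg"

type_synonym rand_alg = "alg pmf"

text \<open>At most \<open>q\<close> oracle calls of both kinds along every branch, membership queries only in the cube.\<close>

primrec alg_queries_le :: "nat \<Rightarrow> alg \<Rightarrow> nat \<Rightarrow> bool" where
  "alg_queries_le n (Output b) q = True"
| "alg_queries_le n (MQ x k) q = (x \<in> cube n \<and> q > 0 \<and> (\<forall>b. alg_queries_le n (k b) (q - 1)))"
| "alg_queries_le n (Samp k) q = (q > 0 \<and> (\<forall>x\<in>cube n. alg_queries_le n (k x) (q - 1)))"

definition queries_le :: "nat \<Rightarrow> rand_alg \<Rightarrow> nat \<Rightarrow> bool" where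
  "queries_le n A q \<longleftrightarrow> (\<forall>T\<in>set_pmf A. alg_queries_le n T q)"

text \<open>
  Each sample is a fresh uniform element of \<^term>\<open>ones n f\<close>; this is meaningful only if
  \<^term>\<open>ones n f\<close> is nonempty.
\<close>

primrec run_alg :: "nat \<Rightarrow> (point \<Rightarrow> bool) \<Rightarrow> alg \<Rightarrow> bool pmf" where
  "run_alg n f (Output b) = return_pmf b"
| "run_alg n f (MQ x k) = run_alg n f (k (f x))"
| "run_alg n f (Samp k) = bind_pmf (pmf_of_set (ones n f)) (\<lambda>x. run_alg n f (k x))"

definition run :: "nat \<Rightarrow> (point \<Rightarrow> bool) \<Rightarrow> rand_alg \<Rightarrow> bool pmf" where
  "run n f A = bind_pmf A (run_alg n f)"

text \<open>Two-sided error tester under the promise that the input function lies in \<open>F\<close>.\<close>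

definition monotonicity_tester ::
    "nat \<Rightarrow> real \<Rightarrow> (point \<Rightarrow> bool) set \<Rightarrow> rand_alg \<Rightarrow> bool" where
  "monotonicity_tester n \<epsilon> F A \<longleftrightarrow>
     (\<forall>f\<in>F. (monotone_fun n f \<longrightarrow> pmf (run n f A) True \<ge> 2/3) \<and>
            (rel_dist_mono n f \<ge> \<epsilon> \<longrightarrow> pmf (run n f A) False \<ge> 2/3))"

text \<open>For \<^prop>\<open>4 dvd n\<close>, as always in its use below, the division is exact.\<close>

definition layer_size :: "nat \<Rightarrow> nat" where
  "layer_size n = n choose (3 * n div 4)"

definition theta_class :: "nat \<Rightarrow> real \<Rightarrow> real \<Rightarrow> (point \<Rightarrow> bool) set" where
  "theta_class n c\<^sub>1 c\<^sub>2 =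
     {f. c\<^sub>1 * real (layer_size n) \<le> real (card (ones n f)) \<and>
         real (card (ones n f)) \<le> c\<^sub>2 * real (layer_size n)}"

end

theory Submission
  imports Defs "HOL-Real_Asymp.Real_Asymp"
begin


text \<open>Write n = 4h and N = (4h choose 3h), so that ln N lies between h and 3h. Two families of
  functions are built that differ from the threshold at weight 3h only on the layers 3h and 3h + 1.
  Random terms and clauses cut part of these layers into 2^(4h) cells such that comparable points
  never lie in different cells, and each cell gets a random key k < 4h. A yes-function is constant
  on each cell, with value 1 iff k < h, and hence monotone (\<open>monotone_yes_fun\<close>). A
  no-function is the negated coordinate k on each cell, so edges in direction k inside the cell are
  violated. For a constant fraction of the terms and clauses, most keys yield more than N / 2048
  disjoint violated edges (\<open>sum_mass_ge\<close>, \<open>sum_coll_le\<close>, and Hoeffding's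
  inequality in \<open>card_few_violations_le\<close>), which forces a relative distance of at least
  1/4096 (\<open>rel_dist_no_fun\<close>).

  All hard functions are 1 on a constant fraction of the points of weight at least 3h. A sample is
  therefore simulated by O(log h) membership queries to random such points
  (\<open>acc_sim_rand\<close>), and decision trees of some depth Q remain.

  For fixed terms and clauses, the keys consistent with a transcript form a product over the cells
  (\<open>transcript_yes_set\<close>), and a single query to a cell hardly separates the families.
  Further queries help only if they vary many coordinates, but by Harris' inequality a query with
  more than K new coordinates stays in the same term or clause with probability at most 2^-K (locale
  \<open>hidden_set\<close>, \<open>sum_bad_run_le\<close>). Otherwise m queries to the clause of a
  cell keep the union of supports at 3h + Km, and the union of zero sets in the cell at h + K min(Q,
  m^2), which is at most h + K m sqrt Q. So the cell loses a fraction of at most K m sqrt Q / h of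
  its keys (\<open>card_no_keys_ge\<close>). Since the m sum up to at most 2Q, the total loss is 2 K
  Q^(3/2) / h (\<open>card_transcript_no_ge\<close>). With K of order log h, this is small until Q
  reaches h^(2/3) up to logarithms, and \<open>no_small_tester\<close> derives the
  contradiction.\<close>

section \<open>Deterministic membership-query algorithms as decision trees\<close>

datatype dtree = Leaf bool | Node point dtree dtree

primrec eval :: "(point \<Rightarrow> bool) \<Rightarrow> dtree \<Rightarrow> bool" where
  "eval f (Leaf b) = b"
| "eval f (Node x t1 t0) = (if f x then eval f t1 else eval f t0)"

primrec depth :: "dtree \<Rightarrow> nat" where
  "depth (Leaf b) = 0"
| "depth (Node x t1 t0) = Suc (max (depth t1) (depth t0))"

primrec transcript :: "(point \<Rightarrow> bool) \<Rightarrow> dtree \<Rightarrow> (point \<times> bool) list" where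
  "transcript f (Leaf b) = []"
| "transcript f (Node x t1 t0) = (x, f x) # (if f x then transcript f t1 else transcript f t0)"

definition queried :: "(point \<Rightarrow> bool) \<Rightarrow> dtree \<Rightarrow> point list" where
  "queried f t = map fst (transcript f t)"

lemma queried_simps [simp]:
  "queried f (Leaf b) = []"
  "queried f (Node x t1 t0) = x # queried f (if f x then t1 else t0)"
  by (simp_all add: queried_def)

lemma length_queried: "length (queried f t) \<le> depth t"
  by (induction t) auto

lemma transcript_eq_iff: "transcript g t = transcript f t \<longleftrightarrow> (\<forall>(x, a) \<in> set (transcript f t). g x = a)"
  by (induction t) auto

lemma eval_cong_transcript: "transcript g t = transcript f t \<Longrightarrow> eval g t = eval f t"
  by (induction t) (auto split: if_splits)

section \<open>Sequences of sets with few new elements per step\<close>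

fun growth_ok :: "nat \<Rightarrow> (point \<Rightarrow> nat set) \<Rightarrow> nat set \<Rightarrow> point list \<Rightarrow> bool" where
  "growth_ok K E B [] = True"
| "growth_ok K E B (y # ys) = (card (E y - B) \<le> K \<and> growth_ok K E (B \<union> E y) ys)"

text \<open>The first set is free of charge: its size is known from the weight of the query, and
  only later sets are charged for new elements.\<close>

definition chain_ok :: "nat \<Rightarrow> (point \<Rightarrow> nat set) \<Rightarrow> point list \<Rightarrow> bool" where
  "chain_ok K E ys = (case ys of [] \<Rightarrow> True | y # ys' \<Rightarrow> growth_ok K E (E y) ys')"

lemma chain_ok_simps [simp]: "chain_ok K E []" "chain_ok K E (y # ys) = growth_ok K E (E y) ys"
  by (simp_all add: chain_ok_def)

lemma growth_ok_card_le:
  assumes "growth_ok K E B ys" "finite B" "\<And>y. finite (E y)"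
  shows "card (B \<union> (\<Union>y\<in>set ys. E y)) \<le> card B + K * length ys"
  using assms
proof (induction ys arbitrary: B)
  case (Cons y ys)
  have "card (B \<union> E y \<union> (\<Union>y\<in>set ys. E y)) \<le> card (B \<union> E y) + K * length ys"
    using Cons.prems by (intro Cons.IH) auto
  moreover have "B \<union> E y \<union> (\<Union>y\<in>set ys. E y) = B \<union> (\<Union>y\<in>set (y # ys). E y)"
    by auto
  moreover have "card (B \<union> E y) = card B + card (E y - B)"
    using Cons.prems by (subst Un_Diff_cancel[symmetric], subst card_Un_disjoint) auto
  ultimately show ?case using Cons.prems by simp
qed simp

lemma chain_ok_card_le:
  assumes "chain_ok K E ys" "\<And>y. finite (E y)" "\<And>y. y \<in> set ys \<Longrightarrow> card (E y) \<le> e"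
  shows "card (\<Union>y\<in>set ys. E y) \<le> e + K * (length ys - 1)"
proof (cases ys)
  case (Cons y ys')
  have "card (\<Union>y\<in>set ys. E y) \<le> card (E y) + K * length ys'"
    using growth_ok_card_le[of K E "E y" ys'] assms Cons by simp
  also have "\<dots> \<le> e + K * length ys'"
    using assms(3)[of y] Cons by simp
  finally show ?thesis
    using Cons by simp
qed simp

section \<open>Decision trees that probe a hidden random set\<close>

definition up_closed :: "nat set set \<Rightarrow> bool" where
  "up_closed U \<longleftrightarrow> (\<forall>R R'. R \<in> U \<longrightarrow> R \<subseteq> R' \<longrightarrow> R' \<in> U)"

lemma up_closed_UNIV: "up_closed UNIV"
  by (simp add: up_closed_def)

lemma up_closed_Int_meets: "up_closed U \<Longrightarrow> up_closed (U \<inter> {R. R \<inter> D \<noteq> {}})"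
  unfolding up_closed_def by blast

text \<open>
  Harris' inequality in the only case needed: avoiding a set is negatively correlated with an
  up-closed family. Adding arbitrary elements of \<open>E - B\<close> to \<open>R\<close> is injective and preserves \<open>U\<close>.
\<close>

lemma card_avoiding_up_closed_le:
  assumes "up_closed U" "E \<subseteq> {..<n}"
  shows "card {R \<in> Pow {..<n}. R \<inter> B = {} \<and> R \<in> U \<and> R \<inter> E = {}} * 2 ^ card (E - B)
    \<le> card {R \<in> Pow {..<n}. R \<inter> B = {} \<and> R \<in> U}"
proof -
  let ?L = "{R \<in> Pow {..<n}. R \<inter> B = {} \<and> R \<in> U \<and> R \<inter> E = {}}"
  let ?R = "{R \<in> Pow {..<n}. R \<inter> B = {} \<and> R \<in> U}"
  have fin: "finite (E - B)"
    using assms(2) by (meson finite_Diff finite_lessThan finite_subset)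
  have "card ?L * 2 ^ card (E - B) = card (?L \<times> Pow (E - B))"
    using fin by (simp add: card_cartesian_product card_Pow)
  also have "\<dots> \<le> card ?R"
  proof (rule card_inj_on_le[where f = "\<lambda>(R, S). R \<union> S"])
    show "inj_on (\<lambda>(R, S). R \<union> S) (?L \<times> Pow (E - B))"
    proof (rule inj_onI; clarify)
      fix R S R' S'
      assume "R \<inter> E = {}" "R' \<inter> E = {}" "S \<subseteq> E - B" "S' \<subseteq> E - B" "R \<union> S = R' \<union> S'"
      then show "R = R' \<and> S = S'"
        by blast
    qed
    show "(\<lambda>(R, S). R \<union> S) ` (?L \<times> Pow (E - B)) \<subseteq> ?R"
    proof clarify
      fix R S
      assume "R \<subseteq> {..<n}" "R \<inter> B = {}" "R \<in> U" "S \<subseteq> E - B"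
      moreover from this have "R \<union> S \<in> U"
        using assms(1) unfolding up_closed_def by (metis Un_upper1)
      ultimately show "R \<union> S \<in> Pow {..<n} \<and> (R \<union> S) \<inter> B = {} \<and> R \<union> S \<in> U"
        using assms(2) by auto
    qed
  qed simp
  finally show ?thesis .
qed

lemma card_avoiding: "E \<subseteq> {..<n} \<Longrightarrow> card {R \<in> Pow {..<n}. R \<inter> E = {}} = 2 ^ (n - card E)"
proof -
  assume E: "E \<subseteq> {..<n}"
  have "{R \<in> Pow {..<n}. R \<inter> E = {}} = Pow ({..<n} - E)"
    by auto
  then show ?thesis
    using E by (simp add: card_Pow card_Diff_subset finite_subset)
qed

text \<open>
  The answers depend on a random set \<open>R\<close> only through whether \<open>R\<close> avoids \<open>E x\<close>. Answers that \<open>R\<close> avoids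
  some set shrink the range of \<open>R\<close>, and all other answers put \<open>R\<close> into an up-closed family. So by Harris'
  inequality the next query \<open>x\<close> is avoided with probability at most \<open>2\<^bsup>-d\<^esup>\<close> if \<open>E x\<close> has \<open>d\<close> new elements.
\<close>

locale hidden_set =
  fixes n K :: nat and E :: "point \<Rightarrow> nat set" and gate :: "point \<Rightarrow> bool"
    and f :: "nat set \<Rightarrow> point \<Rightarrow> bool" and g1 g0 :: "point \<Rightarrow> bool"
  assumes f_eq: "\<And>R x. R \<in> Pow {..<n} \<Longrightarrow> f R x = (if gate x \<and> R \<inter> E x = {} then g1 x else g0 x)"
    and E_sub: "\<And>x. E x \<subseteq> {..<n}"
begin

definition members :: "nat set \<Rightarrow> dtree \<Rightarrow> point list" where
  "members R t = filter (\<lambda>x. gate x \<and> R \<inter> E x = {}) (queried (f R) t)"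

lemma members_Node:
  assumes "R \<in> Pow {..<n}"
  shows "members R (Node x t1 t0) = (if gate x \<and> R \<inter> E x = {}
     then x # members R (if g1 x then t1 else t0) else members R (if g0 x then t1 else t0))"
  using f_eq[OF assms] by (simp add: members_def)

lemma members_Node_in:
  "R \<in> Pow {..<n} \<Longrightarrow> gate x \<Longrightarrow> R \<inter> E x = {} \<Longrightarrow>
    members R (Node x t1 t0) = x # members R (if g1 x then t1 else t0)"
  by (simp only: members_Node simp_thms if_True)

lemma members_Node_out:
  "R \<in> Pow {..<n} \<Longrightarrow> \<not> (gate x \<and> R \<inter> E x = {}) \<Longrightarrow>
    members R (Node x t1 t0) = members R (if g0 x then t1 else t0)"
  by (simp only: members_Node if_False)

text \<open>The induction generalises over what is known about \<open>R\<close>: it avoids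
  \<open>B\<close> and lies in the up-closed \<open>U\<close>. At a gated query either
  \<open>R\<close> avoids \<open>E x\<close>, which enlarges \<open>B\<close>, or it meets
  \<open>E x\<close>, which shrinks \<open>U\<close> to another up-closed family. The two cases
  split the current family, so their errors add up without overlap, and each level of the tree pays
  2^-K once.\<close>

lemma card_growth_bad_le:
  assumes "up_closed U"
  shows "real (card {R \<in> Pow {..<n}. R \<inter> B = {} \<and> R \<in> U \<and> \<not> growth_ok K E B (members R t)})
     \<le> real (depth t) / 2 ^ K * real (card {R \<in> Pow {..<n}. R \<inter> B = {} \<and> R \<in> U})"
  using assms
proof (induction t arbitrary: B U)
  case (Leaf b)
  then show ?case by (simp add: members_def)
next
  case (Node x t1 t0)
  let ?P = "\<lambda>B U. {R \<in> Pow {..<n}. R \<inter> B = {} \<and> R \<in> U}"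
  let ?Bad = "\<lambda>B U t. {R \<in> Pow {..<n}. R \<inter> B = {} \<and> R \<in> U \<and> \<not> growth_ok K E B (members R t)}"
  let ?d = "max (depth t1) (depth t0)"
  have IH: "real (card (?Bad B U (if b then t1 else t0))) \<le> real ?d / 2 ^ K * real (card (?P B U))"
    if "up_closed U" for B U b
  proof -
    have "real (card (?Bad B U (if b then t1 else t0)))
        \<le> real (depth (if b then t1 else t0)) / 2 ^ K * real (card (?P B U))"
      using Node.IH that by (cases b) auto
    also have "\<dots> \<le> real ?d / 2 ^ K * real (card (?P B U))"
      by (intro mult_right_mono divide_right_mono) auto
    finally show ?thesis .
  qed
  show ?case
  proof (cases "gate x")
    case False
    then have "?Bad B U (Node x t1 t0) = ?Bad B U (if g0 x then t1 else t0)"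
      using members_Node_out by (intro Collect_cong conj_cong refl) simp
    then have "real (card (?Bad B U (Node x t1 t0))) \<le> real ?d / 2 ^ K * real (card (?P B U))"
      using IH[OF Node.prems, of B "g0 x"] by simp
    also have "\<dots> \<le> real (depth (Node x t1 t0)) / 2 ^ K * real (card (?P B U))"
      by (intro mult_right_mono divide_right_mono) auto
    finally show ?thesis .
  next
    case gate: True
    define U' where "U' = U \<inter> {R. R \<inter> E x \<noteq> {}}"
    have U': "up_closed U'"
      unfolding U'_def by (rule up_closed_Int_meets[OF Node.prems])
    define In where "In = {R \<in> Pow {..<n}. R \<inter> B = {} \<and> R \<in> U \<and> R \<inter> E x = {}}"
    have In_eq: "In = ?P (B \<union> E x) U"
      unfolding In_def by auto
    have finIn: "finite In" and finP: "finite (?P B U')"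
      unfolding In_def by simp_all
    have split_P: "card (?P B U) = card In + card (?P B U')"
    proof -
      have "?P B U = In \<union> ?P B U'" "In \<inter> ?P B U' = {}"
        unfolding In_def U'_def by auto
      then show ?thesis
        using card_Un_disjoint[OF finIn finP] by simp
    qed
    have sub: "?Bad B U (Node x t1 t0) \<subseteq> {R \<in> In. \<not> growth_ok K E B (members R (Node x t1 t0))}
        \<union> ?Bad B U' (if g0 x then t1 else t0)"
    proof
      fix R assume R: "R \<in> ?Bad B U (Node x t1 t0)"
      show "R \<in> {R \<in> In. \<not> growth_ok K E B (members R (Node x t1 t0))}
        \<union> ?Bad B U' (if g0 x then t1 else t0)"
      proof (cases "R \<inter> E x = {}")
        case True
        then show ?thesis using R by (simp add: In_def)
      next
        case False
        then have "members R (Node x t1 t0) = members R (if g0 x then t1 else t0)"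
          using R by (intro members_Node_out) auto
        then show ?thesis using R False by (simp add: U'_def)
      qed
    qed
    have inpart: "real (card {R \<in> In. \<not> growth_ok K E B (members R (Node x t1 t0))})
       \<le> real (card (?P B U)) / 2 ^ K + real ?d / 2 ^ K * real (card In)"
    proof (cases "card (E x - B) \<le> K")
      case True
      have "{R \<in> In. \<not> growth_ok K E B (members R (Node x t1 t0))} = ?Bad (B \<union> E x) U (if g1 x then t1 else t0)"
        unfolding In_def using gate True by (intro set_eqI iffI; clarify) (simp_all add: members_Node_in Int_Un_distrib)
      then have "real (card {R \<in> In. \<not> growth_ok K E B (members R (Node x t1 t0))}) \<le> real ?d / 2 ^ K * real (card In)"
        using IH[OF Node.prems, of "B \<union> E x" "g1 x"] by (simp add: In_eq)
      moreover have "0 \<le> real (card (?P B U)) / 2 ^ K"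
        by simp
      ultimately show ?thesis by linarith
    next
      case False
      \<comment> \<open>More than \<open>K\<close> new elements: all of \<open>In\<close> is given
        up, and Harris' inequality bounds it by a 2^-K fraction of the current family.\<close>
      have "real (card In) * 2 ^ K \<le> real (card In) * 2 ^ card (E x - B)"
        using False by (intro mult_left_mono power_increasing) auto
      also have "\<dots> = real (card In * 2 ^ card (E x - B))"
        by simp
      also have "\<dots> \<le> real (card (?P B U))"
        unfolding In_def using card_avoiding_up_closed_le[OF Node.prems E_sub] of_nat_le_iff by blast
      finally have "real (card In) \<le> real (card (?P B U)) / 2 ^ K"
        by (simp add: pos_le_divide_eq)
      moreover have "card {R \<in> In. \<not> growth_ok K E B (members R (Node x t1 t0))} \<le> card In"
        using finIn by (intro card_mono) auto
      moreover have "0 \<le> real ?d / 2 ^ K * real (card In)"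
        by simp
      ultimately show ?thesis by linarith
    qed
    have "card (?Bad B U (Node x t1 t0)) \<le> card ({R \<in> In. \<not> growth_ok K E B (members R (Node x t1 t0))}
        \<union> ?Bad B U' (if g0 x then t1 else t0))"
      using finIn by (intro card_mono sub) auto
    also have "\<dots> \<le> card {R \<in> In. \<not> growth_ok K E B (members R (Node x t1 t0))}
        + card (?Bad B U' (if g0 x then t1 else t0))"
      by (rule card_Un_le)
    finally have "real (card (?Bad B U (Node x t1 t0))) \<le> real (card {R \<in> In. \<not> growth_ok K E B (members R (Node x t1 t0))})
        + real (card (?Bad B U' (if g0 x then t1 else t0)))"
      by (simp only: of_nat_add[symmetric] of_nat_le_iff)
    also have "\<dots> \<le> (real (card (?P B U)) / 2 ^ K + real ?d / 2 ^ K * real (card In)) + real ?d / 2 ^ K * real (card (?P B U'))"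
      using inpart IH[OF U', of B "g0 x"] by (rule add_mono)
    also have "\<dots> = real (depth (Node x t1 t0)) / 2 ^ K * real (card (?P B U))"
      unfolding split_P depth.simps of_nat_add of_nat_Suc
      by (simp add: distrib_left distrib_right add_divide_distrib del: of_nat_max)
    finally show ?thesis .
  qed
qed

text \<open>Until the first member all answers come from \<open>g0\<close>, so the first member is a
  gated query on the \<open>g0\<close> path. For each of these at most 2^(n-e) sets avoid
  \<open>E x\<close>, and \<open>card_growth_bad_le\<close> with \<open>B = E x\<close> contributes
  a factor \<open>d / 2^K\<close>. Gated queries are counted instead of the depth so that the bound
  vanishes if there are none, which the bound for clauses exploits.\<close>

lemma card_chain_bad_le_aux:
  assumes "up_closed U" "\<And>x. gate x \<Longrightarrow> e \<le> card (E x)" "depth t \<le> d"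
  shows "real (card {R \<in> Pow {..<n}. R \<in> U \<and> \<not> chain_ok K E (members R t)})
     \<le> real (length (filter gate (queried g0 t))) * (real d / 2 ^ K * 2 ^ (n - e))"
  using assms(1,3)
proof (induction t arbitrary: U)
  case (Leaf b)
  then show ?case by (simp add: members_def)
next
  case (Node x t1 t0)
  let ?Bad = "\<lambda>U t. {R \<in> Pow {..<n}. R \<in> U \<and> \<not> chain_ok K E (members R t)}"
  let ?b = "real d / 2 ^ K * 2 ^ (n - e)"
  have IH: "real (card (?Bad U (if g0 x then t1 else t0)))
     \<le> real (length (filter gate (queried g0 (if g0 x then t1 else t0)))) * ?b" if "up_closed U" for U
    using Node.IH[OF that] Node.prems by auto
  show ?case
  proof (cases "gate x")
    case False
    then have "?Bad U (Node x t1 t0) = ?Bad U (if g0 x then t1 else t0)"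
      using members_Node_out by (intro Collect_cong conj_cong refl) simp
    then show ?thesis
      using IH[OF Node.prems(1)] False by simp
  next
    case gate: True
    define U' where "U' = U \<inter> {R. R \<inter> E x \<noteq> {}}"
    have U': "up_closed U'"
      unfolding U'_def by (rule up_closed_Int_meets[OF Node.prems(1)])
    let ?t = "if g1 x then t1 else t0"
    let ?In = "{R \<in> Pow {..<n}. R \<inter> E x = {} \<and> R \<in> U \<and> \<not> growth_ok K E (E x) (members R ?t)}"
    have sub: "?Bad U (Node x t1 t0) \<subseteq> ?In \<union> ?Bad U' (if g0 x then t1 else t0)"
    proof
      fix R assume R: "R \<in> ?Bad U (Node x t1 t0)"
      show "R \<in> ?In \<union> ?Bad U' (if g0 x then t1 else t0)"
      proof (cases "R \<inter> E x = {}")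
        case True
        then have "members R (Node x t1 t0) = x # members R ?t"
          using R gate by (intro members_Node_in) auto
        then show ?thesis using R True by simp
      next
        case False
        then have "members R (Node x t1 t0) = members R (if g0 x then t1 else t0)"
          using R by (intro members_Node_out) auto
        then show ?thesis using R False by (simp add: U'_def)
      qed
    qed
    have "card (?Bad U (Node x t1 t0)) \<le> card (?In \<union> ?Bad U' (if g0 x then t1 else t0))"
      by (intro card_mono sub) auto
    also have "\<dots> \<le> card ?In + card (?Bad U' (if g0 x then t1 else t0))"
      by (rule card_Un_le)
    finally have "real (card (?Bad U (Node x t1 t0))) \<le> real (card ?In) + real (card (?Bad U' (if g0 x then t1 else t0)))"
      by (simp only: of_nat_add[symmetric] of_nat_le_iff)
    moreover have "real (card ?In) \<le> ?b"
    proof -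
      have "card {R \<in> Pow {..<n}. R \<inter> E x = {} \<and> R \<in> U} \<le> card {R \<in> Pow {..<n}. R \<inter> E x = {}}"
        by (intro card_mono) auto
      also have "\<dots> = 2 ^ (n - card (E x))"
        using E_sub by (rule card_avoiding)
      also have "\<dots> \<le> 2 ^ (n - e)"
        using assms(2)[OF gate] by (intro power_increasing) auto
      finally have *: "real (card {R \<in> Pow {..<n}. R \<inter> E x = {} \<and> R \<in> U}) \<le> 2 ^ (n - e)"
        by (simp only: of_nat_le_iff[symmetric, where 'a = real] of_nat_power of_nat_numeral)
      have "real (card ?In) \<le> real (depth ?t) / 2 ^ K * real (card {R \<in> Pow {..<n}. R \<inter> E x = {} \<and> R \<in> U})"
        by (rule card_growth_bad_le[OF Node.prems(1)])
      also have "\<dots> \<le> ?b"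
        using * Node.prems(2) by (intro mult_mono divide_right_mono) auto
      finally show ?thesis .
    qed
    moreover note IH[OF U']
    ultimately have "real (card (?Bad U (Node x t1 t0)))
        \<le> ?b + real (length (filter gate (queried g0 (if g0 x then t1 else t0)))) * ?b"
      by linarith
    also have "\<dots> = real (length (filter gate (queried g0 (Node x t1 t0)))) * ?b"
      using gate by (simp only: queried_simps filter.simps if_True length_Cons of_nat_Suc distrib_right mult_1)
    finally show ?thesis .
  qed
qed

lemma card_chain_bad_le:
  assumes "\<And>x. gate x \<Longrightarrow> e \<le> card (E x)" "depth t \<le> d"
  shows "real (card {R \<in> Pow {..<n}. \<not> chain_ok K E (members R t)})
     \<le> real (length (filter gate (queried g0 t))) * (real d / 2 ^ K * 2 ^ (n - e))"
  using card_chain_bad_le_aux[OF up_closed_UNIV assms] by simp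

text \<open>A union bound along the \<open>g0\<close> path, which the tree follows until the first
  member.\<close>

lemma card_members_nonempty_le:
  assumes "\<And>x. gate x \<Longrightarrow> e \<le> card (E x)"
  shows "card {R \<in> Pow {..<n}. members R t \<noteq> []} \<le> depth t * 2 ^ (n - e)"
proof (induction t)
  case (Leaf b)
  then show ?case by (simp add: members_def)
next
  case (Node x t1 t0)
  let ?t = "if g0 x then t1 else t0"
  let ?In = "{R \<in> Pow {..<n}. gate x \<and> R \<inter> E x = {}}"
  have "card {R \<in> Pow {..<n}. members R (Node x t1 t0) \<noteq> []}
     \<le> card (?In \<union> {R \<in> Pow {..<n}. members R ?t \<noteq> []})"
  proof (intro card_mono subsetI)
    fix R assume R: "R \<in> {R \<in> Pow {..<n}. members R (Node x t1 t0) \<noteq> []}"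
    show "R \<in> ?In \<union> {R \<in> Pow {..<n}. members R ?t \<noteq> []}"
    proof (cases "gate x \<and> R \<inter> E x = {}")
      case False
      then have "members R (Node x t1 t0) = members R ?t"
        using R by (intro members_Node_out) auto
      then show ?thesis using R by simp
    qed (use R in simp)
  qed simp
  also have "\<dots> \<le> card ?In + card {R \<in> Pow {..<n}. members R ?t \<noteq> []}"
    by (rule card_Un_le)
  also have "card ?In \<le> 2 ^ (n - e)"
  proof (cases "gate x")
    case True
    then have "card ?In = 2 ^ (n - card (E x))"
      using card_avoiding[OF E_sub[of x]] by simp
    also have "\<dots> \<le> 2 ^ (n - e)"
      using assms[OF True] by (intro power_increasing) auto
    finally show ?thesis .
  qed simp
  also have "card {R \<in> Pow {..<n}. members R ?t \<noteq> []} \<le> max (depth t1) (depth t0) * 2 ^ (n - e)"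
  proof -
    have "card {R \<in> Pow {..<n}. members R ?t \<noteq> []} \<le> depth ?t * 2 ^ (n - e)"
      using Node.IH by (cases "g0 x") auto
    also have "\<dots> \<le> max (depth t1) (depth t0) * 2 ^ (n - e)"
      by (intro mult_right_mono) auto
    finally show ?thesis .
  qed
  finally show ?case by (simp add: algebra_simps)
qed

end


section \<open>The hard functions\<close>

definition supp :: "nat \<Rightarrow> point \<Rightarrow> nat set" where
  "supp n x = {i. i < n \<and> x i}"

definition zer :: "nat \<Rightarrow> point \<Rightarrow> nat set" where
  "zer n x = {i. i < n \<and> \<not> x i}"

lemma finite_supp [simp]: "finite (supp n x)" and finite_zer [simp]: "finite (zer n x)"
  by (simp_all add: supp_def zer_def)

lemma supp_subset: "supp n x \<subseteq> {..<n}" and zer_subset: "zer n x \<subseteq> {..<n}"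
  by (auto simp: supp_def zer_def)

lemma zer_eq: "zer n x = {..<n} - supp n x"
  by (auto simp: supp_def zer_def)

lemma card_zer: "card (zer n x) = n - card (supp n x)"
  by (simp add: zer_eq card_Diff_subset supp_subset)

lemma card_supp_le: "card (supp n x) \<le> n"
  using card_mono[OF _ supp_subset[of n x]] by simp

lemma supp_mono: "x \<le> y \<Longrightarrow> supp n x \<subseteq> supp n y"
  by (auto simp: supp_def le_fun_def)

lemma bij_betw_supp: "bij_betw (supp n) (cube n) (Pow {..<n})"
proof (rule bij_betwI[where g = "\<lambda>S i. if i < n then i \<in> S else undefined"])
  show "(\<lambda>S i. if i < n then i \<in> S else undefined) \<in> Pow {..<n} \<rightarrow> cube n"
    by (auto simp: cube_def PiE_def extensional_def)
  show "(\<lambda>i. if i < n then i \<in> supp n x else undefined) = x" if "x \<in> cube n" for x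
    using that by (auto simp: cube_def PiE_def extensional_def supp_def)
qed (auto simp: supp_def split: if_splits)

lemma supp_inj: "x \<in> cube n \<Longrightarrow> y \<in> cube n \<Longrightarrow> supp n x = supp n y \<Longrightarrow> x = y"
  using bij_betw_supp[of n] by (auto simp: bij_betw_def dest: inj_onD)

lemma fun_upd_cube: "x \<in> cube n \<Longrightarrow> i < n \<Longrightarrow> x(i := b) \<in> cube n"
  by (auto simp: cube_def PiE_def extensional_def)

lemma supp_insert: "i < n \<Longrightarrow> supp n (x(i := True)) = insert i (supp n x)"
  by (auto simp: supp_def)

lemma zer_remove: "zer n (x(i := True)) = zer n x - {i}"
  by (auto simp: zer_def)

definition layer :: "nat \<Rightarrow> nat \<Rightarrow> point set" where
  "layer n w = {x \<in> cube n. card (supp n x) = w}"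

lemma layer_subset: "layer n w \<subseteq> cube n"
  by (simp add: layer_def)

lemma finite_layer [simp]: "finite (layer n w)"
  using finite_subset[OF layer_subset finite_cube] .

lemma card_layer: "card (layer n w) = n choose w"
proof -
  have "supp n ` layer n w = {S. S \<subseteq> {..<n} \<and> card S = w}" (is "_ = ?S")
  proof
    show "supp n ` layer n w \<subseteq> ?S"
      using supp_subset by (auto simp: layer_def)
    show "?S \<subseteq> supp n ` layer n w"
    proof
      fix S assume S: "S \<in> ?S"
      then have "S \<in> supp n ` cube n"
        by (simp add: bij_betw_imp_surj_on[OF bij_betw_supp])
      then obtain x where "x \<in> cube n" "supp n x = S"
        by auto
      then show "S \<in> supp n ` layer n w"
        using S by (auto simp: layer_def)
    qed
  qed
  moreover have "inj_on (supp n) (layer n w)"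
    using bij_betw_imp_inj_on[OF bij_betw_supp[of n]] layer_subset by (rule inj_on_subset)
  ultimately show ?thesis
    using n_subsets[of "{..<n}" w] card_image[of "supp n" "layer n w"] by simp
qed

definition upper :: "nat \<Rightarrow> nat \<Rightarrow> point set" where
  "upper n w = {x \<in> cube n. w \<le> card (supp n x)}"

lemma finite_upper [simp]: "finite (upper n w)"
  using finite_cube by (simp add: upper_def)

text \<open>
  With \<open>n = 4h\<close>, a family of terms \<open>T\<close> (a point satisfies term \<open>i\<close> if it contains \<open>T i\<close>) and clauses
  \<open>C\<close> (a point falsifies clause \<open>(i, j)\<close> if it is disjoint from \<open>C (i, j)\<close>) cuts the layers \<open>3h\<close> and
  \<open>3h + 1\<close> into cells: a point lies in cell \<open>(i, j)\<close> if \<open>i\<close> is its only satisfied term and \<open>j\<close> its only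
  falsified clause of term \<open>i\<close>.
\<close>

definition band :: "nat \<Rightarrow> point \<Rightarrow> bool" where
  "band h x \<longleftrightarrow> card (supp (4*h) x) = 3*h \<or> card (supp (4*h) x) = 3*h + 1"

definition sat :: "nat \<Rightarrow> (nat \<Rightarrow> nat set) \<Rightarrow> point \<Rightarrow> nat set" where
  "sat h T x = {i. i < 2^h \<and> T i \<inter> zer (4*h) x = {}}"

definition avd :: "nat \<Rightarrow> (nat \<times> nat \<Rightarrow> nat set) \<Rightarrow> nat \<Rightarrow> point \<Rightarrow> nat set" where
  "avd h C i x = {j. j < 2^(3*h) \<and> C (i, j) \<inter> supp (4*h) x = {}}"

definition in_cell :: "nat \<Rightarrow> (nat \<Rightarrow> nat set) \<Rightarrow> (nat \<times> nat \<Rightarrow> nat set) \<Rightarrow> point \<Rightarrow> nat \<times> nat \<Rightarrow> bool" where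
  "in_cell h T C x c \<longleftrightarrow> band h x \<and> sat h T x = {fst c} \<and> avd h C (fst c) x = {snd c}"

text \<open>The common skeleton of both families, so that whatever concerns only \<open>T\<close>
  and \<open>C\<close> is proved once for all \<open>v\<close>. The description is well defined
  because the cells are disjoint (\<open>in_cell_unique\<close>).\<close>

definition glue :: "nat \<Rightarrow> (nat \<Rightarrow> nat set) \<Rightarrow> (nat \<times> nat \<Rightarrow> nat set) \<Rightarrow>
    (nat \<times> nat \<Rightarrow> point \<Rightarrow> bool) \<Rightarrow> point \<Rightarrow> bool" where
  "glue h T C v x = (if \<exists>c. in_cell h T C x c then v (THE c. in_cell h T C x c) x
     else 3*h < card (supp (4*h) x))"

text \<open>A quarter of all keys is below \<open>h\<close>, the same fraction for which the
  no-function below is 1 at a given cell point of layer \<open>3*h\<close>, because such a point has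
  \<open>h\<close> zeros.\<close>

definition yes_fun :: "nat \<Rightarrow> (nat \<Rightarrow> nat set) \<Rightarrow> (nat \<times> nat \<Rightarrow> nat set) \<Rightarrow> (nat \<times> nat \<Rightarrow> nat) \<Rightarrow> point \<Rightarrow> bool" where
  "yes_fun h T C k = glue h T C (\<lambda>c x. k c < h)"

definition no_fun :: "nat \<Rightarrow> (nat \<Rightarrow> nat set) \<Rightarrow> (nat \<times> nat \<Rightarrow> nat set) \<Rightarrow> (nat \<times> nat \<Rightarrow> nat) \<Rightarrow> point \<Rightarrow> bool" where
  "no_fun h T C k = glue h T C (\<lambda>c x. \<not> x (k c))"

lemma finite_sat [simp]: "finite (sat h T x)" and finite_avd [simp]: "finite (avd h C i x)"
  by (simp_all add: sat_def avd_def)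

lemma in_cell_unique: "in_cell h T C x c \<Longrightarrow> in_cell h T C x c' \<Longrightarrow> c = c'"
  by (simp add: in_cell_def prod_eq_iff)

lemma glue_in_cell: "in_cell h T C x c \<Longrightarrow> glue h T C v x = v c x"
  unfolding glue_def using in_cell_unique by (metis the_equality)

lemma glue_no_cell: "\<nexists>c. in_cell h T C x c \<Longrightarrow> glue h T C v x \<longleftrightarrow> 3*h < card (supp (4*h) x)"
  unfolding glue_def by simp

lemma in_cell_cong: "supp (4*h) x = supp (4*h) y \<Longrightarrow> in_cell h T C x c \<longleftrightarrow> in_cell h T C y c"
  by (simp add: in_cell_def band_def sat_def avd_def zer_eq)

lemma in_cell_less:
  assumes "in_cell h T C x c"
  shows "c \<in> {..<2^h} \<times> {..<2^(3*h)}"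
proof -
  have "fst c \<in> sat h T x" "snd c \<in> avd h C (fst c) x"
    using assms by (auto simp: in_cell_def)
  then show ?thesis
    by (cases c) (auto simp: sat_def avd_def)
qed

text \<open>A larger support satisfies more terms and falsifies fewer clauses; nested singletons are
  equal.\<close>

lemma in_cell_mono:
  assumes "in_cell h T C x c" "in_cell h T C y c'" "supp (4*h) x \<subseteq> supp (4*h) y"
  shows "c = c'"
proof -
  have "sat h T x \<subseteq> sat h T y"
    using assms(3) by (auto simp: sat_def zer_eq)
  then have fst: "fst c = fst c'"
    using assms(1,2) by (auto simp: in_cell_def)
  have "avd h C (fst c) y \<subseteq> avd h C (fst c) x"
    using assms(3) by (auto simp: avd_def)
  then have "snd c = snd c'"
    using assms(1,2) fst by (auto simp: in_cell_def)
  with fst show ?thesis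
    by (simp add: prod_eq_iff)
qed

lemma glue_above: "3*h + 2 \<le> card (supp (4*h) x) \<Longrightarrow> glue h T C v x"
  using glue_no_cell[of h T C x v] by (auto simp: in_cell_def band_def)

lemma glue_below: "card (supp (4*h) x) < 3*h \<Longrightarrow> \<not> glue h T C v x"
  using glue_no_cell[of h T C x v] by (auto simp: in_cell_def band_def)

text \<open>Comparable cell points share the cell and the value. If only the lower point is in a
  cell, the upper one has larger weight and default value 1. If only the upper one is in a cell and
  the lower one has default value 1, both have weight \<open>3*h + 1\<close> and hence the same
  support, a contradiction.\<close>

lemma monotone_yes_fun: "monotone_fun (4*h) (yes_fun h T C k)"
proof (rule mono_onI)
  fix x y assume xy: "x \<in> cube (4*h)" "y \<in> cube (4*h)" "x \<le> y"
  have sub: "supp (4*h) x \<subseteq> supp (4*h) y"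
    using supp_mono[OF xy(3)] .
  then have le: "card (supp (4*h) x) \<le> card (supp (4*h) y)"
    by (simp add: card_mono)
  have eq: "in_cell h T C x = in_cell h T C y" if "card (supp (4*h) x) = card (supp (4*h) y)"
    using card_subset_eq[OF _ sub that] by (intro ext in_cell_cong) simp
  have "yes_fun h T C k y" if fx: "yes_fun h T C k x"
  proof (cases "\<exists>c. in_cell h T C x c")
    case True
    then obtain c where c: "in_cell h T C x c" by blast
    show ?thesis
    proof (cases "\<exists>c. in_cell h T C y c")
      case True
      then obtain c' where c': "in_cell h T C y c'" by blast
      then show ?thesis
        using fx c in_cell_mono[OF c c' sub] by (simp add: yes_fun_def glue_in_cell)
    next
      case False
      then have "card (supp (4*h) x) \<noteq> card (supp (4*h) y)"
        using eq True by metis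
      then have "3*h < card (supp (4*h) y)"
        using le c by (auto simp: in_cell_def band_def)
      then show ?thesis
        using False by (simp add: yes_fun_def glue_no_cell)
    qed
  next
    case False
    then have gt: "3*h < card (supp (4*h) x)"
      using fx by (simp add: yes_fun_def glue_no_cell)
    show ?thesis
    proof (cases "\<exists>c. in_cell h T C y c")
      case True
      then have "card (supp (4*h) y) \<le> 3*h + 1"
        by (auto simp: in_cell_def band_def)
      then have "card (supp (4*h) x) = card (supp (4*h) y)"
        using gt le by simp
      then show ?thesis
        using eq True False by metis
    next
      case False
      then show ?thesis
        using gt le by (simp add: yes_fun_def glue_no_cell)
    qed
  qed
  then show "yes_fun h T C k x \<le> yes_fun h T C k y"
    by simp
qed

section \<open>Violated edges of the no-functions\<close>

text \<open>An edge with both ends in cell \<open>c\<close> is recorded by its lower end. If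
  \<open>e\<close> is the key of \<open>c\<close>, the no-function falls from 1 to 0 along
  it.\<close>

definition cell_edge :: "nat \<Rightarrow> (nat \<Rightarrow> nat set) \<Rightarrow> (nat \<times> nat \<Rightarrow> nat set) \<Rightarrow> nat \<times> nat \<Rightarrow> nat \<Rightarrow> point set" where
  "cell_edge h T C c e = {x \<in> layer (4*h) (3*h). in_cell h T C x c \<and> e < 4*h \<and> \<not> x e \<and>
     in_cell h T C (x(e := True)) c}"

definition violations :: "nat \<Rightarrow> (nat \<Rightarrow> nat set) \<Rightarrow> (nat \<times> nat \<Rightarrow> nat set) \<Rightarrow> (nat \<times> nat \<Rightarrow> nat) \<Rightarrow> point set" where
  "violations h T C k = (\<Union>c. cell_edge h T C c (k c))"

text \<open>The violated edges form a matching, because the cell of either end determines the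
  direction, and a monotone \<open>g\<close> errs at one end of each.\<close>

lemma rel_dist_no_fun:
  assumes g: "monotone_fun (4*h) g"
  shows "real (card (violations h T C k)) / real (card (ones (4*h) (no_fun h T C k)))
    \<le> rel_dist (4*h) (no_fun h T C k) g"
proof -
  let ?f = "no_fun h T C k" and ?n = "4*h"
  define c where "c x = (THE c. in_cell h T C x c)" for x
  define up where "up x = x(k (c x) := True)" for x
  have c_eq: "c x = c'" if "in_cell h T C x c'" for x c'
    unfolding c_def using that in_cell_unique by blast
  have V: "x \<in> layer ?n (3*h) \<and> in_cell h T C x (c x) \<and> k (c x) < ?n \<and> \<not> x (k (c x)) \<and>
      in_cell h T C (up x) (c x)" if "x \<in> violations h T C k" for x
    using that c_eq unfolding violations_def cell_edge_def up_def by auto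
  \<comment> \<open>The end at which \<open>g\<close> errs: if \<open>g x\<close> holds then so does
    \<open>g (up x)\<close>, where the no-function is 0; otherwise \<open>g\<close> misses the 1 at
    \<open>x\<close>.\<close>
  define \<phi> where "\<phi> x = (if g x then up x else x)" for x
  have up_layer: "up x \<in> layer ?n (3*h + 1)" if "x \<in> violations h T C k" for x
    using V[OF that] by (auto simp: layer_def up_def supp_insert fun_upd_cube) (simp add: supp_def)
  have c_up: "c (up x) = c x" if "x \<in> violations h T C k" for x
    using V[OF that] c_eq by blast
  have inj: "inj_on \<phi> (violations h T C k)"
  proof (rule inj_onI)
    fix x x' assume x: "x \<in> violations h T C k" "x' \<in> violations h T C k" and eq: "\<phi> x = \<phi> x'"
    have "layer ?n (3*h) \<inter> layer ?n (3*h + 1) = {}"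
      by (auto simp: layer_def)
    then have "g x = g x'"
      using eq up_layer[OF x(1)] up_layer[OF x(2)] V[OF x(1)] V[OF x(2)]
      unfolding \<phi>_def by (auto split: if_splits)
    moreover have "x = x'" if "up x = up x'"
    proof -
      have "c x = c x'"
        using c_up x that by metis
      then have "(up x)(k (c x) := False) = (up x')(k (c x') := False)"
        using that by simp
      moreover have "(up x)(k (c x) := False) = x" "(up x')(k (c x') := False) = x'"
        using V[OF x(1)] V[OF x(2)] by (simp_all add: up_def fun_upd_idem)
      ultimately show ?thesis by simp
    qed
    ultimately show "x = x'"
      using eq unfolding \<phi>_def by (auto split: if_splits)
  qed
  have im: "\<phi> ` violations h T C k \<subseteq> sym_diff (ones ?n ?f) (ones ?n g)"
  proof
    fix z assume "z \<in> \<phi> ` violations h T C k"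
    then obtain x where x: "x \<in> violations h T C k" "z = \<phi> x" by blast
    note Vx = V[OF x(1)]
    have cube: "x \<in> cube ?n" "up x \<in> cube ?n"
      using Vx up_layer[OF x(1)] by (auto simp: layer_def)
    have "?f x" "\<not> ?f (up x)"
      using Vx by (auto simp: no_fun_def glue_in_cell) (simp add: up_def)
    moreover have "g (up x)" if "g x"
      using g cube that by (auto dest!: mono_onD[where r = x and s = "up x"] simp: up_def le_fun_def)
    ultimately show "z \<in> sym_diff (ones ?n ?f) (ones ?n g)"
      using cube x(2) unfolding \<phi>_def ones_def by auto
  qed
  have "card (violations h T C k) \<le> card (sym_diff (ones ?n ?f) (ones ?n g))"
    using inj im finite_cube by (intro card_inj_on_le) (auto simp: ones_def)
  then show ?thesis
    unfolding rel_dist_def by (intro divide_right_mono) auto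
qed

lemma rel_dist_mono_no_fun:
  "real (card (violations h T C k)) / real (card (ones (4*h) (no_fun h T C k)))
    \<le> rel_dist_mono (4*h) (no_fun h T C k)"
  unfolding rel_dist_mono_def using rel_dist_values rel_dist_no_fun
  by (subst Min_ge_iff) auto

section \<open>Number of ones of the hard functions\<close>

lemma ones_glue_subset: "ones (4*h) (glue h T C v) \<subseteq> upper (4*h) (3*h)"
proof
  fix x assume "x \<in> ones (4*h) (glue h T C v)"
  then show "x \<in> upper (4*h) (3*h)"
    using glue_below[of h x T C v] by (auto simp: ones_def upper_def not_less[symmetric])
qed

lemma ones_glue_supset: "upper (4*h) (3*h + 2) \<subseteq> ones (4*h) (glue h T C v)"
  using glue_above by (auto simp: ones_def upper_def)

lemma layer_ratio: "(j + 1) * (n choose (j + 1)) = (n - j) * (n choose j)"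
  using binomial_absorb_comp[of n j] binomial_absorption[of j n] by (cases n) (simp_all add: binomial_eq_0)

text \<open>From weight \<open>3*h\<close> upwards the layer sizes at least halve with each step,
  since (4h - j) / (j + 1) is at most 1/2; the geometric series sums to at most 2.\<close>

lemma card_upper_le: "card (upper (4*h) (3*h)) \<le> 2 * (4*h choose (3*h))"
proof -
  let ?N = "4*h choose (3*h)"
  have step: "2 * (4*h choose Suc j) \<le> 4*h choose j" if "3*h \<le> j" for j
  proof (cases "h = 0")
    case False
    have "(j + 1) * (2 * (4*h choose Suc j)) = 2 * (4*h - j) * (4*h choose j)"
      using layer_ratio[of j "4*h"] by simp
    also have "\<dots> \<le> (j + 1) * (4*h choose j)"
      using that False by (intro mult_right_mono) auto
    finally show ?thesis
      by (metis Suc_eq_plus1 mult_le_cancel1 zero_less_Suc)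
  qed simp
  have pow: "2 ^ i * (4*h choose (3*h + i)) \<le> ?N" for i
  proof (induction i)
    case (Suc i)
    have "2 ^ Suc i * (4*h choose (3*h + Suc i)) = 2 ^ i * (2 * (4*h choose Suc (3*h + i)))"
      by simp
    also have "\<dots> \<le> 2 ^ i * (4*h choose (3*h + i))"
      using step[of "3*h + i"] by (intro mult_left_mono) auto
    finally show ?case using Suc by linarith
  qed simp
  have "upper (4*h) (3*h) \<subseteq> (\<Union>i\<in>{..h}. layer (4*h) (3*h + i))"
  proof
    fix x assume x: "x \<in> upper (4*h) (3*h)"
    then have "x \<in> layer (4*h) (3*h + (card (supp (4*h) x) - 3*h))" "card (supp (4*h) x) - 3*h \<le> h"
      using card_supp_le[of "4*h" x] by (auto simp: upper_def layer_def)
    then show "x \<in> (\<Union>i\<in>{..h}. layer (4*h) (3*h + i))"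
      by blast
  qed
  then have "card (upper (4*h) (3*h)) \<le> card (\<Union>i\<in>{..h}. layer (4*h) (3*h + i))"
    by (intro card_mono) auto
  also have "\<dots> \<le> (\<Sum>i\<le>h. card (layer (4*h) (3*h + i)))"
    by (intro card_UN_le) simp
  finally have "card (upper (4*h) (3*h)) \<le> (\<Sum>i\<le>h. card (layer (4*h) (3*h + i)))" .
  then have "real (card (upper (4*h) (3*h))) \<le> (\<Sum>i\<le>h. real (4*h choose (3*h + i)))"
    by (simp add: card_layer flip: of_nat_sum)
  also have "\<dots> \<le> (\<Sum>i\<le>h. real ?N * (1/2) ^ i)"
  proof (rule sum_mono)
    fix i
    have "real (2 ^ i * (4*h choose (3*h + i))) \<le> real ?N"
      using pow[of i] by (simp only: of_nat_le_iff)
    then show "real (4*h choose (3*h + i)) \<le> real ?N * (1/2) ^ i"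
      by (simp add: power_one_over field_simps)
  qed
  also have "\<dots> = real ?N * (\<Sum>i\<le>h. (1/2) ^ i)"
    by (simp add: sum_distrib_left)
  also have "(\<Sum>i\<le>h. (1/2::real) ^ i) \<le> 2"
    using sum_gp_strict[of "1/2::real" "Suc h"] by (simp add: lessThan_Suc_atMost)
  finally show ?thesis
    by (simp add: mult_left_mono mult.commute flip: of_nat_le_iff[where 'a = real])
qed

text \<open>Layer \<open>3*h + 2\<close> alone suffices: each of the two steps up from layer
  \<open>3*h\<close> shrinks the size by a factor of at most 4.\<close>

lemma card_upper_ge:
  assumes "h \<ge> 8"
  shows "(4*h choose (3*h)) \<le> 16 * card (upper (4*h) (3*h + 2))"
proof -
  let ?N = "\<lambda>i. real (4*h choose (3*h + i))"
  have 1: "(3*h + 1) * ?N 1 = h * ?N 0"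
    using arg_cong[OF layer_ratio[of "3*h" "4*h"], of real] by (simp add: algebra_simps)
  have 2: "(3*h + 2) * ?N 2 = (h - 1) * ?N 1"
    using arg_cong[OF layer_ratio[of "3*h + 1" "4*h"], of real] assms by (simp add: of_nat_diff algebra_simps)
  have "16 * ?N 2 \<ge> ?N 0"
  proof -
    have a: "4 * ?N 1 \<ge> ?N 0"
    proof -
      have "real h * (4 * ?N 1) \<ge> (3*h + 1) * ?N 1"
        using assms unfolding mult.assoc[symmetric] by (intro mult_right_mono) auto
      then have "real h * (4 * ?N 1) \<ge> real h * ?N 0"
        using 1 by simp
      then show ?thesis
        using assms by simp
    qed
    have b: "4 * ?N 2 \<ge> ?N 1"
    proof -
      have "real (h - 1) * (4 * ?N 2) \<ge> (3*h + 2) * ?N 2"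
        using assms unfolding mult.assoc[symmetric] by (intro mult_right_mono) (auto simp: of_nat_diff)
      then have "real (h - 1) * (4 * ?N 2) \<ge> real (h - 1) * ?N 1"
        using 2 by simp
      then show ?thesis
        using assms by simp
    qed
    show ?thesis
      using a b by linarith
  qed
  moreover have "card (layer (4*h) (3*h + 2)) \<le> card (upper (4*h) (3*h + 2))"
    by (intro card_mono finite_upper) (auto simp: layer_def upper_def)
  ultimately show ?thesis
    by (simp add: card_layer)
qed


section \<open>Queries rarely flip many unknown coordinates\<close>

text \<open>A uniform function stays uniform if one value is replaced by a fresh one; swapping old
  and new value is an involution on the pairs \<open>(w, r)\<close>. This isolates the randomness of
  a single term, clause or key.\<close>

lemma sum_PiE_resample:
  fixes \<phi> :: "('a \<Rightarrow> 'b) \<Rightarrow> real"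
  assumes "a \<in> I"
  shows "(\<Sum>w\<in>I \<rightarrow>\<^sub>E A. \<Sum>r\<in>A. \<phi> (w(a := r))) = real (card A) * (\<Sum>w\<in>I \<rightarrow>\<^sub>E A. \<phi> w)"
proof -
  have mem: "w(a := r) \<in> I \<rightarrow>\<^sub>E A" if "w \<in> I \<rightarrow>\<^sub>E A" "r \<in> A" for w r
    using that assms by (auto simp: PiE_def extensional_def)
  have "(\<Sum>w\<in>I \<rightarrow>\<^sub>E A. \<Sum>r\<in>A. \<phi> (w(a := r))) = (\<Sum>(w, r)\<in>(I \<rightarrow>\<^sub>E A) \<times> A. \<phi> (w(a := r)))"
    by (simp add: sum.cartesian_product)
  also have "\<dots> = (\<Sum>(w, r)\<in>(I \<rightarrow>\<^sub>E A) \<times> A. \<phi> w)"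
    using assms mem
    by (intro sum.reindex_bij_witness[where i = "\<lambda>(w, r). (w(a := r), w a)" and j = "\<lambda>(w, r). (w(a := r), w a)"])
       (auto simp: PiE_mem)
  also have "\<dots> = real (card A) * (\<Sum>w\<in>I \<rightarrow>\<^sub>E A. \<phi> w)"
    by (simp add: sum.cartesian_product[symmetric] sum_distrib_left)
  finally show ?thesis .
qed

text \<open>A point of layer \<open>3*h\<close> satisfies a uniform term with probability 2^-h and
  falsifies a uniform clause with probability 2^-(3h). The numbers of terms, and of clauses per
  term, make both expectations 1.\<close>

definition terms :: "nat \<Rightarrow> (nat \<Rightarrow> nat set) set" where
  "terms h = ({..<2^h} \<rightarrow>\<^sub>E Pow {..<4*h})"

definition clauses :: "nat \<Rightarrow> (nat \<times> nat \<Rightarrow> nat set) set" where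
  "clauses h = ({..<2^h} \<times> {..<2^(3*h)} \<rightarrow>\<^sub>E Pow {..<4*h})"

definition keys :: "nat \<Rightarrow> (nat \<times> nat \<Rightarrow> nat) set" where
  "keys h = ({..<2^h} \<times> {..<2^(3*h)} \<rightarrow>\<^sub>E {..<4*h})"

lemma finite_terms [simp]: "finite (terms h)" and finite_clauses [simp]: "finite (clauses h)"
  and finite_keys [simp]: "finite (keys h)"
  by (auto simp: terms_def clauses_def keys_def intro!: finite_PiE)

text \<open>
  The value of a glued function at \<open>x\<close> depends on \<open>T i\<close> only through whether \<open>x\<close> satisfies term \<open>i\<close>,
  and not at all if two other terms are satisfied; similarly for clauses. Hence a query outside the
  gate reveals nothing, and a query inside the gate of a clause of term \<open>i\<close> falsifies at most one
  other clause.
\<close>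

definition gateT :: "nat \<Rightarrow> (nat \<Rightarrow> nat set) \<Rightarrow> nat \<Rightarrow> point \<Rightarrow> bool" where
  "gateT h T i x \<longleftrightarrow> band h x \<and> card (sat h T x - {i}) \<le> 1"

definition gateC :: "nat \<Rightarrow> (nat \<Rightarrow> nat set) \<Rightarrow> (nat \<times> nat \<Rightarrow> nat set) \<Rightarrow> nat \<times> nat \<Rightarrow> point \<Rightarrow> bool" where
  "gateC h T C c x \<longleftrightarrow> band h x \<and> sat h T x = {fst c} \<and> card (avd h C (fst c) x - {snd c}) \<le> 1"

text \<open>All queries inside a cell lie in the chain of its term and in that of its clause. A
  query with one other satisfied term is kept too: whether it lies in a cell of that other term
  depends on \<open>T i\<close>.\<close>

definition term_chain :: "nat \<Rightarrow> (nat \<Rightarrow> nat set) \<Rightarrow> nat \<Rightarrow> point list \<Rightarrow> point list" where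
  "term_chain h T i qs = filter (\<lambda>x. gateT h T i x \<and> T i \<inter> zer (4*h) x = {}) qs"

definition clause_chain :: "nat \<Rightarrow> (nat \<Rightarrow> nat set) \<Rightarrow> (nat \<times> nat \<Rightarrow> nat set) \<Rightarrow> nat \<times> nat \<Rightarrow> point list \<Rightarrow> point list" where
  "clause_chain h T C c qs = filter (\<lambda>x. gateC h T C c x \<and> C c \<inter> supp (4*h) x = {}) qs"

lemma glue_cong:
  assumes "\<And>c. in_cell h T C x c \<longleftrightarrow> in_cell h T' C' x c"
  shows "glue h T C v x = glue h T' C' v x"
proof -
  have "in_cell h T C x = in_cell h T' C' x"
    using assms by (rule ext)
  then show ?thesis
    by (simp add: glue_def)
qed

lemma glue_cong_sat: "sat h T x = sat h T' x \<Longrightarrow> glue h T C v x = glue h T' C v x"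
  by (rule glue_cong) (simp add: in_cell_def)

lemma glue_cong_avd:
  "sat h T x = {i} \<Longrightarrow> avd h C i x = avd h C' i x \<Longrightarrow> glue h T C v x = glue h T C' v x"
  by (rule glue_cong) (auto simp: in_cell_def)

lemma sat_upd: "i < 2^h \<Longrightarrow>
    sat h (T(i := R)) x = (if R \<inter> zer (4*h) x = {} then insert i (sat h T x) else sat h T x - {i})"
  by (auto simp: sat_def)

lemma avd_upd: "j < 2^(3*h) \<Longrightarrow> avd h (C((i, j) := R)) i x =
    (if R \<inter> supp (4*h) x = {} then insert j (avd h C i x) else avd h C i x - {j})"
  by (auto simp: avd_def)

lemma avd_upd_other: "i \<noteq> i' \<Longrightarrow> avd h (C((i, j) := R)) i' x = avd h C i' x"
  by (auto simp: avd_def)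

lemma gateT_upd: "i < 2^h \<Longrightarrow> gateT h (T(i := R)) i = gateT h T i"
  by (intro ext) (simp add: gateT_def sat_upd)

lemma gateC_upd: "snd c < 2^(3*h) \<Longrightarrow> gateC h T (C(c := R)) c = gateC h T C c"
  by (cases c; intro ext) (simp add: gateC_def avd_upd)

lemma band_card_zer: "band h x \<Longrightarrow> h - 1 \<le> card (zer (4*h) x) \<and> card (zer (4*h) x) \<le> h"
  by (auto simp: band_def card_zer)

text \<open>With \<open>{}\<close> as term \<open>i\<close> every point satisfies it; with
  \<open>{..<4*h}\<close> no point of the band does, since \<open>2 \<le> h\<close> leaves each of
  them a zero. In the band but outside the gate two other terms are satisfied, so the point is in no
  cell whatever \<open>T i\<close> is.\<close>

lemma hidden_term:
  assumes h: "2 \<le> h" and i: "i < 2^h"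
  shows "hidden_set (4*h) (zer (4*h)) (gateT h T i) (\<lambda>R. glue h (T(i := R)) C v)
     (glue h (T(i := {})) C v) (glue h (T(i := {..<4*h})) C v)"
proof
  show "zer (4*h) x \<subseteq> {..<4*h}" for x
    by (rule zer_subset)
  fix R x assume R: "R \<in> Pow {..<4*h}"
  show "glue h (T(i := R)) C v x = (if gateT h T i x \<and> R \<inter> zer (4*h) x = {}
      then glue h (T(i := {})) C v x else glue h (T(i := {..<4*h})) C v x)"
  proof (cases "band h x")
    case False
    then have "glue h T C v x = (3*h < card (supp (4*h) x))" for T
      by (intro glue_no_cell) (auto simp: in_cell_def)
    then show ?thesis by simp
  next
    case True
    have zer: "zer (4*h) x \<noteq> {}"
      using band_card_zer[OF True] h by auto
    have full: "{..<4*h} \<inter> zer (4*h) x = zer (4*h) x"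
      using zer_subset by blast
    show ?thesis
    proof (cases "R \<inter> zer (4*h) x = {}")
      case in_term: True
      show ?thesis
      proof (cases "gateT h T i x")
        case True
        have "glue h (T(i := R)) C v x = glue h (T(i := {})) C v x"
          using i in_term by (intro glue_cong_sat) (simp add: sat_upd)
        with True in_term show ?thesis by simp
      next
        case False
        have nc: "\<not> in_cell h (T(i := R)) C x c" for R c
        proof
          assume "in_cell h (T(i := R)) C x c"
          then have "sat h (T(i := R)) x - {i} \<subseteq> {fst c}"
            by (auto simp: in_cell_def)
          moreover have "sat h (T(i := R)) x - {i} = sat h T x - {i}"
            using i by (auto simp: sat_upd)
          ultimately have "card (sat h T x - {i}) \<le> 1"
            using card_mono[of "{fst c}" "sat h T x - {i}"] by simp
          then show False
            using False \<open>band h x\<close> by (simp add: gateT_def)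
        qed
        have "glue h (T(i := R)) C v x = glue h (T(i := {..<4*h})) C v x"
          by (intro glue_cong) (simp add: nc)
        with False show ?thesis by simp
      qed
    next
      case False
      have "glue h (T(i := R)) C v x = glue h (T(i := {..<4*h})) C v x"
        using i False zer full by (intro glue_cong_sat) (simp add: sat_upd)
      with False show ?thesis by simp
    qed
  qed
qed

text \<open>The dual of \<open>hidden_term\<close>, with supports in place of zero sets. Clause
  \<open>c\<close> has no influence unless \<open>fst c\<close> is the only satisfied term, nor if
  two other clauses of that term are falsified.\<close>

lemma hidden_clause:
  assumes h: "1 \<le> h" and c: "snd c < 2^(3*h)"
  shows "hidden_set (4*h) (supp (4*h)) (gateC h T C c) (\<lambda>R. glue h T (C(c := R)) v)
     (glue h T (C(c := {})) v) (glue h T (C(c := {..<4*h})) v)"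
proof
  show "supp (4*h) x \<subseteq> {..<4*h}" for x
    by (rule supp_subset)
  fix R x assume R: "R \<in> Pow {..<4*h}"
  obtain i j where ij: "c = (i, j)" by fastforce
  show "glue h T (C(c := R)) v x = (if gateC h T C c x \<and> R \<inter> supp (4*h) x = {}
      then glue h T (C(c := {})) v x else glue h T (C(c := {..<4*h})) v x)"
  proof (cases "band h x \<and> sat h T x = {i}")
    case False
    have "glue h T (C(c := R)) v x = glue h T (C(c := R')) v x" for R R'
      using False unfolding ij
      by (intro glue_cong) (auto simp: in_cell_def avd_upd_other)
    moreover have "\<not> gateC h T C c x"
      using False by (auto simp: gateC_def ij)
    ultimately show ?thesis by metis
  next
    case True
    have supp: "supp (4*h) x \<noteq> {}"
      using True h by (auto simp: band_def)
    have full: "{..<4*h} \<inter> supp (4*h) x = supp (4*h) x"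
      using supp_subset by blast
    have j: "j < 2^(3*h)"
      using c by (simp add: ij)
    show ?thesis
    proof (cases "R \<inter> supp (4*h) x = {}")
      case in_clause: True
      show ?thesis
      proof (cases "gateC h T C c x")
        case gate: True
        have "glue h T (C(c := R)) v x = glue h T (C(c := {})) v x"
          using True j in_clause unfolding ij by (intro glue_cong_avd[of h T x i]) (simp_all add: avd_upd)
        then show ?thesis
          using gate in_clause by simp
      next
        case False
        have nc: "\<not> in_cell h T (C(c := R)) x c'" for R c'
        proof
          assume *: "in_cell h T (C(c := R)) x c'"
          then have "fst c' = i"
            using True by (simp add: in_cell_def)
          then have "avd h (C(c := R)) i x - {j} \<subseteq> {snd c'}"
            using * by (auto simp: in_cell_def)
          moreover have "avd h (C(c := R)) i x - {j} = avd h C i x - {j}"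
            using j unfolding ij by (auto simp: avd_upd)
          ultimately have "card (avd h C i x - {j}) \<le> 1"
            using card_mono[of "{snd c'}" "avd h C i x - {j}"] by simp
          then show False
            using False True by (simp add: gateC_def ij)
        qed
        have "glue h T (C(c := R)) v x = glue h T (C(c := {..<4*h})) v x"
          by (intro glue_cong) (simp add: nc)
        then show ?thesis
          using False by simp
      qed
    next
      case False
      have "glue h T (C(c := R)) v x = glue h T (C(c := {..<4*h})) v x"
        using True j False supp full unfolding ij by (intro glue_cong_avd[of h T x i]) (simp_all add: avd_upd)
      then show ?thesis
        using False by simp
    qed
  qed
qed

section \<open>Union bound over terms and clauses\<close>

definition good_run :: "nat \<Rightarrow> nat \<Rightarrow> (nat \<Rightarrow> nat set) \<Rightarrow> (nat \<times> nat \<Rightarrow> nat set) \<Rightarrow> point list \<Rightarrow> bool" where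
  "good_run h K T C qs \<longleftrightarrow> (\<forall>i<2^h. chain_ok K (zer (4*h)) (term_chain h T i qs)) \<and>
     (\<forall>c\<in>{..<2^h} \<times> {..<2^(3*h)}. chain_ok K (supp (4*h)) (clause_chain h T C c qs))"

lemma card_filter_eq_sum: "finite A \<Longrightarrow> real (card {a \<in> A. P a}) = (\<Sum>a\<in>A. of_bool (P a))"
  by (simp add: sum_of_bool_eq Int_def)

context
  fixes h Q K :: nat and t :: dtree and v :: "nat \<times> nat \<Rightarrow> point \<Rightarrow> bool"
  assumes h: "2 \<le> h" and depth: "depth t \<le> Q"
begin

abbreviation F :: "(nat \<Rightarrow> nat set) \<Rightarrow> (nat \<times> nat \<Rightarrow> nat set) \<Rightarrow> point list" where
  "F T C \<equiv> queried (glue h T C v) t"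

lemma pow_n_minus: "2 ^ (4*h - (h - 1)) = (2 ^ (3*h + 1) :: real)"
  using h by (intro arg_cong[where f = "\<lambda>k. 2 ^ k"]) auto

lemma length_filter_queried: "length (filter P (queried g t)) \<le> Q"
  using length_filter_le[of P "queried g t"] length_queried[of g t] depth by linarith

text \<open>Only term \<open>i\<close> is resampled. Each of at most \<open>Q\<close> candidates for
  the first member satisfies it with probability at most 2 / 2^h, the factor 2 stemming from the
  \<open>h - 1\<close> zeros on layer \<open>3*h + 1\<close>; a later jump costs a factor
  \<open>Q / 2^K\<close>.\<close>

lemma sum_term_bad_le:
  assumes i: "i < 2^h"
  shows "(\<Sum>T\<in>terms h. of_bool (\<not> chain_ok K (zer (4*h)) (term_chain h T i (F T C))))
    \<le> 2 * real Q ^ 2 / 2 ^ K / 2 ^ h * real (card (terms h))"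
proof -
  let ?bad = "\<lambda>T. \<not> chain_ok K (zer (4*h)) (term_chain h T i (F T C))"
  let ?B = "real Q * (real Q / 2 ^ K * 2 ^ (3*h + 1))"
  have one: "(\<Sum>R\<in>Pow {..<4*h}. of_bool (?bad (T(i := R)))) \<le> ?B" for T
  proof -
    interpret hidden_set "4*h" K "zer (4*h)" "gateT h T i" "\<lambda>R. glue h (T(i := R)) C v"
      "glue h (T(i := {})) C v" "glue h (T(i := {..<4*h})) C v"
      using h i by (rule hidden_term)
    have "real (card {R \<in> Pow {..<4*h}. \<not> chain_ok K (zer (4*h)) (members R t)})
       \<le> real (length (filter (gateT h T i) (queried (glue h (T(i := {..<4*h})) C v) t))) * (real Q / 2 ^ K * 2 ^ (4*h - (h - 1)))"
      using depth band_card_zer by (intro card_chain_bad_le) (auto simp: gateT_def)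
    also have "\<dots> \<le> ?B"
      unfolding pow_n_minus by (intro mult_right_mono) (use length_filter_queried in auto)
    also have "(\<lambda>R. \<not> chain_ok K (zer (4*h)) (members R t)) = (\<lambda>R. ?bad (T(i := R)))"
      using i by (simp add: members_def term_chain_def gateT_upd)
    finally show ?thesis
      by (subst (asm) card_filter_eq_sum) auto
  qed
  have "2 ^ (4*h) * (\<Sum>T\<in>terms h. of_bool (?bad T) :: real) = (\<Sum>T\<in>terms h. \<Sum>R\<in>Pow {..<4*h}. of_bool (?bad (T(i := R))))"
    using sum_PiE_resample[of i "{..<2^h}" "\<lambda>T. of_bool (?bad T)" "Pow {..<4*h}"] i
    by (simp add: terms_def card_Pow)
  also have "\<dots> \<le> (\<Sum>T\<in>terms h. ?B)"
    by (intro sum_mono one)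
  also have "\<dots> = 2 ^ (4*h) * (2 * real Q ^ 2 / 2 ^ K / 2 ^ h * real (card (terms h)))"
  proof -
    have "(2::real) ^ (4*h) = 2 ^ (3*h) * 2 ^ h"
      by (simp flip: power_add)
    then show ?thesis
      by (simp add: power2_eq_square)
  qed
  finally show ?thesis
    by (rule mult_left_le_imp_le) simp
qed

text \<open>As in \<open>sum_term_bad_le\<close>, but without the jump. It supplies the factor 2^-h
  that the clause bound cannot gain from the clause itself.\<close>

lemma sum_term_hit_le:
  assumes i: "i < 2^h"
  shows "(\<Sum>T\<in>terms h. of_bool (term_chain h T i (F T C) \<noteq> [])) \<le> 2 * real Q / 2 ^ h * real (card (terms h))"
proof -
  let ?hit = "\<lambda>T. term_chain h T i (F T C) \<noteq> []"
  let ?B = "real Q * 2 ^ (3*h + 1)"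
  have one: "(\<Sum>R\<in>Pow {..<4*h}. of_bool (?hit (T(i := R)))) \<le> ?B" for T
  proof -
    interpret hidden_set "4*h" K "zer (4*h)" "gateT h T i" "\<lambda>R. glue h (T(i := R)) C v"
      "glue h (T(i := {})) C v" "glue h (T(i := {..<4*h})) C v"
      using h i by (rule hidden_term)
    have "card {R \<in> Pow {..<4*h}. members R t \<noteq> []} \<le> depth t * 2 ^ (4*h - (h - 1))"
      using band_card_zer by (intro card_members_nonempty_le) (auto simp: gateT_def)
    then have "real (card {R \<in> Pow {..<4*h}. members R t \<noteq> []}) \<le> real (depth t * 2 ^ (4*h - (h - 1)))"
      by (simp only: of_nat_le_iff)
    also have "\<dots> \<le> ?B"
      unfolding of_nat_mult of_nat_power of_nat_numeral pow_n_minus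
      using depth by (intro mult_right_mono) auto
    also have "(\<lambda>R. members R t \<noteq> []) = (\<lambda>R. ?hit (T(i := R)))"
      using i by (simp add: members_def term_chain_def gateT_upd)
    finally show ?thesis
      by (subst (asm) card_filter_eq_sum) auto
  qed
  have "2 ^ (4*h) * (\<Sum>T\<in>terms h. of_bool (?hit T) :: real) = (\<Sum>T\<in>terms h. \<Sum>R\<in>Pow {..<4*h}. of_bool (?hit (T(i := R))))"
    using sum_PiE_resample[of i "{..<2^h}" "\<lambda>T. of_bool (?hit T)" "Pow {..<4*h}"] i
    by (simp add: terms_def card_Pow)
  also have "\<dots> \<le> (\<Sum>T\<in>terms h. ?B)"
    by (intro sum_mono one)
  also have "\<dots> = 2 ^ (4*h) * (2 * real Q / 2 ^ h * real (card (terms h)))"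
  proof -
    have "(2::real) ^ (4*h) = 2 ^ (3*h) * 2 ^ h"
      by (simp flip: power_add)
    then show ?thesis
      by simp
  qed
  finally show ?thesis
    by (rule mult_left_le_imp_le) simp
qed

text \<open>A union bound over 2^(4h) clauses needs the factor 2^-(4h): the first member of the
  chain costs 2^-(3h), and 2^-h comes from the term, which some query must satisfy.\<close>

lemma sum_clause_bad_le:
  assumes c: "c \<in> {..<2^h} \<times> {..<2^(3*h)}"
  shows "(\<Sum>T\<in>terms h. \<Sum>C\<in>clauses h. of_bool (\<not> chain_ok K (supp (4*h)) (clause_chain h T C c (F T C))))
    \<le> 2 * real Q ^ 3 / 2 ^ K / 2 ^ (4*h) * real (card (terms h)) * real (card (clauses h))"
proof -
  let ?bad = "\<lambda>T C. \<not> chain_ok K (supp (4*h)) (clause_chain h T C c (F T C))"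
  let ?hit = "\<lambda>T C. term_chain h T (fst c) (F T C) \<noteq> []"
  let ?full = "\<lambda>C. C(c := {..<4*h})"
  let ?B = "real Q * (real Q / 2 ^ K * 2 ^ h)"
  have i: "fst c < 2^h" and j: "snd c < 2^(3*h)"
    using c by auto
  have one: "(\<Sum>R\<in>Pow {..<4*h}. of_bool (?bad T (C(c := R)))) \<le> ?B * of_bool (?hit T (?full C))" for T C
  proof -
    interpret hidden_set "4*h" K "supp (4*h)" "gateC h T C c" "\<lambda>R. glue h T (C(c := R)) v"
      "glue h T (C(c := {})) v" "glue h T (C(c := {..<4*h})) v"
      using h j by (intro hidden_clause) auto
    let ?L = "filter (gateC h T C c) (F T (?full C))"
    have "real (card {R \<in> Pow {..<4*h}. \<not> chain_ok K (supp (4*h)) (members R t)})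
       \<le> real (length ?L) * (real Q / 2 ^ K * 2 ^ (4*h - 3*h))"
      using depth by (intro card_chain_bad_le) (auto simp: gateC_def band_def)
    also have "\<dots> \<le> ?B * of_bool (?hit T (?full C))"
    \<comment> \<open>\<open>?L\<close> lists the gated queries on the path where clause
      \<open>c\<close> is never falsified. If it is empty, the bound is 0; otherwise some query lies
      in the chain of term \<open>fst c\<close>, an event that no longer involves
      \<open>C c\<close>.\<close>
    proof (cases "?L = []")
      case False
      have "?hit T (?full C)"
      proof -
        obtain x where x: "x \<in> set (F T (?full C))" "gateC h T C c x"
          using False by (auto simp: filter_empty_conv)
        then have "sat h T x = {fst c}" "band h x"
          by (auto simp: gateC_def)
        then have "gateT h T (fst c) x" "T (fst c) \<inter> zer (4*h) x = {}"
          by (auto simp: gateT_def sat_def)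
        then show ?thesis
          using x(1) by (auto simp: term_chain_def filter_empty_conv)
      qed
      moreover have "real (length ?L) \<le> real Q"
        using length_filter_queried by simp
      ultimately show ?thesis
        by (simp add: mult_right_mono divide_right_mono)
    qed simp
    also have "(\<lambda>R. \<not> chain_ok K (supp (4*h)) (members R t)) = (\<lambda>R. ?bad T (C(c := R)))"
      using j by (simp add: members_def clause_chain_def gateC_upd)
    finally show ?thesis
      by (subst (asm) card_filter_eq_sum) auto
  qed
  have "2 ^ (4*h) * (\<Sum>C\<in>clauses h. of_bool (?bad T C)) \<le> (\<Sum>C\<in>clauses h. ?B * of_bool (?hit T (?full C)))" for T
  proof -
    have "2 ^ (4*h) * (\<Sum>C\<in>clauses h. of_bool (?bad T C) :: real) = (\<Sum>C\<in>clauses h. \<Sum>R\<in>Pow {..<4*h}. of_bool (?bad T (C(c := R))))"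
      using sum_PiE_resample[OF c, of "\<lambda>C. of_bool (?bad T C)" "Pow {..<4*h}"]
      by (simp add: clauses_def card_Pow)
    also have "\<dots> \<le> (\<Sum>C\<in>clauses h. ?B * of_bool (?hit T (?full C)))"
      by (intro sum_mono one)
    finally show ?thesis .
  qed
  then have "2 ^ (4*h) * (\<Sum>T\<in>terms h. \<Sum>C\<in>clauses h. of_bool (?bad T C))
      \<le> (\<Sum>T\<in>terms h. \<Sum>C\<in>clauses h. ?B * of_bool (?hit T (?full C)))"
    unfolding sum_distrib_left[of "2 ^ (4*h)" _ "terms h"] by (intro sum_mono)
  \<comment> \<open>The order is exchanged so that the terms are averaged for fixed clauses;
    \<open>sum_term_hit_le\<close> holds for every \<open>C\<close>, in particular for the modified
    one.\<close>
  also have "\<dots> = (\<Sum>C\<in>clauses h. ?B * (\<Sum>T\<in>terms h. of_bool (?hit T (?full C))))"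
    by (subst sum.swap) (simp only: sum_distrib_left)
  also have "\<dots> \<le> (\<Sum>C\<in>clauses h. ?B * (2 * real Q / 2 ^ h * real (card (terms h))))"
    by (intro sum_mono mult_left_mono sum_term_hit_le i) auto
  also have "\<dots> = 2 ^ (4*h) * (2 * real Q ^ 3 / 2 ^ K / 2 ^ (4*h) * real (card (terms h)) * real (card (clauses h)))"
    by (simp add: power3_eq_cube)
  finally show ?thesis
    by (rule mult_left_le_imp_le) simp
qed

text \<open>The numbers 2^h of terms and 2^(4h) of clauses cancel exactly against the two bounds
  above, leaving \<open>2 Q^2 / 2^K + 2 Q^3 / 2^K\<close>.\<close>

lemma sum_bad_run_le:
  "(\<Sum>T\<in>terms h. \<Sum>C\<in>clauses h. of_bool (\<not> good_run h K T C (F T C)))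
    \<le> 4 * real Q ^ 3 / 2 ^ K * real (card (terms h)) * real (card (clauses h))"
proof -
  let ?I = "{..<2^h} :: nat set" and ?J = "{..<2^h} \<times> {..<2^(3*h)} :: (nat \<times> nat) set"
  let ?bT = "\<lambda>i T C. \<not> chain_ok K (zer (4*h)) (term_chain h T i (F T C))"
  let ?bC = "\<lambda>c T C. \<not> chain_ok K (supp (4*h)) (clause_chain h T C c (F T C))"
  let ?N = "real (card (terms h)) * real (card (clauses h))"
  have point: "of_bool (\<not> good_run h K T C (F T C)) \<le> (\<Sum>i\<in>?I. of_bool (?bT i T C)) + (\<Sum>c\<in>?J. of_bool (?bC c T C) :: real)" for T C
  proof (cases "good_run h K T C (F T C)")
    case True
    then show ?thesis by (auto intro!: add_nonneg_nonneg sum_nonneg)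
  next
    case False
    then consider i where "i \<in> ?I" "?bT i T C" | c where "c \<in> ?J" "?bC c T C"
      by (auto simp: good_run_def)
    then show ?thesis
    proof cases
      case 1
      then have "1 \<le> (\<Sum>i\<in>?I. of_bool (?bT i T C) :: real)"
        using member_le_sum[of i ?I "\<lambda>i. of_bool (?bT i T C) :: real"] by simp
      then show ?thesis
        using False by (simp add: add_increasing2 sum_nonneg)
    next
      case 2
      then have "1 \<le> (\<Sum>c\<in>?J. of_bool (?bC c T C) :: real)"
        using member_le_sum[of c ?J "\<lambda>c. of_bool (?bC c T C) :: real"] by simp
      then show ?thesis
        using False by (simp add: add_increasing sum_nonneg)
    qed
  qed
  have "(\<Sum>T\<in>terms h. \<Sum>C\<in>clauses h. of_bool (\<not> good_run h K T C (F T C)))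
     \<le> (\<Sum>T\<in>terms h. \<Sum>C\<in>clauses h. (\<Sum>i\<in>?I. of_bool (?bT i T C)) + (\<Sum>c\<in>?J. of_bool (?bC c T C) :: real))"
    by (intro sum_mono point)
  also have "\<dots> = (\<Sum>i\<in>?I. \<Sum>C\<in>clauses h. \<Sum>T\<in>terms h. of_bool (?bT i T C))
     + (\<Sum>c\<in>?J. \<Sum>T\<in>terms h. \<Sum>C\<in>clauses h. of_bool (?bC c T C))"
  proof -
    have "(\<Sum>T\<in>terms h. \<Sum>C\<in>clauses h. \<Sum>i\<in>?I. of_bool (?bT i T C) :: real)
        = (\<Sum>i\<in>?I. \<Sum>C\<in>clauses h. \<Sum>T\<in>terms h. of_bool (?bT i T C))"
      by (subst sum.swap, subst sum.swap[of _ "?I"], subst (2) sum.swap) simp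
    moreover have "(\<Sum>T\<in>terms h. \<Sum>C\<in>clauses h. \<Sum>c\<in>?J. of_bool (?bC c T C) :: real)
        = (\<Sum>c\<in>?J. \<Sum>T\<in>terms h. \<Sum>C\<in>clauses h. of_bool (?bC c T C))"
      by (subst sum.swap[of _ "?J"], subst sum.swap[of _ "?J"]) simp
    ultimately show ?thesis
      by (simp only: sum.distrib)
  qed
  also have "\<dots> \<le> (\<Sum>i\<in>?I. \<Sum>C\<in>clauses h. 2 * real Q ^ 2 / 2 ^ K / 2 ^ h * real (card (terms h)))
     + (\<Sum>c\<in>?J. 2 * real Q ^ 3 / 2 ^ K / 2 ^ (4*h) * real (card (terms h)) * real (card (clauses h)))"
    by (intro add_mono sum_mono sum_term_bad_le sum_clause_bad_le) auto
  also have "\<dots> = (2 * real Q ^ 2 / 2 ^ K + 2 * real Q ^ 3 / 2 ^ K) * ?N"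
  proof -
    have "(2::real) ^ (4*h) = 2 ^ h * 2 ^ (3*h)"
      by (simp flip: power_add)
    then show ?thesis
      by (simp add: card_cartesian_product distrib_left distrib_right mult_ac)
  qed
  also have "\<dots> \<le> (4 * real Q ^ 3 / 2 ^ K) * ?N"
  proof (intro mult_right_mono)
    have "real Q ^ 2 \<le> real Q ^ 3"
      by (cases "Q = 0") (auto intro!: power_increasing)
    then show "2 * real Q ^ 2 / 2 ^ K + 2 * real Q ^ 3 / 2 ^ K \<le> 4 * real Q ^ 3 / 2 ^ K"
      unfolding add_divide_distrib[symmetric] by (intro divide_right_mono) auto
  qed simp
  finally show ?thesis
    by (simp add: mult.assoc)
qed

end


section \<open>Comparison of transcripts\<close>

lemma sum_length_filter:
  assumes "finite A"
  shows "(\<Sum>c\<in>A. length (filter (P c) qs)) = (\<Sum>x\<leftarrow>qs. card {c \<in> A. P c x})"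
proof (induction qs)
  case (Cons x qs)
  have "(\<Sum>c\<in>A. length (filter (P c) (x # qs))) = (\<Sum>c\<in>A. (if P c x then 1 else 0) + length (filter (P c) qs))"
    by (intro sum.cong) auto
  also have "\<dots> = card {c \<in> A. P c x} + (\<Sum>c\<in>A. length (filter (P c) qs))"
    using assms by (simp only: sum.distrib card_eq_sum sum.inter_filter)
  finally show ?case
    using Cons by simp
qed simp

text \<open>At a gated query the satisfied term is unique and at most one further clause is
  falsified, so a query lies in at most two chains. Thus losses can be added up over exponentially
  many cells.\<close>

lemma sum_length_clause_chain_le:
  "(\<Sum>c\<in>{..<2^h} \<times> {..<2^(3*h)}. length (clause_chain h T C c qs)) \<le> 2 * length qs"
proof -
  let ?I = "{..<2^h} \<times> {..<2^(3*h)} :: (nat \<times> nat) set"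
  let ?P = "\<lambda>c x. gateC h T C c x \<and> C c \<inter> supp (4*h) x = {}"
  have "card {c \<in> ?I. ?P c x} \<le> 2" for x
  proof (cases "{c \<in> ?I. ?P c x} = {}")
    case False
    then obtain i j where c: "(i, j) \<in> ?I" "?P (i, j) x"
      by auto
    then have sat: "sat h T x = {i}" and card: "card (avd h C i x - {j}) \<le> 1"
      by (auto simp: gateC_def)
    have "{c \<in> ?I. ?P c x} \<subseteq> {i} \<times> avd h C i x"
      using sat by (auto simp: gateC_def avd_def)
    then have "card {c \<in> ?I. ?P c x} \<le> card ({i} \<times> avd h C i x)"
      by (intro card_mono) auto
    also have "\<dots> = card (avd h C i x)"
      by (simp add: card_cartesian_product)
    also have "\<dots> \<le> Suc (card (avd h C i x - {j}))"
      using diff_card_le_card_Diff[of "{j}" "avd h C i x"] by simp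
    also have "\<dots> \<le> 2"
      using card by simp
    finally show ?thesis .
  qed (simp only: card.empty)
  then have "(\<Sum>x\<leftarrow>qs. card {c \<in> ?I. ?P c x}) \<le> (\<Sum>x\<leftarrow>qs. 2)"
    by (intro sum_list_mono) auto
  then show ?thesis
    unfolding clause_chain_def
    by (subst sum_length_filter) (auto simp: sum_list_triv)
qed

text \<open>
  The constraints that a transcript of the yes-function with key \<open>k\<^sub>0\<close> puts on the key of cell \<open>c\<close>,
  for the yes- and for the no-functions.
\<close>

definition yes_keys :: "nat \<Rightarrow> (nat \<Rightarrow> nat set) \<Rightarrow> (nat \<times> nat \<Rightarrow> nat set) \<Rightarrow> (nat \<times> nat \<Rightarrow> nat) \<Rightarrow> point list \<Rightarrow> nat \<times> nat \<Rightarrow> nat set" where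
  "yes_keys h T C k\<^sub>0 qs c = {k \<in> {..<4*h}. \<forall>x\<in>set qs. in_cell h T C x c \<longrightarrow> (k < h) = (k\<^sub>0 c < h)}"

definition no_keys :: "nat \<Rightarrow> (nat \<Rightarrow> nat set) \<Rightarrow> (nat \<times> nat \<Rightarrow> nat set) \<Rightarrow> (nat \<times> nat \<Rightarrow> nat) \<Rightarrow> point list \<Rightarrow> nat \<times> nat \<Rightarrow> nat set" where
  "no_keys h T C k\<^sub>0 qs c = {k \<in> {..<4*h}. \<forall>x\<in>set qs. in_cell h T C x c \<longrightarrow> (\<not> x k) = (k\<^sub>0 c < h)}"

lemma glue_agree_iff:
  assumes "\<And>x. \<nexists>c. in_cell h T C x c \<Longrightarrow> g x = (3*h < card (supp (4*h) x))"
  shows "(\<forall>x\<in>set qs. glue h T C v x = g x) \<longleftrightarrow>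
    (\<forall>c\<in>{..<2^h} \<times> {..<2^(3*h)}. \<forall>x\<in>set qs. in_cell h T C x c \<longrightarrow> v c x = g x)" (is "?L \<longleftrightarrow> ?R")
proof
  assume ?L then show ?R
    using glue_in_cell by metis
next
  assume R: ?R
  show ?L
  proof
    fix x assume x: "x \<in> set qs"
    show "glue h T C v x = g x"
    proof (cases "\<exists>c. in_cell h T C x c")
      case True
      then obtain c where c: "in_cell h T C x c" by blast
      then show ?thesis
        using R x in_cell_less[OF c] glue_in_cell[OF c, of v] by metis
    next
      case False
      then show ?thesis
        using assms glue_no_cell by metis
    qed
  qed
qed

lemma PiE_Collect: "{f \<in> I \<rightarrow>\<^sub>E A. \<forall>c\<in>I. P c (f c)} = (\<Pi>\<^sub>E c\<in>I. {a \<in> A. P c a})"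
  by (rule set_eqI) (simp add: PiE_iff, blast)

text \<open>Answers outside the cells do not depend on the key, and an answer in cell
  \<open>c\<close> constrains \<open>k c\<close> only. So the consistent keys form a product set in
  both families and can be compared cell by cell.\<close>

lemma transcript_yes_set:
  assumes "t' = transcript (yes_fun h T C k\<^sub>0) t"
  shows "{k \<in> keys h. transcript (yes_fun h T C k) t = t'}
      = PiE ({..<2^h} \<times> {..<2^(3*h)}) (yes_keys h T C k\<^sub>0 (map fst t'))"
    and "{k \<in> keys h. transcript (no_fun h T C k) t = t'}
      = PiE ({..<2^h} \<times> {..<2^(3*h)}) (no_keys h T C k\<^sub>0 (map fst t'))"
proof -
  let ?I = "{..<2^h} \<times> {..<2^(3*h)} :: (nat \<times> nat) set"
  let ?y = "yes_fun h T C k\<^sub>0" and ?qs = "map fst t'"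
  have dflt: "?y x = (3*h < card (supp (4*h) x))" if "\<nexists>c. in_cell h T C x c" for x
    using glue_no_cell[OF that] by (simp add: yes_fun_def)
  have ans: "(x, a) \<in> set (transcript ?y t) \<Longrightarrow> a = ?y x" for x a
    by (induction t) (auto split: if_splits)
  have agree: "transcript g t = t' \<longleftrightarrow> (\<forall>x\<in>set ?qs. g x = ?y x)" for g
    unfolding assms transcript_eq_iff using ans by fastforce
  have yc: "?y x = (k\<^sub>0 c < h)" if "in_cell h T C x c" for x c
    using glue_in_cell[OF that] by (simp add: yes_fun_def)
  have "transcript (glue h T C v) t = t' \<longleftrightarrow>
      (\<forall>c\<in>?I. \<forall>x\<in>set ?qs. in_cell h T C x c \<longrightarrow> v c x = (k\<^sub>0 c < h))" for v
  proof -
    have "transcript (glue h T C v) t = t' \<longleftrightarrow> (\<forall>x\<in>set ?qs. glue h T C v x = ?y x)"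
      by (rule agree)
    also have "\<dots> \<longleftrightarrow> (\<forall>c\<in>?I. \<forall>x\<in>set ?qs. in_cell h T C x c \<longrightarrow> v c x = ?y x)"
      by (rule glue_agree_iff[OF dflt])
    also have "\<dots> \<longleftrightarrow> (\<forall>c\<in>?I. \<forall>x\<in>set ?qs. in_cell h T C x c \<longrightarrow> v c x = (k\<^sub>0 c < h))"
      by (intro ball_cong refl imp_cong) (simp only: yc)
    finally show ?thesis .
  qed
  note * = this
  show "{k \<in> keys h. transcript (yes_fun h T C k) t = t'} = PiE ?I (yes_keys h T C k\<^sub>0 ?qs)"
    unfolding yes_fun_def * keys_def yes_keys_def by (rule PiE_Collect)
  show "{k \<in> keys h. transcript (no_fun h T C k) t = t'} = PiE ?I (no_keys h T C k\<^sub>0 ?qs)"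
    unfolding no_fun_def * keys_def no_keys_def by (rule PiE_Collect)
qed

lemma card_keys_below:
  "card {k \<in> {..<4*h}. (k < h) = b} = (if b then h else 3*h)"
proof (cases b)
  case True
  then have "{k \<in> {..<4*h}. (k < h) = b} = {..<h}" by auto
  then show ?thesis using True by simp
next
  case False
  then have "{k \<in> {..<4*h}. (k < h) = b} = {h..<4*h}" by auto
  then show ?thesis using False by simp
qed

text \<open>Answers 1 force the key of the no-function out of the union \<open>W\<close> of
  supports, answers 0 out of the union \<open>V\<close> of zero sets. In a good run \<open>W\<close>
  has size at most \<open>3h + Km\<close>, and \<open>V\<close> at most \<open>h + KQ\<close> by the
  term chain and \<open>h + Km^2\<close> by the clause chain. The bound
  \<open>min(Q, m^2) \<le> m sqrt Q\<close> is what produces the exponent 2/3.\<close>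

lemma card_no_keys_ge:
  fixes qs :: "point list"
  assumes h: "1 \<le> h" and K: "1 \<le> K" and len: "length qs \<le> Q"
    and good: "good_run h K T C qs" and x: "x \<in> set qs" "in_cell h T C x c"
  defines "m \<equiv> length (clause_chain h T C c qs)"
  shows "(1 - real K * real m * sqrt (real Q) / real h) * card (yes_keys h T C k\<^sub>0 qs c) \<le> card (no_keys h T C k\<^sub>0 qs c)"
proof -
  let ?n = "4*h"
  let ?ch = "clause_chain h T C c qs" and ?th = "term_chain h T (fst c) qs"
  have c: "c \<in> {..<2^h} \<times> {..<2^(3*h)}"
    using in_cell_less[OF x(2)] .
  have mem: "y \<in> set ?ch \<and> y \<in> set ?th" if "y \<in> set qs" "in_cell h T C y c" for y
  proof -
    have *: "band h y" "sat h T y = {fst c}" "avd h C (fst c) y = {snd c}"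
      using that(2) by (auto simp: in_cell_def)
    then have "fst c \<in> sat h T y" "snd c \<in> avd h C (fst c) y"
      by auto
    then show ?thesis
      using * that(1) by (simp add: clause_chain_def term_chain_def gateC_def gateT_def sat_def avd_def)
  qed
  have band: "band h y" if "y \<in> set ?ch \<or> y \<in> set ?th" for y
    using that by (auto simp: clause_chain_def term_chain_def gateC_def gateT_def)
  have m: "1 \<le> m"
    using mem[OF x] unfolding m_def by (cases ?ch) auto
  have Q: "1 \<le> Q"
    using x(1) len by (cases qs) auto
  have le_ch: "card (supp ?n y) \<le> 3*h + 1" if "y \<in> set ?ch" for y
    using band[of y] that by (auto simp: band_def)
  define W where "W = (\<Union>y\<in>set ?ch. supp ?n y)"
  have W_sub: "W \<subseteq> {..<?n}"
    unfolding W_def using supp_subset by blast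
  have finW: "finite W"
    using W_sub finite_subset by blast
  have "card W \<le> (3*h + 1) + K * (m - 1)"
    unfolding W_def m_def
  proof (rule chain_ok_card_le[OF _ finite_supp le_ch])
    show "chain_ok K (supp ?n) ?ch"
      using good c unfolding good_run_def by blast
  qed
  \<comment> \<open>The extra 1 from layer \<open>3*h + 1\<close> is absorbed by the
    \<open>K\<close> saved on the first query.\<close>
  also have "\<dots> \<le> 3*h + K * m"
    using m K by (cases m) auto
  finally have W: "card W \<le> 3*h + K * m" .
  have yes: "yes_keys h T C k\<^sub>0 qs c = {k \<in> {..<?n}. (k < h) = (k\<^sub>0 c < h)}"
    using x by (auto simp: yes_keys_def)
  have Km: "real K * real m \<le> real K * real m * sqrt (real Q)"
    using Q mult_left_mono[of 1 "sqrt (real Q)" "real K * real m"] by simp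
  show ?thesis
  proof (cases "k\<^sub>0 c < h")
    case True
    have "{..<?n} - W \<subseteq> no_keys h T C k\<^sub>0 qs c"
      using True mem by (auto simp: no_keys_def W_def supp_def)
    then have "card ({..<?n} - W) \<le> card (no_keys h T C k\<^sub>0 qs c)"
      by (intro card_mono) (auto simp: no_keys_def)
    moreover have "card ({..<?n} - W) = ?n - card W"
      using W_sub finW by (simp add: card_Diff_subset)
    ultimately have "h \<le> card (no_keys h T C k\<^sub>0 qs c) + K * m"
      using W by linarith
    then have "real h \<le> real (card (no_keys h T C k\<^sub>0 qs c) + K * m)"
      by (simp only: of_nat_le_iff)
    then have "real h - real K * real m \<le> card (no_keys h T C k\<^sub>0 qs c)"
      by simp
    moreover have "(1 - real K * real m * sqrt (real Q) / real h) * card (yes_keys h T C k\<^sub>0 qs c) = real h - real K * real m * sqrt (real Q)"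
      using h True unfolding yes card_keys_below by (simp add: left_diff_distrib)
    ultimately show ?thesis
      using Km by linarith
  next
    case False
    define V where "V = (\<Union>y\<in>{y \<in> set qs. in_cell h T C y c}. zer ?n y)"
    have V_sub: "V \<subseteq> {..<?n}"
      unfolding V_def using zer_subset by blast
    have finV: "finite V"
      using V_sub finite_subset by blast
    have "{..<?n} - V \<subseteq> no_keys h T C k\<^sub>0 qs c"
      using False by (auto simp: no_keys_def V_def zer_def)
    then have "card ({..<?n} - V) \<le> card (no_keys h T C k\<^sub>0 qs c)"
      by (intro card_mono) (auto simp: no_keys_def)
    moreover have "card ({..<?n} - V) = ?n - card V"
      using V_sub finV by (simp add: card_Diff_subset)
    ultimately have no: "?n \<le> card (no_keys h T C k\<^sub>0 qs c) + card V"
      by linarith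
    \<comment> \<open>Through the term chain: at most \<open>h\<close> zeros at first, then at most
      \<open>K\<close> new ones per query.\<close>
    have V1: "card V \<le> h + K * Q"
    proof -
      have "card V \<le> card (\<Union>y\<in>set ?th. zer ?n y)"
        unfolding V_def using mem by (intro card_mono) auto
      also have "\<dots> \<le> h + K * (length ?th - 1)"
      proof (rule chain_ok_card_le[OF _ finite_zer])
        show "chain_ok K (zer ?n) ?th"
          using good c unfolding good_run_def by auto
      qed (use band band_card_zer in blast)
      also have "length ?th - 1 \<le> Q"
        using len length_filter_le[of _ qs] unfolding term_chain_def by (meson diff_le_self order_trans)
      finally show ?thesis by simp
    qed
    have V2: "card V \<le> h + m * (K * m)"
    proof -
      \<comment> \<open>A zero of a query in the cell lies outside \<open>W\<close>, where at most
        \<open>h\<close> indices remain, or in the part of \<open>W\<close> that the query misses,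
        of size at most \<open>K * m\<close> since its support has at least \<open>3*h\<close>
        elements.\<close>
      have "V \<subseteq> ({..<?n} - W) \<union> (\<Union>y\<in>set ?ch. W - supp ?n y)"
        unfolding V_def using mem by (auto simp: zer_eq)
      then have "card V \<le> card (({..<?n} - W) \<union> (\<Union>y\<in>set ?ch. W - supp ?n y))"
        using finW by (intro card_mono) auto
      also have "\<dots> \<le> card ({..<?n} - W) + card (\<Union>y\<in>set ?ch. W - supp ?n y)"
        by (rule card_Un_le)
      also have "card (\<Union>y\<in>set ?ch. W - supp ?n y) \<le> (\<Sum>y\<in>set ?ch. card (W - supp ?n y))"
        by (intro card_UN_le) auto
      also have "\<dots> \<le> (\<Sum>y\<in>set ?ch. K * m)"
      proof (intro sum_mono)
        fix y assume y: "y \<in> set ?ch"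
        then have "supp ?n y \<subseteq> W" "3*h \<le> card (supp ?n y)"
          using band[of y] by (auto simp: W_def band_def)
        then show "card (W - supp ?n y) \<le> K * m"
          using W by (simp add: card_Diff_subset)
      qed
      also have "\<dots> \<le> m * (K * m)"
        unfolding m_def using card_length[of ?ch] by simp
      also have "card ({..<?n} - W) \<le> h"
      proof -
        have "supp ?n x \<subseteq> W" "3*h \<le> card (supp ?n x)"
          using mem[OF x] band[of x] by (auto simp: W_def band_def)
        then have "3*h \<le> card W"
          using card_mono[OF finW] by (meson order_trans)
        then show ?thesis
          using W_sub finW by (simp add: card_Diff_subset)
      qed
      finally show ?thesis by simp
    qed
    have "real (card V) \<le> h + real K * (real m * sqrt (real Q))"
    \<comment> \<open>\<open>V2\<close> is used for short chains and \<open>V1\<close> for long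
      ones.\<close>
    proof (cases "real m \<le> sqrt Q")
      case True
      have "real (card V) \<le> real (h + m * (K * m))"
        using V2 by (simp only: of_nat_le_iff)
      also have "\<dots> \<le> h + real K * (real m * sqrt (real Q))"
        using True by (simp add: mult_left_mono mult.left_commute)
      finally show ?thesis .
    next
      case False
      have "real (card V) \<le> real (h + K * Q)"
        using V1 by (simp only: of_nat_le_iff)
      also have "\<dots> = h + real K * (sqrt (real Q) * sqrt (real Q))"
        by simp
      also have "\<dots> \<le> h + real K * (real m * sqrt (real Q))"
        using False by (intro add_mono mult_left_mono mult_right_mono) auto
      finally show ?thesis .
    qed
    then have "3 * real h - real K * (real m * sqrt (real Q)) \<le> card (no_keys h T C k\<^sub>0 qs c)"
      using no by linarith
    moreover have "(1 - real K * real m * sqrt (real Q) / real h) * card (yes_keys h T C k\<^sub>0 qs c) = 3*h - 3 * (real K * (real m * sqrt (real Q)))"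
      using h False unfolding yes card_keys_below by (simp add: left_diff_distrib)
    moreover have "0 \<le> real K * (real m * sqrt (real Q))"
      by simp
    ultimately show ?thesis
      by linarith
  qed
qed

text \<open>The losses \<open>l c\<close> of the cells combine by the Weierstrass product
  inequality, and their sum is controlled by \<open>sum_length_clause_chain_le\<close>. A cell
  without queries loses nothing.\<close>

lemma card_transcript_no_ge:
  assumes h: "1 \<le> h" and K: "1 \<le> K" and depth: "depth t \<le> Q"
    and t': "t' = transcript (yes_fun h T C k\<^sub>0) t" and good: "good_run h K T C (map fst t')"
    and small: "2 * real K * real Q * sqrt (real Q) / real h \<le> 1"
  shows "(1 - 2 * real K * real Q * sqrt (real Q) / real h) * card {k \<in> keys h. transcript (yes_fun h T C k) t = t'}
    \<le> card {k \<in> keys h. transcript (no_fun h T C k) t = t'}"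
proof -
  let ?I = "{..<2^h} \<times> {..<2^(3*h)} :: (nat \<times> nat) set" and ?qs = "map fst t'"
  let ?A = "yes_keys h T C k\<^sub>0 ?qs" and ?B = "no_keys h T C k\<^sub>0 ?qs"
  have len: "length ?qs \<le> Q"
    using length_queried[of "yes_fun h T C k\<^sub>0" t] depth by (simp add: queried_def t')
  define l where "l c = real K * real (length (clause_chain h T C c ?qs)) * sqrt (real Q) / real h" for c
  have l0: "0 \<le> l c" for c
    by (simp add: l_def)
  have "(\<Sum>c\<in>?I. l c) = real K * sqrt (real Q) / real h * real (\<Sum>c\<in>?I. length (clause_chain h T C c ?qs))"
    unfolding l_def of_nat_sum sum_distrib_left by (intro sum.cong) auto
  also have "\<dots> \<le> real K * sqrt (real Q) / real h * real (2 * length ?qs)"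
    using sum_length_clause_chain_le[of h T C ?qs] by (intro mult_left_mono) (simp_all only: of_nat_le_iff, simp)
  also have "\<dots> \<le> real K * sqrt (real Q) / real h * real (2 * Q)"
    using len by (intro mult_left_mono) auto
  also have "\<dots> = 2 * real K * real Q * sqrt (real Q) / real h"
    by simp
  finally have sum_l: "(\<Sum>c\<in>?I. l c) \<le> 2 * real K * real Q * sqrt (real Q) / real h" .
  have l1: "l c \<le> 1" if "c \<in> ?I" for c
    using member_le_sum[OF that, of l] l0 sum_l small by fastforce
  have cell: "(1 - l c) * card (?A c) \<le> card (?B c)" for c
  proof (cases "\<exists>x\<in>set ?qs. in_cell h T C x c")
    case True
    then obtain x where "x \<in> set ?qs" "in_cell h T C x c" by blast
    then show ?thesis
      unfolding l_def using card_no_keys_ge[OF h K len good] by blast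
  next
    case False
    then have "?A c = ?B c"
      by (auto simp: yes_keys_def no_keys_def)
    then show ?thesis
      using l0[of c] mult_right_mono[of "1 - l c" 1 "real (card (?B c))"] by simp
  qed
  have "(1 - 2 * real K * real Q * sqrt (real Q) / real h) * (\<Prod>c\<in>?I. real (card (?A c))) \<le> (1 - (\<Sum>c\<in>?I. l c)) * (\<Prod>c\<in>?I. real (card (?A c)))"
    using sum_l by (intro mult_right_mono prod_nonneg) auto
  also have "\<dots> \<le> (\<Prod>c\<in>?I. 1 - l c) * (\<Prod>c\<in>?I. real (card (?A c)))"
    using l0 l1 by (intro mult_right_mono Weierstrass_prod_ineq prod_nonneg) auto
  also have "\<dots> = (\<Prod>c\<in>?I. (1 - l c) * real (card (?A c)))"
    by (simp only: prod.distrib)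
  also have "\<dots> \<le> (\<Prod>c\<in>?I. real (card (?B c)))"
    using cell l1 by (intro prod_mono) auto
  finally show ?thesis
    unfolding transcript_yes_set[OF t'] by (simp only: card_PiE finite_cartesian_product finite_lessThan of_nat_prod)
qed

text \<open>The verdict of a tree depends only on the transcript. Grouping the accepting keys by
  transcript reduces the claim to \<open>card_transcript_no_ge\<close>; distinct transcripts have
  disjoint sets of no-keys.\<close>

lemma card_accept_no_ge:
  assumes h: "1 \<le> h" and K: "1 \<le> K" and depth: "depth t \<le> Q"
    and small: "2 * real K * real Q * sqrt (real Q) / real h \<le> 1"
  shows "(1 - 2 * real K * real Q * sqrt (real Q) / real h) *
      card {k \<in> keys h. eval (yes_fun h T C k) t \<and> good_run h K T C (queried (yes_fun h T C k) t)}
    \<le> card {k \<in> keys h. eval (no_fun h T C k) t}"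
proof -
  let ?tr = "\<lambda>k. transcript (yes_fun h T C k) t" and ?tr' = "\<lambda>k. transcript (no_fun h T C k) t"
  define G where "G = {k \<in> keys h. eval (yes_fun h T C k) t \<and> good_run h K T C (queried (yes_fun h T C k) t)}"
  have fin: "finite G"
    by (simp add: G_def)
  have "real (card G) = (\<Sum>t'\<in>?tr ` G. real (card {k \<in> G. ?tr k = t'}))"
    using sum.group[of G "?tr ` G" ?tr "\<lambda>_. 1::nat"] fin by (simp flip: of_nat_sum)
  also have "\<dots> \<le> (\<Sum>t'\<in>?tr ` G. real (card {k \<in> keys h. ?tr k = t'}))"
    by (intro sum_mono of_nat_mono card_mono) (auto simp: G_def)
  finally have "(1 - 2 * real K * real Q * sqrt (real Q) / real h) * card G
      \<le> (1 - 2 * real K * real Q * sqrt (real Q) / real h) * (\<Sum>t'\<in>?tr ` G. real (card {k \<in> keys h. ?tr k = t'}))"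
    using small by (intro mult_left_mono) auto
  also have "\<dots> \<le> (\<Sum>t'\<in>?tr ` G. real (card {k \<in> keys h. ?tr' k = t'}))"
    unfolding sum_distrib_left
  proof (intro sum_mono)
    fix t' assume "t' \<in> ?tr ` G"
    then obtain k\<^sub>0 where k0: "t' = ?tr k\<^sub>0" "good_run h K T C (map fst t')"
      by (auto simp: G_def queried_def)
    show "(1 - 2 * real K * real Q * sqrt (real Q) / real h) * card {k \<in> keys h. ?tr k = t'} \<le> card {k \<in> keys h. ?tr' k = t'}"
      by (rule card_transcript_no_ge[OF h K depth k0 small])
  qed
  also have "\<dots> = real (card (\<Union>t'\<in>?tr ` G. {k \<in> keys h. ?tr' k = t'}))"
    using fin by (subst card_UN_disjoint) auto
  also have "\<dots> \<le> real (card {k \<in> keys h. eval (no_fun h T C k) t})"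
  proof (intro of_nat_mono card_mono)
    show "(\<Union>t'\<in>?tr ` G. {k \<in> keys h. ?tr' k = t'}) \<subseteq> {k \<in> keys h. eval (no_fun h T C k) t}"
    proof
      fix k assume "k \<in> (\<Union>t'\<in>?tr ` G. {k \<in> keys h. ?tr' k = t'})"
      then obtain k' where "k' \<in> G" "k \<in> keys h" "?tr' k = ?tr k'"
        by auto
      then show "k \<in> {k \<in> keys h. eval (no_fun h T C k) t}"
        using eval_cong_transcript[of "no_fun h T C k" t "yes_fun h T C k'"] by (simp add: G_def)
    qed
  qed simp
  finally show ?thesis
    by (simp add: G_def)
qed


section \<open>Distance of the no-functions\<close>

lemma card_PiE_ratio:
  assumes "finite I" "finite A" "A \<noteq> {}"
  shows "real (card (PiE I f)) = real (card (I \<rightarrow>\<^sub>E A)) * (\<Prod>c\<in>I. real (card (f c)) / real (card A))"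
  using assms by (simp add: card_PiE prod_dividef card_eq_0_iff)

lemma card_avoiding_ratio:
  assumes "D \<subseteq> {..<n}"
  shows "real (card {R \<in> Pow {..<n}. R \<inter> D = {}}) / 2 ^ n = 1 / 2 ^ card D"
proof -
  have "card D \<le> n"
    using card_mono[OF _ assms] by simp
  then have "(2::real) ^ n = 2 ^ (n - card D) * 2 ^ card D"
    by (simp flip: power_add)
  then show ?thesis
    using card_avoiding[OF assms] by simp
qed

lemma card_meeting_ratio:
  assumes "D \<subseteq> {..<n}"
  shows "real (card {R \<in> Pow {..<n}. R \<inter> D \<noteq> {}}) / 2 ^ n = 1 - 1 / 2 ^ card D"
proof -
  have eq: "{R \<in> Pow {..<n}. R \<inter> D \<noteq> {}} = Pow {..<n} - {R \<in> Pow {..<n}. R \<inter> D = {}}"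
    by auto
  have "card {R \<in> Pow {..<n}. R \<inter> D = {}} \<le> card (Pow {..<n})"
    by (intro card_mono) auto
  then have "real (card {R \<in> Pow {..<n}. R \<inter> D \<noteq> {}}) = 2 ^ n - real (card {R \<in> Pow {..<n}. R \<inter> D = {}})"
    unfolding eq by (subst card_Diff_subset) (auto simp: card_Pow of_nat_diff)
  then show ?thesis
    using card_avoiding_ratio[OF assms] by (simp add: diff_divide_distrib)
qed

text \<open>The sequence starts at 1/4 and increases, because 1 - 1/2^k is at most the square of 1 -
  1/2^(k+1).\<close>

lemma one_minus_inverse_power_ge:
  assumes "1 \<le> k"
  shows "1 / 4 \<le> (1 - 1 / 2 ^ k :: real) ^ (2 ^ k)"
  using assms
proof (induction k rule: nat_induct_at_least)
  case base
  then show ?case by (simp add: power2_eq_square)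
next
  case (Suc k)
  have "1 / 4 \<le> (1 - 1 / 2 ^ k :: real) ^ (2 ^ k)"
    by (rule Suc.IH)
  also have "\<dots> \<le> ((1 - 1 / 2 ^ Suc k) ^ 2) ^ (2 ^ k)"
    by (intro power_mono) (auto simp: power2_eq_square algebra_simps)
  also have "\<dots> = (1 - 1 / 2 ^ Suc k :: real) ^ (2 ^ Suc k)"
    by (simp add: power_mult[symmetric])
  finally show ?case .
qed

lemma card_terms_pos: "0 < card (terms h)" and card_clauses_pos: "0 < card (clauses h)"
  and card_keys_pos: "1 \<le> h \<Longrightarrow> 0 < card (keys h)"
  by (auto simp: terms_def clauses_def keys_def card_gt_0_iff PiE_eq_empty_iff lessThan_empty_iff intro!: finite_PiE)

text \<open>\<open>D\<close> and \<open>D'\<close> will be the zero sets of the lower and the upper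
  end of an edge. A term satisfied below is satisfied above, and one that fails above fails below,
  so \<open>i\<close> becomes the only satisfied term at both ends.\<close>

lemma card_terms_unique_ge:
  assumes h: "2 \<le> h" and i: "i < 2^h" and D: "D \<subseteq> {..<4*h}" "card D = h"
    and D': "D' \<subseteq> {..<4*h}" "card D' = h - 1"
  shows "real (card (terms h)) / (16 * 2 ^ h)
     \<le> card {T \<in> terms h. T i \<inter> D = {} \<and> (\<forall>i'\<in>{..<2^h} - {i}. T i' \<inter> D' \<noteq> {})}"
proof -
  let ?P = "Pow {..<4*h}" and ?I = "{..<2^h} :: nat set"
  let ?f = "\<lambda>i'. {R \<in> ?P. if i' = i then R \<inter> D = {} else R \<inter> D' \<noteq> {}}"
  have eq: "{T \<in> terms h. T i \<inter> D = {} \<and> (\<forall>i'\<in>?I - {i}. T i' \<inter> D' \<noteq> {})} = PiE ?I ?f"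
    unfolding terms_def PiE_Collect[symmetric] using i
    by (intro Collect_cong conj_cong refl) (auto split: if_splits)
  have "(\<Prod>i'\<in>?I. real (card (?f i')) / real (card ?P)) = 1 / 2 ^ h * (\<Prod>i'\<in>?I - {i}. 1 - 1 / 2 ^ (h - 1))"
    using i D D' card_avoiding_ratio[OF D(1)] card_meeting_ratio[OF D'(1)]
    by (subst prod.remove[of _ i]) (simp_all add: card_Pow)
  also have "\<dots> = 1 / 2 ^ h * (1 - 1 / 2 ^ (h - 1)) ^ (2 ^ h - 1)"
    using i by simp
  also have "\<dots> \<ge> 1 / 2 ^ h * (1 / 16)"
  proof (intro mult_left_mono)
    have "(1 / 4 :: real) ^ 2 \<le> ((1 - 1 / 2 ^ (h - 1)) ^ (2 ^ (h - 1))) ^ 2"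
      using one_minus_inverse_power_ge[of "h - 1"] h by (intro power_mono) auto
    also have "\<dots> = (1 - 1 / 2 ^ (h - 1)) ^ (2 ^ h)"
      using h by (cases h) (simp_all add: power_mult[symmetric] mult.commute)
    also have "\<dots> \<le> (1 - 1 / 2 ^ (h - 1)) ^ (2 ^ h - 1)"
      by (intro power_decreasing) auto
    finally show "(1 / 16 :: real) \<le> (1 - 1 / 2 ^ (h - 1)) ^ (2 ^ h - 1)"
      by (simp add: power2_eq_square)
  qed simp
  finally have "1 / 2 ^ h * (1 / 16) \<le> (\<Prod>i'\<in>?I. real (card (?f i')) / real (card ?P))" .
  moreover have "real (card (PiE ?I ?f)) = real (card (terms h)) * (\<Prod>i'\<in>?I. real (card (?f i')) / real (card ?P))"
    unfolding terms_def by (intro card_PiE_ratio) auto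
  ultimately have "real (card (terms h)) * (1 / 2 ^ h * (1 / 16)) \<le> card (PiE ?I ?f)"
    by (simp only: mult_left_mono of_nat_0_le_iff)
  then show ?thesis
    unfolding eq by (simp add: field_simps)
qed

text \<open>The dual for supports: \<open>D\<close> belongs to the upper and \<open>D'\<close> to
  the lower end. Clauses of other terms are unconstrained and contribute factors 1.\<close>

lemma card_clauses_unique_ge:
  assumes h: "1 \<le> h" and c: "c \<in> {..<2^h} \<times> {..<2^(3*h)}" and D: "D \<subseteq> {..<4*h}" "card D = 3*h + 1"
    and D': "D' \<subseteq> {..<4*h}" "card D' = 3*h"
  shows "real (card (clauses h)) / (8 * 2 ^ (3*h))
     \<le> card {C \<in> clauses h. C c \<inter> D = {} \<and> (\<forall>j\<in>{..<2^(3*h)} - {snd c}. C (fst c, j) \<inter> D' \<noteq> {})}"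
proof -
  let ?P = "Pow {..<4*h}" and ?I = "{..<2^h} \<times> {..<2^(3*h)} :: (nat \<times> nat) set"
  let ?J = "{fst c} \<times> {..<2^(3*h)} :: (nat \<times> nat) set"
  let ?f = "\<lambda>c'. {R \<in> ?P. if c' = c then R \<inter> D = {} else fst c' = fst c \<longrightarrow> R \<inter> D' \<noteq> {}}"
  let ?r = "\<lambda>c'. real (card (?f c')) / real (card ?P)"
  have eq: "{C \<in> clauses h. C c \<inter> D = {} \<and> (\<forall>j\<in>{..<2^(3*h)} - {snd c}. C (fst c, j) \<inter> D' \<noteq> {})} = PiE ?I ?f"
    unfolding clauses_def PiE_Collect[symmetric]
  proof (intro Collect_cong conj_cong refl iffI)
    fix C :: "nat \<times> nat \<Rightarrow> nat set"
    assume "C c \<inter> D = {} \<and> (\<forall>j\<in>{..<2^(3*h)} - {snd c}. C (fst c, j) \<inter> D' \<noteq> {})"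
    then show "\<forall>c'\<in>?I. if c' = c then C c' \<inter> D = {} else fst c' = fst c \<longrightarrow> C c' \<inter> D' \<noteq> {}"
      by (cases c) auto
  next
    fix C :: "nat \<times> nat \<Rightarrow> nat set"
    assume R: "\<forall>c'\<in>?I. if c' = c then C c' \<inter> D = {} else fst c' = fst c \<longrightarrow> C c' \<inter> D' \<noteq> {}"
    have "C c \<inter> D = {}"
      using bspec[OF R c] by simp
    moreover have "C (fst c, j) \<inter> D' \<noteq> {}" if "j \<in> {..<2^(3*h)} - {snd c}" for j
      using bspec[OF R, of "(fst c, j)"] c that by (cases c) auto
    ultimately show "C c \<inter> D = {} \<and> (\<forall>j\<in>{..<2^(3*h)} - {snd c}. C (fst c, j) \<inter> D' \<noteq> {})"
      by blast
  qed
  have "(\<Prod>c'\<in>?I. ?r c') = (\<Prod>c'\<in>?J. ?r c')"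
  proof (intro prod.mono_neutral_right ballI)
    fix c' assume "c' \<in> ?I - ?J"
    then have "fst c' \<noteq> fst c"
      by (cases c') auto
    then have "?f c' = ?P"
      by auto
    then show "?r c' = 1"
      by (simp add: card_Pow)
  qed (use c in auto)
  also have "\<dots> = ?r c * (\<Prod>c'\<in>?J - {c}. ?r c')"
    using c by (intro prod.remove) (auto simp: mem_Times_iff)
  also have "?r c = 1 / 2 ^ (3*h + 1)"
    using card_avoiding_ratio[OF D(1)] D(2) by (simp add: card_Pow)
  also have "(\<Prod>c'\<in>?J - {c}. ?r c') = (\<Prod>c'\<in>?J - {c}. 1 - 1 / 2 ^ (3*h))"
    using card_meeting_ratio[OF D'(1)] D'(2) by (intro prod.cong) (auto simp: card_Pow)
  also have "\<dots> = (1 - 1 / 2 ^ (3*h)) ^ (2 ^ (3*h) - 1)"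
    using c by (cases c) (simp add: card_Diff_singleton card_cartesian_product)
  also have "1 / 2 ^ (3*h + 1) * \<dots> \<ge> 1 / 2 ^ (3*h + 1) * (1 / 4)"
  proof (intro mult_left_mono)
    have "(1 / 4 :: real) \<le> (1 - 1 / 2 ^ (3*h)) ^ (2 ^ (3*h))"
      using h by (intro one_minus_inverse_power_ge) auto
    also have "\<dots> \<le> (1 - 1 / 2 ^ (3*h)) ^ (2 ^ (3*h) - 1)"
      by (intro power_decreasing) auto
    finally show "(1 / 4 :: real) \<le> (1 - 1 / 2 ^ (3*h)) ^ (2 ^ (3*h) - 1)" .
  qed simp
  finally have "1 / 2 ^ (3*h + 1) * (1 / 4) \<le> (\<Prod>c'\<in>?I. ?r c')" .
  moreover have "real (card (PiE ?I ?f)) = real (card (clauses h)) * (\<Prod>c'\<in>?I. ?r c')"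
    unfolding clauses_def by (intro card_PiE_ratio) auto
  ultimately have "real (card (clauses h)) * (1 / 2 ^ (3*h + 1) * (1 / 4)) \<le> card (PiE ?I ?f)"
    by (simp only: mult_left_mono of_nat_0_le_iff)
  then show ?thesis
    unfolding eq by (simp add: field_simps)
qed

text \<open>
  \<open>mass h T C\<close> is \<open>4h\<close> times the expected number of violations of the no-function with a uniformly
  random key.
\<close>

definition mass :: "nat \<Rightarrow> (nat \<Rightarrow> nat set) \<Rightarrow> (nat \<times> nat \<Rightarrow> nat set) \<Rightarrow> real" where
  "mass h T C = (\<Sum>(c, e, x)\<in>({..<2^h} \<times> {..<2^(3*h)}) \<times> {..<4*h} \<times> layer (4*h) (3*h). of_bool (x \<in> cell_edge h T C c e))"

lemma card_as_sum: "A \<subseteq> B \<Longrightarrow> finite B \<Longrightarrow> real (card A) = (\<Sum>x\<in>B. of_bool (x \<in> A))"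
  by (simp add: Int_absorb1)

lemma mass_eq: "mass h T C = (\<Sum>c\<in>{..<2^h} \<times> {..<2^(3*h)}. \<Sum>e<4*h. real (card (cell_edge h T C c e)))"
proof -
  have "real (card (cell_edge h T C c e)) = (\<Sum>x\<in>layer (4*h) (3*h). of_bool (x \<in> cell_edge h T C c e))" for c e
    by (intro card_as_sum) (auto simp: cell_edge_def)
  then show ?thesis
    unfolding mass_def by (simp only: sum.cartesian_product)
qed

lemma card_layer_zeros: "x \<in> layer (4*h) (3*h) \<Longrightarrow> card (zer (4*h) x) = h"
  by (simp add: layer_def card_zer)

text \<open>Each point of the layer has \<open>h\<close> zeros, and an edge lies in at most one
  cell. This maximum is what turns the large mean into a large mass for a constant fraction of the
  pairs.\<close>

lemma mass_le: "mass h T C \<le> real (h * (4*h choose (3*h)))"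
proof -
  let ?I = "{..<2^h} \<times> {..<2^(3*h)} :: (nat \<times> nat) set" and ?L = "layer (4*h) (3*h)"
  have "mass h T C = (\<Sum>c\<in>?I. \<Sum>e<4*h. \<Sum>x\<in>?L. of_bool (x \<in> cell_edge h T C c e))"
    unfolding mass_def by (simp only: sum.cartesian_product[symmetric])
  also have "\<dots> = (\<Sum>e<4*h. \<Sum>c\<in>?I. \<Sum>x\<in>?L. of_bool (x \<in> cell_edge h T C c e))"
    by (rule sum.swap)
  also have "\<dots> = (\<Sum>e<4*h. \<Sum>x\<in>?L. \<Sum>c\<in>?I. of_bool (x \<in> cell_edge h T C c e))"
    by (intro sum.cong refl sum.swap)
  also have "\<dots> = (\<Sum>x\<in>?L. \<Sum>e<4*h. \<Sum>c\<in>?I. of_bool (x \<in> cell_edge h T C c e))"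
    by (rule sum.swap)
  also have "\<dots> \<le> (\<Sum>x\<in>?L. \<Sum>e<4*h. of_bool (e \<in> zer (4*h) x))"
  proof (intro sum_mono)
    fix x e assume "x \<in> ?L"
    show "(\<Sum>c\<in>?I. of_bool (x \<in> cell_edge h T C c e)) \<le> (of_bool (e \<in> zer (4*h) x) :: real)"
    proof (cases "\<exists>c. x \<in> cell_edge h T C c e")
      case True
      then obtain c where c: "x \<in> cell_edge h T C c e" by blast
      have "x \<in> cell_edge h T C c' e \<longleftrightarrow> c' = c" for c'
        using c unfolding cell_edge_def by (metis (no_types, lifting) in_cell_unique mem_Collect_eq)
      then have "(\<Sum>c\<in>?I. of_bool (x \<in> cell_edge h T C c e)) \<le> (1 :: real)"
        by (simp add: of_bool_def)
      moreover have "e \<in> zer (4*h) x"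
        using c by (auto simp: cell_edge_def zer_def)
      ultimately show ?thesis by simp
    next
      case False
      then have "(\<Sum>c\<in>?I. of_bool (x \<in> cell_edge h T C c e)) = (0 :: real)"
        by (intro sum.neutral) simp
      then show ?thesis by simp
    qed
  qed
  also have "\<dots> = (\<Sum>x\<in>?L. real h)"
    by (intro sum.cong refl, subst card_as_sum[symmetric]) (auto simp: card_layer_zeros zer_subset)
  also have "\<dots> = real (h * (4*h choose (3*h)))"
    by (simp add: card_layer)
  finally show ?thesis .
qed

text \<open>The independent events for terms and clauses together place both ends of the edge in
  cell \<open>c\<close>; the constant is 16 * 8.\<close>

lemma card_cell_edge_pairs_ge:
  assumes h: "2 \<le> h" and c: "c \<in> {..<2^h} \<times> {..<2^(3*h)}" and x: "x \<in> layer (4*h) (3*h)" and e: "e < 4*h" "\<not> x e"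
  shows "real (card (terms h)) * real (card (clauses h)) / (128 * 2 ^ (4*h))
    \<le> card {(T, C). T \<in> terms h \<and> C \<in> clauses h \<and> x \<in> cell_edge h T C c e}"
proof -
  let ?y = "x(e := True)" and ?n = "4*h"
  let ?A = "{T \<in> terms h. T (fst c) \<inter> zer ?n x = {} \<and> (\<forall>i'\<in>{..<2^h} - {fst c}. T i' \<inter> zer ?n ?y \<noteq> {})}"
  let ?B = "{C \<in> clauses h. C c \<inter> supp ?n ?y = {} \<and> (\<forall>j\<in>{..<2^(3*h)} - {snd c}. C (fst c, j) \<inter> supp ?n x \<noteq> {})}"
  have ze: "e \<in> zer ?n x" "e \<notin> supp ?n x"
    using e by (auto simp: zer_def supp_def)
  have cx: "card (zer ?n x) = h" "card (supp ?n x) = 3*h"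
    using x card_layer_zeros[OF x] by (auto simp: layer_def)
  have cy: "card (zer ?n ?y) = h - 1" "card (supp ?n ?y) = 3*h + 1"
    using cx ze e by (simp_all add: zer_remove supp_insert)
  have "real (card (terms h)) / (16 * 2 ^ h) * (real (card (clauses h)) / (8 * 2 ^ (3*h))) \<le> real (card ?A) * real (card ?B)"
    using h c cx cy by (intro mult_mono card_terms_unique_ge card_clauses_unique_ge zer_subset supp_subset) auto
  also have "real (card (terms h)) / (16 * 2 ^ h) * (real (card (clauses h)) / (8 * 2 ^ (3*h)))
      = real (card (terms h)) * real (card (clauses h)) / (128 * 2 ^ (4*h))"
  proof -
    have "(2::real) ^ (4*h) = 2 ^ h * 2 ^ (3*h)"
      by (simp flip: power_add)
    then show ?thesis by simp
  qed
  also have "real (card ?A) * real (card ?B) = real (card (?A \<times> ?B))"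
    by (simp add: card_cartesian_product)
  also have "\<dots> \<le> card {(T, C). T \<in> terms h \<and> C \<in> clauses h \<and> x \<in> cell_edge h T C c e}"
  proof (intro of_nat_mono card_mono)
    show "finite {(T, C). T \<in> terms h \<and> C \<in> clauses h \<and> x \<in> cell_edge h T C c e}"
      by (rule finite_subset[of _ "terms h \<times> clauses h"]) auto
    have "x \<in> cell_edge h T C c e" if T: "T \<in> ?A" and C: "C \<in> ?B" for T C
    proof -
      have sub: "zer ?n ?y \<subseteq> zer ?n x" "supp ?n x \<subseteq> supp ?n ?y"
        by (auto simp: zer_def supp_def)
      have i: "fst c < 2^h" "snd c < 2^(3*h)"
        using c by auto
      have "sat h T x = {fst c}" "sat h T ?y = {fst c}"
        using T sub i unfolding sat_def by blast+
      moreover have "avd h C (fst c) x = {snd c}" "avd h C (fst c) ?y = {snd c}"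
        using C sub i unfolding avd_def by (cases c; simp; blast)+
      ultimately show ?thesis
        using x e cx cy by (simp add: cell_edge_def in_cell_def band_def)
    qed
    then show "?A \<times> ?B \<subseteq> {(T, C). T \<in> terms h \<and> C \<in> clauses h \<and> x \<in> cell_edge h T C c e}"
      by auto
  qed
  finally show ?thesis .
qed

lemma sum_mass_ge:
  assumes h: "2 \<le> h"
  shows "real (card (terms h)) * real (card (clauses h)) * (h * (4*h choose (3*h))) / 128
    \<le> (\<Sum>(T, C)\<in>terms h \<times> clauses h. mass h T C)"
proof -
  let ?I = "{..<2^h} \<times> {..<2^(3*h)} :: (nat \<times> nat) set" and ?L = "layer (4*h) (3*h)"
  let ?r = "real (card (terms h)) * real (card (clauses h)) / (128 * 2 ^ (4*h))"
  have "(\<Sum>(T, C)\<in>terms h \<times> clauses h. mass h T C)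
      = (\<Sum>(c, e, x)\<in>?I \<times> {..<4*h} \<times> ?L. \<Sum>(T, C)\<in>terms h \<times> clauses h. of_bool (x \<in> cell_edge h T C c e))"
    unfolding mass_def by (simp only: split_def, subst sum.swap) simp
  also have "\<dots> \<ge> (\<Sum>(c, e, x)\<in>?I \<times> {..<4*h} \<times> ?L. of_bool (e \<in> zer (4*h) x) * ?r)"
  proof (intro sum_mono)
    fix p assume "p \<in> ?I \<times> {..<4*h} \<times> ?L"
    then obtain c e x where p: "p = (c, e, x)" and *: "c \<in> ?I" "e < 4*h" "x \<in> ?L"
      by blast
    have "real (card {(T, C). T \<in> terms h \<and> C \<in> clauses h \<and> x \<in> cell_edge h T C c e})
        = (\<Sum>p\<in>terms h \<times> clauses h. of_bool (p \<in> {(T, C). T \<in> terms h \<and> C \<in> clauses h \<and> x \<in> cell_edge h T C c e}))"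
      by (intro card_as_sum) auto
    also have "\<dots> = (\<Sum>(T, C)\<in>terms h \<times> clauses h. of_bool (x \<in> cell_edge h T C c e))"
      by (intro sum.cong refl) auto
    finally show "(case p of (c, e, x) \<Rightarrow> of_bool (e \<in> zer (4*h) x) * ?r)
        \<le> (case p of (c, e, x) \<Rightarrow> \<Sum>(T, C)\<in>terms h \<times> clauses h. of_bool (x \<in> cell_edge h T C c e))"
      using card_cell_edge_pairs_ge[OF h *(1,3,2)] by (cases "x e") (auto simp: p zer_def split_def intro!: sum_nonneg)
  qed
  also have "(\<Sum>(c, e, x)\<in>?I \<times> {..<4*h} \<times> ?L. of_bool (e \<in> zer (4*h) x) * ?r)
      = (\<Sum>c\<in>?I. \<Sum>x\<in>?L. \<Sum>e<4*h. of_bool (e \<in> zer (4*h) x) * ?r)"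
    unfolding sum.cartesian_product[symmetric] by (subst (2) sum.swap) (rule refl)
  also have "\<dots> = (\<Sum>c\<in>?I. \<Sum>x\<in>?L. real h * ?r)"
    unfolding sum_distrib_right[symmetric]
    by (intro sum.cong refl arg_cong2[where f = "(*)"], subst card_as_sum[symmetric]) (auto simp: card_layer_zeros zer_subset)
  also have "\<dots> = real (card (terms h)) * real (card (clauses h)) * (h * (4*h choose (3*h))) / 128"
  proof -
    have "(2::real) ^ (4*h) = 2 ^ h * 2 ^ (3*h)"
      by (simp flip: power_add)
    then show ?thesis
      by (simp add: card_cartesian_product card_layer)
  qed
  finally show ?thesis .
qed


section \<open>Second moment: points sharing a cell\<close>

text \<open>The number of ordered pairs of points of layer \<open>3*h\<close> in a common cell. Cell
  sizes bound the summands in Hoeffding's inequality, so this is the sum of squares in its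
  exponent.\<close>

definition coll :: "nat \<Rightarrow> (nat \<Rightarrow> nat set) \<Rightarrow> (nat \<times> nat \<Rightarrow> nat set) \<Rightarrow> real" where
  "coll h T C = (\<Sum>c\<in>{..<2^h} \<times> {..<2^(3*h)}. (real (card {x \<in> layer (4*h) (3*h). in_cell h T C x c}))\<^sup>2)"

lemma card_PiE_avoiding:
  assumes "a \<in> I" "finite I" "D \<subseteq> {..<n :: nat}"
  shows "real (card {f \<in> I \<rightarrow>\<^sub>E Pow {..<n}. f a \<inter> D = {}}) = real (card (I \<rightarrow>\<^sub>E Pow {..<n})) / 2 ^ card D"
proof -
  let ?A = "I \<rightarrow>\<^sub>E Pow {..<n}"
  have fin: "finite ?A"
    using assms by (intro finite_PiE) auto
  have "2 ^ n * real (card {f \<in> ?A. f a \<inter> D = {}}) = (\<Sum>f\<in>?A. \<Sum>R\<in>Pow {..<n}. of_bool (R \<inter> D = {}))"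
    using sum_PiE_resample[OF assms(1), of "\<lambda>f. of_bool (f a \<inter> D = {})" "Pow {..<n}"] card_filter_eq_sum[OF fin, of "\<lambda>f. f a \<inter> D = {}"]
    by (simp add: card_Pow)
  also have "\<dots> = real (card ?A) * real (card {R \<in> Pow {..<n}. R \<inter> D = {}})"
    using card_filter_eq_sum[of "Pow {..<n}" "\<lambda>R. R \<inter> D = {}"] by simp
  also have "real (card {R \<in> Pow {..<n}. R \<inter> D = {}}) = 2 ^ n * (1 / 2 ^ card D)"
    using card_avoiding_ratio[OF assms(3)] by (simp add: field_simps)
  finally have "2 ^ n * real (card {f \<in> ?A. f a \<inter> D = {}}) = 2 ^ n * (real (card ?A) / 2 ^ card D)"
    by (simp only: mult.left_commute mult.commute times_divide_eq_right mult_1_right)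
  then show ?thesis
    by (subst (asm) mult_cancel_left) simp
qed

text \<open>If the second point has \<open>d\<close> new ones, the common term must avoid
  \<open>h + d\<close> zeros and the common clause \<open>3h + d\<close> ones, which has probability
  2^-(4h + 2d).\<close>

lemma card_same_cell_le:
  assumes c: "c \<in> {..<2^h} \<times> {..<2^(3*h)}" and x: "x \<in> layer (4*h) (3*h)" "x' \<in> layer (4*h) (3*h)"
  shows "card {(T, C). T \<in> terms h \<and> C \<in> clauses h \<and> in_cell h T C x c \<and> in_cell h T C x' c}
    \<le> real (card (terms h)) * real (card (clauses h)) / 2 ^ (4*h) * (1 / 4) ^ card (supp (4*h) x' - supp (4*h) x)"
proof -
  let ?n = "4*h"
  define d where "d = card (supp ?n x' - supp ?n x)"
  have cs: "card (supp ?n x) = 3*h" "card (supp ?n x') = 3*h"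
    using x by (auto simp: layer_def)
  have s: "card (supp ?n x \<union> supp ?n x') = 3*h + d"
    unfolding d_def using cs(1) by (subst Un_Diff_cancel[symmetric], subst card_Un_disjoint) auto
  have z: "card (zer ?n x \<union> zer ?n x') = h + d"
  proof -
    have "card (supp ?n x - supp ?n x') = d"
    proof -
      have "card (supp ?n x) = card (supp ?n x \<inter> supp ?n x') + card (supp ?n x - supp ?n x')"
        by (subst card_Un_disjoint[symmetric]) (auto intro: arg_cong[where f = card])
      moreover have "card (supp ?n x') = card (supp ?n x \<inter> supp ?n x') + card (supp ?n x' - supp ?n x)"
        by (subst card_Un_disjoint[symmetric]) (auto intro: arg_cong[where f = card])
      ultimately show ?thesis
        using cs by (simp add: d_def)
    qed
    moreover have "zer ?n x \<union> zer ?n x' = zer ?n x \<union> (supp ?n x - supp ?n x')"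
      by (auto simp: zer_def supp_def)
    moreover have "card (zer ?n x \<union> (supp ?n x - supp ?n x')) = card (zer ?n x) + card (supp ?n x - supp ?n x')"
      by (intro card_Un_disjoint) (auto simp: zer_eq)
    ultimately show ?thesis
      using card_layer_zeros[OF x(1)] by simp
  qed
  let ?A = "{T \<in> terms h. T (fst c) \<inter> (zer ?n x \<union> zer ?n x') = {}}"
  let ?B = "{C \<in> clauses h. C c \<inter> (supp ?n x \<union> supp ?n x') = {}}"
  have "{(T, C). T \<in> terms h \<and> C \<in> clauses h \<and> in_cell h T C x c \<and> in_cell h T C x' c} \<subseteq> ?A \<times> ?B"
  proof
    fix p assume "p \<in> {(T, C). T \<in> terms h \<and> C \<in> clauses h \<and> in_cell h T C x c \<and> in_cell h T C x' c}"
    then obtain T C where p: "p = (T, C)" "T \<in> terms h" "C \<in> clauses h" "in_cell h T C x c" "in_cell h T C x' c"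
      by auto
    then have "fst c \<in> sat h T x" "fst c \<in> sat h T x'" "snd c \<in> avd h C (fst c) x" "snd c \<in> avd h C (fst c) x'"
      by (auto simp: in_cell_def)
    then show "p \<in> ?A \<times> ?B"
      using p by (auto simp: sat_def avd_def)
  qed
  then have "card {(T, C). T \<in> terms h \<and> C \<in> clauses h \<and> in_cell h T C x c \<and> in_cell h T C x' c} \<le> card (?A \<times> ?B)"
    by (intro card_mono) auto
  then have "real (card {(T, C). T \<in> terms h \<and> C \<in> clauses h \<and> in_cell h T C x c \<and> in_cell h T C x' c}) \<le> real (card ?A) * real (card ?B)"
    by (simp add: card_cartesian_product flip: of_nat_mult)
  also have "real (card ?A) = real (card (terms h)) / 2 ^ (h + d)"
    unfolding z[symmetric] terms_def using c zer_subset by (intro card_PiE_avoiding) auto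
  also have "real (card ?B) = real (card (clauses h)) / 2 ^ (3*h + d)"
    unfolding s[symmetric] clauses_def using c supp_subset by (intro card_PiE_avoiding) auto
  also have "real (card (terms h)) / 2 ^ (h + d) * (real (card (clauses h)) / 2 ^ (3*h + d))
      = real (card (terms h)) * real (card (clauses h)) / 2 ^ (4*h) * (1 / 4) ^ d"
  proof -
    have "(2::real) ^ (h + d) * 2 ^ (3*h + d) = 2 ^ (4*h + 2*d)"
      by (simp flip: power_add)
    also have "\<dots> = 2 ^ (4*h) * 4 ^ d"
      by (simp add: power_add power_mult)
    finally show ?thesis
      by (simp add: power_one_over)
  qed
  finally show ?thesis
    by (simp add: d_def)
qed

lemma card_small_subsets_le: "card {A. A \<subseteq> {..<n::nat} \<and> card A \<le> d} \<le> (n + 1) ^ d"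
proof -
  have "{A. A \<subseteq> {..<n} \<and> card A \<le> d} = (\<Union>i\<in>{..d}. {A. A \<subseteq> {..<n} \<and> card A = i})"
    by auto
  then have "card {A. A \<subseteq> {..<n} \<and> card A \<le> d} \<le> (\<Sum>i\<le>d. card {A. A \<subseteq> {..<n} \<and> card A = i})"
    by (simp add: card_UN_le)
  also have "\<dots> = (\<Sum>i\<le>d. n choose i)"
    by (simp add: n_subsets)
  also have "\<dots> \<le> (\<Sum>i\<le>d. (d choose i) * n ^ i)"
  proof (intro sum_mono)
    fix i assume "i \<in> {..d}"
    then have "0 < d choose i"
      by simp
    moreover have "n choose i \<le> n ^ i"
      by (cases "i \<le> n") (auto simp: binomial_le_pow binomial_eq_0)
    ultimately show "n choose i \<le> (d choose i) * n ^ i"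
      by (metis One_nat_def Suc_leI mult_le_mono nat_mult_1)
  qed
  also have "\<dots> = (n + 1) ^ d"
    using binomial[of n 1 d] by simp
  finally show ?thesis .
qed

text \<open>Within the layer a point is determined by the ones it gains and loses relative to
  \<open>x\<close>, and these are equally many.\<close>

lemma card_near_le:
  assumes x: "x \<in> layer (4*h) (3*h)"
  shows "card {x' \<in> layer (4*h) (3*h). card (supp (4*h) x' - supp (4*h) x) \<le> d} \<le> (4*h + 1) ^ (2 * d)"
proof -
  let ?n = "4*h" and ?S = "{A. A \<subseteq> {..<4*h} \<and> card A \<le> d}"
  let ?f = "\<lambda>x'. (supp (4*h) x' - supp (4*h) x, supp (4*h) x - supp (4*h) x')"
  have "finite ?S"
    by (rule finite_subset[of _ "Pow {..<4*h}"]) auto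
  moreover have "inj_on ?f {x' \<in> layer ?n (3*h). card (supp ?n x' - supp ?n x) \<le> d}"
  proof (rule inj_onI)
    fix y z assume y: "y \<in> {x' \<in> layer ?n (3*h). card (supp ?n x' - supp ?n x) \<le> d}"
      and z: "z \<in> {x' \<in> layer ?n (3*h). card (supp ?n x' - supp ?n x) \<le> d}" and eq: "?f y = ?f z"
    then have "supp ?n y = supp ?n z"
      by blast
    then show "y = z"
      using y z by (intro supp_inj) (auto simp: layer_def)
  qed
  moreover have "?f ` {x' \<in> layer ?n (3*h). card (supp ?n x' - supp ?n x) \<le> d} \<subseteq> ?S \<times> ?S"
  proof
    fix p assume "p \<in> ?f ` {x' \<in> layer ?n (3*h). card (supp ?n x' - supp ?n x) \<le> d}"
    then obtain y where y: "p = ?f y" "y \<in> layer ?n (3*h)" "card (supp ?n y - supp ?n x) \<le> d"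
      by blast
    have "card (supp ?n x) = card (supp ?n x \<inter> supp ?n y) + card (supp ?n x - supp ?n y)"
      by (subst card_Un_disjoint[symmetric]) (auto intro: arg_cong[where f = card])
    moreover have "card (supp ?n y) = card (supp ?n x \<inter> supp ?n y) + card (supp ?n y - supp ?n x)"
      by (subst card_Un_disjoint[symmetric]) (auto intro: arg_cong[where f = card])
    ultimately have "card (supp ?n x - supp ?n y) \<le> d"
      using y x by (simp add: layer_def)
    then show "p \<in> ?S \<times> ?S"
      using y supp_subset by blast
  qed
  ultimately have "card {x' \<in> layer ?n (3*h). card (supp ?n x' - supp ?n x) \<le> d} \<le> card (?S \<times> ?S)"
    by (intro card_inj_on_le) auto
  also have "\<dots> \<le> (4*h + 1) ^ d * (4*h + 1) ^ d"
    unfolding card_cartesian_product by (intro mult_le_mono card_small_subsets_le)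
  also have "\<dots> = (4*h + 1) ^ (2 * d)"
    by (simp add: mult_2 power_add)
  finally show ?thesis .
qed

lemma layer_size_ge: "1 \<le> h \<Longrightarrow> 4 ^ h \<le> (4*h choose (3*h))"
proof -
  assume h: "1 \<le> h"
  have "(real (4*h) / real h) ^ h \<le> real (4*h choose h)"
    by (rule binomial_ge_n_over_k_pow_k) simp
  moreover have "4*h choose h = (4*h choose (3*h))"
    using binomial_symmetric[of h "4*h"] by simp
  ultimately have "real (4 ^ h) \<le> real (4*h choose (3*h))"
    using h by simp
  then show ?thesis
    by (simp only: of_nat_le_iff)
qed

text \<open>The weight 4^-d of a pair is trivially at most 1 for d up to 15, but then only
  \<open>(4h + 1)^30\<close> points qualify, few against N, which is at least 4^h. For larger d it
  is at most 4^-16 = 2^-32. Both parts give at most N / 2^32 per point.\<close>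

lemma sum_coll_le:
  assumes h: "1 \<le> h" and large: "2 ^ 32 * (4*h + 1) ^ 30 \<le> (4::nat) ^ h"
  shows "(\<Sum>(T, C)\<in>terms h \<times> clauses h. coll h T C)
    \<le> real (card (terms h)) * real (card (clauses h)) * (real (4*h choose (3*h)))\<^sup>2 / 2 ^ 31"
proof -
  let ?I = "{..<2^h} \<times> {..<2^(3*h)} :: (nat \<times> nat) set" and ?L = "layer (4*h) (3*h)"
  let ?N = "real (4*h choose (3*h))"
  let ?tc = "real (card (terms h)) * real (card (clauses h))"
  let ?d = "\<lambda>x x'. card (supp (4*h) x' - supp (4*h) x)"
  let ?P = "\<lambda>T C c x x'. in_cell h T C x c \<and> in_cell h T C x' c"
  have coll: "coll h T C = (\<Sum>(c, x, x')\<in>?I \<times> ?L \<times> ?L. of_bool (?P T C c x x'))" for T C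
  proof -
    have "coll h T C = (\<Sum>c\<in>?I. (\<Sum>x\<in>?L. of_bool (in_cell h T C x c)) * (\<Sum>x'\<in>?L. of_bool (in_cell h T C x' c)))"
      unfolding coll_def power2_eq_square by (simp only: card_filter_eq_sum[OF finite_layer])
    also have "\<dots> = (\<Sum>c\<in>?I. \<Sum>x\<in>?L. \<Sum>x'\<in>?L. of_bool (?P T C c x x'))"
      unfolding sum_product of_bool_conj by (rule refl)
    finally show ?thesis
      by (simp only: sum.cartesian_product)
  qed
  have near: "(\<Sum>x'\<in>?L. (1/4) ^ ?d x x') \<le> ?N / 2 ^ 31" if x: "x \<in> ?L" for x
  proof -
    have "(\<Sum>x'\<in>?L. (1/4) ^ ?d x x') \<le> (\<Sum>x'\<in>?L. of_bool (?d x x' \<le> 15) + (1/4::real) ^ 16)"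
    proof (intro sum_mono)
      fix x'
      show "(1/4::real) ^ ?d x x' \<le> of_bool (?d x x' \<le> 15) + (1/4) ^ 16"
      proof (cases "?d x x' \<le> 15")
        case True
        have "(1/4::real) ^ ?d x x' \<le> 1"
          by (intro power_le_one) auto
        moreover have "(0::real) \<le> (1/4) ^ 16"
          by simp
        moreover have "of_bool (?d x x' \<le> 15) = (1::real)"
          using True by simp
        ultimately show ?thesis
          by linarith
      next
        case False
        then have "(1/4::real) ^ ?d x x' \<le> (1/4) ^ 16"
          by (intro power_decreasing) auto
        then show ?thesis using False by simp
      qed
    qed
    also have "\<dots> = real (card {x' \<in> ?L. ?d x x' \<le> 15}) + ?N * (1/4) ^ 16"
      by (simp only: sum.distrib card_filter_eq_sum[OF finite_layer] sum_constant card_layer)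
    also have "real (card {x' \<in> ?L. ?d x x' \<le> 15}) \<le> ?N / 2 ^ 32"
    proof -
      have "2 ^ 32 * card {x' \<in> ?L. ?d x x' \<le> 15} \<le> 2 ^ 32 * (4*h + 1) ^ (2 * 15)"
        using card_near_le[OF x, of 15] by (intro mult_left_mono) auto
      also have "\<dots> \<le> 4*h choose (3*h)"
        using large layer_size_ge[OF h] by simp
      finally have "real (2 ^ 32 * card {x' \<in> ?L. ?d x x' \<le> 15}) \<le> ?N"
        by (simp only: of_nat_le_iff)
      then show ?thesis
        by simp
    qed
    finally show ?thesis
      by (simp add: power_one_over)
  qed
  have "(\<Sum>(T, C)\<in>terms h \<times> clauses h. coll h T C)
      = (\<Sum>(c, x, x')\<in>?I \<times> ?L \<times> ?L. \<Sum>(T, C)\<in>terms h \<times> clauses h. of_bool (?P T C c x x'))"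
    unfolding coll by (simp only: split_def, subst sum.swap) (rule refl)
  also have "\<dots> \<le> (\<Sum>(c, x, x')\<in>?I \<times> ?L \<times> ?L. ?tc / 2 ^ (4*h) * (1/4) ^ ?d x x')"
  proof (intro sum_mono)
    fix p assume "p \<in> ?I \<times> ?L \<times> ?L"
    then obtain c x x' where p: "p = (c, x, x')" and *: "c \<in> ?I" "x \<in> ?L" "x' \<in> ?L"
      by blast
    have "real (card {(T, C). T \<in> terms h \<and> C \<in> clauses h \<and> in_cell h T C x c \<and> in_cell h T C x' c})
        = (\<Sum>q\<in>terms h \<times> clauses h. of_bool (q \<in> {(T, C). T \<in> terms h \<and> C \<in> clauses h \<and> in_cell h T C x c \<and> in_cell h T C x' c}))"
      by (intro card_as_sum) auto
    also have "\<dots> = (\<Sum>(T, C)\<in>terms h \<times> clauses h. of_bool (?P T C c x x'))"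
      by (intro sum.cong refl) auto
    finally show "(case p of (c, x, x') \<Rightarrow> \<Sum>(T, C)\<in>terms h \<times> clauses h. of_bool (?P T C c x x'))
        \<le> (case p of (c, x, x') \<Rightarrow> ?tc / 2 ^ (4*h) * (1/4) ^ ?d x x')"
      using card_same_cell_le[OF *] by (simp only: p prod.case)
  qed
  also have "\<dots> = (\<Sum>c\<in>?I. \<Sum>x\<in>?L. ?tc / 2 ^ (4*h) * (\<Sum>x'\<in>?L. (1/4) ^ ?d x x'))"
    unfolding sum_distrib_left by (simp only: sum.cartesian_product)
  also have "\<dots> \<le> (\<Sum>c\<in>?I. \<Sum>x\<in>?L. ?tc / 2 ^ (4*h) * (?N / 2 ^ 31))"
    by (intro sum_mono mult_left_mono near) auto
  also have "\<dots> = ?tc * ?N\<^sup>2 / 2 ^ 31"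
  proof -
    have "(2::real) ^ (4*h) = 2 ^ h * 2 ^ (3*h)"
      by (simp flip: power_add)
    then show ?thesis
      by (simp add: card_cartesian_product card_layer power2_eq_square)
  qed
  finally show ?thesis .
qed

section \<open>Concentration of the number of violations\<close>

text \<open>The first threshold gives a mean of at least N / 1024 violations. The second makes
  Hoeffding's bound for a deviation of N / 2048 at most exp (-2), as 2048^2 = 2^22.\<close>

definition good_pairs :: "nat \<Rightarrow> ((nat \<Rightarrow> nat set) \<times> (nat \<times> nat \<Rightarrow> nat set)) set" where
  "good_pairs h = {(T, C) \<in> terms h \<times> clauses h. real (h * (4*h choose (3*h))) / 256 \<le> mass h T C \<and>
     coll h T C \<le> (real (4*h choose (3*h)))\<^sup>2 / 2 ^ 22}"

text \<open>The mass has mean at least hN / 128 and maximum hN, so it reaches hN / 256 with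
  probability at least 1/256. By Markov's inequality the other condition fails with probability at
  most 2^22 / 2^31 = 1/512.\<close>

lemma card_good_pairs_ge:
  assumes h: "2 \<le> h" and large: "2 ^ 32 * (4*h + 1) ^ 30 \<le> (4::nat) ^ h"
  shows "real (card (terms h)) * real (card (clauses h)) / 512 \<le> card (good_pairs h)"
proof -
  let ?G = "terms h \<times> clauses h"
  let ?N = "real (4*h choose (3*h))"
  let ?tc = "real (card (terms h)) * real (card (clauses h))"
  have N: "0 < ?N"
    by simp
  let ?A = "{p \<in> ?G. real (h * (4*h choose (3*h))) / 256 \<le> mass h (fst p) (snd p)}"
  let ?B = "{p \<in> ?G. ?N\<^sup>2 / 2 ^ 22 < coll h (fst p) (snd p)}"
  have G: "real (card ?G) = ?tc"
    by (simp add: card_cartesian_product)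
  have A: "?tc / 256 \<le> card ?A"
  proof -
    have "?tc * (h * ?N) / 128 \<le> (\<Sum>p\<in>?G. mass h (fst p) (snd p))"
      using sum_mass_ge[OF h] by (simp add: split_def)
    also have "\<dots> \<le> (\<Sum>p\<in>?G. (h * ?N) * of_bool (h * ?N / 256 \<le> mass h (fst p) (snd p)) + h * ?N / 256)"
    proof (intro sum_mono)
      fix p
      show "mass h (fst p) (snd p) \<le> (h * ?N) * of_bool (h * ?N / 256 \<le> mass h (fst p) (snd p)) + h * ?N / 256"
        using mass_le[of h "fst p" "snd p"] by (cases "h * ?N / 256 \<le> mass h (fst p) (snd p)") auto
    qed
    also have "\<dots> = (h * ?N) * card ?A + ?tc * (h * ?N / 256)"
      by (simp add: sum.distrib card_filter_eq_sum[of ?G] G sum_distrib_left[symmetric] del: sum_of_bool_eq)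
    finally have "(h * ?N) * (?tc / 256) \<le> (h * ?N) * card ?A"
      by (simp add: field_simps)
    then show ?thesis
      using h N by (simp del: of_nat_0_less_iff)
  qed
  have B: "card ?B \<le> ?tc / 512"
  proof -
    have "?N\<^sup>2 / 2 ^ 22 * card ?B = (\<Sum>p\<in>?G. ?N\<^sup>2 / 2 ^ 22 * of_bool (?N\<^sup>2 / 2 ^ 22 < coll h (fst p) (snd p)))"
      by (simp only: card_filter_eq_sum[of ?G, OF finite_cartesian_product[OF finite_terms finite_clauses]] sum_distrib_left)
    also have "\<dots> \<le> (\<Sum>p\<in>?G. coll h (fst p) (snd p))"
    proof (intro sum_mono)
      fix p
      have "0 \<le> coll h (fst p) (snd p)"
        by (auto simp: coll_def intro!: sum_nonneg)
      then show "?N\<^sup>2 / 2 ^ 22 * of_bool (?N\<^sup>2 / 2 ^ 22 < coll h (fst p) (snd p)) \<le> coll h (fst p) (snd p)"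
        by (cases "?N\<^sup>2 / 2 ^ 22 < coll h (fst p) (snd p)") auto
    qed
    also have "\<dots> \<le> ?tc * ?N\<^sup>2 / 2 ^ 31"
      using sum_coll_le[OF _ large] h by (simp add: split_def)
    also have "\<dots> = ?N\<^sup>2 / 2 ^ 22 * (?tc / 512)"
      by simp
    finally show ?thesis
      using N by (subst (asm) mult_le_cancel_left_pos) auto
  qed
  have "?A \<subseteq> good_pairs h \<union> ?B"
    by (auto simp: good_pairs_def)
  moreover have "finite (good_pairs h)"
    by (rule finite_subset[of _ ?G]) (auto simp: good_pairs_def)
  ultimately have "card ?A \<le> card (good_pairs h \<union> ?B)"
    by (intro card_mono) auto
  also have "\<dots> \<le> card (good_pairs h) + card ?B"
    by (rule card_Un_le)
  finally show ?thesis
    using A B by linarith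
qed

lemma card_violations: "card (violations h T C k) = (\<Sum>c\<in>{..<2^h} \<times> {..<2^(3*h)}. card (cell_edge h T C c (k c)))"
proof -
  have "violations h T C k = (\<Union>c\<in>{..<2^h} \<times> {..<2^(3*h)}. cell_edge h T C c (k c))"
    using in_cell_less unfolding violations_def cell_edge_def by blast
  moreover have "card (\<Union>c\<in>{..<2^h} \<times> {..<2^(3*h)}. cell_edge h T C c (k c)) = (\<Sum>c\<in>{..<2^h} \<times> {..<2^(3*h)}. card (cell_edge h T C c (k c)))"
  proof (intro card_UN_disjoint ballI impI)
    fix c c' :: "nat \<times> nat" assume "c \<noteq> c'"
    then show "cell_edge h T C c (k c) \<inter> cell_edge h T C c' (k c') = {}"
      using in_cell_unique unfolding cell_edge_def by blast
  qed (auto simp: cell_edge_def)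
  ultimately show ?thesis by simp
qed

text \<open>For fixed terms and clauses the violations are a sum of independent contributions, one
  per cell and each between 0 and the size of the cell in layer \<open>3*h\<close>, so Hoeffding's
  inequality applies.\<close>

lemma card_few_violations_le:
  assumes h: "2 \<le> h" and good: "(T, C) \<in> good_pairs h"
  shows "card {k \<in> keys h. card (violations h T C k) \<le> real (4*h choose (3*h)) / 2048} \<le> real (card (keys h)) / 4"
proof -
  let ?I = "{..<2^h} \<times> {..<2^(3*h)} :: (nat \<times> nat) set"
  let ?N = "real (4*h choose (3*h))"
  let ?s = "\<lambda>c. real (card {x \<in> layer (4*h) (3*h). in_cell h T C x c})"
  let ?X = "\<lambda>c k. real (card (cell_edge h T C c (k c)))"
  define p where "p = pmf_of_set (keys h)"
  have keys_ne: "keys h \<noteq> {}"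
    using card_keys_pos[of h] h by auto
  have N: "0 < ?N"
    by simp
  \<comment> \<open>The uniform key is rewritten as a product distribution, which supplies
    independence; the default \<open>undefined\<close> matches extensionality.\<close>
  have "keys h = PiE_dflt ?I undefined (\<lambda>_. {..<4*h})"
    by (auto simp: keys_def PiE_dflt_def PiE_def extensional_def)
  moreover have "(0::nat) \<in> {..<4*h}"
    using h by simp
  ultimately have p: "p = Pi_pmf ?I undefined (\<lambda>_. pmf_of_set {..<4*h})"
    unfolding p_def using h by (subst Pi_pmf_of_set) (auto simp: lessThan_empty_iff)
  interpret P: Hoeffding_ineq "measure_pmf p" ?I ?X "\<lambda>_. 0" ?s "\<Sum>c\<in>?I. measure_pmf.expectation p (?X c)"
  proof unfold_locales
    have "prob_space.indep_vars (measure_pmf p) (\<lambda>_. count_space UNIV) (\<lambda>c k. k c) ?I"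
      unfolding p by (rule indep_vars_Pi_pmf) simp
    then show "prob_space.indep_vars (measure_pmf p) (\<lambda>_. borel) ?X ?I"
      by (rule prob_space.indep_vars_compose2[OF measure_pmf.prob_space_axioms]) auto
  next
    fix c
    show "AE k in measure_pmf p. ?X c k \<in> {0..?s c}"
      by (intro AE_pmfI) (auto simp: cell_edge_def intro!: card_mono)
  qed auto
  have exp: "measure_pmf.expectation p (?X c) = (\<Sum>e<4*h. real (card (cell_edge h T C c e))) / (4*h)" if "c \<in> ?I" for c
  proof -
    have "measure_pmf.expectation p (?X c) = (\<Sum>k\<in>keys h. ?X c k) / card (keys h)"
      unfolding p_def using keys_ne by (intro integral_pmf_of_set) auto
    also have "real (4*h) * (\<Sum>k\<in>keys h. ?X c k) = card (keys h) * (\<Sum>e<4*h. real (card (cell_edge h T C c e)))"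
      using sum_PiE_resample[OF that, of "?X c" "{..<4*h}"] by (simp add: keys_def)
    then have "(\<Sum>k\<in>keys h. ?X c k) / card (keys h) = (\<Sum>e<4*h. real (card (cell_edge h T C c e))) / (4*h)"
      using h keys_ne by (subst frac_eq_eq) (auto simp only: mult.commute of_nat_eq_0_iff card_0_eq finite_keys)
    finally show ?thesis .
  qed
  have "(\<Sum>c\<in>?I. measure_pmf.expectation p (?X c)) = (\<Sum>c\<in>?I. (\<Sum>e<4*h. real (card (cell_edge h T C c e))) / (4*h))"
    by (intro sum.cong refl exp)
  also have "\<dots> = mass h T C / (4*h)"
    by (simp only: mass_eq sum_divide_distrib)
  also have "\<dots> \<ge> (h * ?N / 256) / (4*h)"
    using good by (intro divide_right_mono) (auto simp: good_pairs_def)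
  also have "(h * ?N / 256) / (4*h) = ?N / 1024"
    using h by simp
  finally have mean: "?N / 1024 \<le> (\<Sum>c\<in>?I. measure_pmf.expectation p (?X c))" .
  have coll: "(\<Sum>c\<in>?I. (?s c - 0)\<^sup>2) \<le> ?N\<^sup>2 / 2 ^ 22"
    using good by (simp add: good_pairs_def coll_def)
  \<comment> \<open>The exponent divides by this sum; positive mass requires a nonempty
    cell.\<close>
  have coll_pos: "0 < (\<Sum>c\<in>?I. (?s c - 0)\<^sup>2)"
  proof (rule ccontr)
    assume "\<not> ?thesis"
    then have "(\<Sum>c\<in>?I. (?s c - 0)\<^sup>2) = 0"
      by (meson not_less order_antisym sum_nonneg zero_le_power2)
    then have "?s c = 0" if "c \<in> ?I" for c
      using that by (subst (asm) sum_nonneg_eq_0_iff) auto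
    then have "cell_edge h T C c e = {}" if "c \<in> ?I" for c e
      using that by (auto simp: cell_edge_def)
    then have "mass h T C = 0"
      unfolding mass_eq by (intro sum.neutral) auto
    then show False
    proof -
      have "0 < real h * ?N"
        using h by (intro mult_pos_pos N) simp
      moreover have "real h * ?N / 256 \<le> 0"
        using good \<open>mass h T C = 0\<close> by (simp add: good_pairs_def)
      ultimately show ?thesis
        by linarith
    qed
  qed
  have "measure_pmf.prob p {k \<in> space (measure_pmf p). (\<Sum>c\<in>?I. ?X c k) \<le> (\<Sum>c\<in>?I. measure_pmf.expectation p (?X c)) - ?N / 2048}
      \<le> exp (- 2 * (?N / 2048)\<^sup>2 / (\<Sum>c\<in>?I. (?s c - 0)\<^sup>2))"
    using coll_pos by (intro P.Hoeffding_ineq_le) auto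
  also have "\<dots> \<le> exp (- 2)"
  proof -
    have "2 * (\<Sum>c\<in>?I. (?s c - 0)\<^sup>2) \<le> 2 * (?N / 2048)\<^sup>2"
      using coll by (simp add: power_divide)
    then show ?thesis
      using coll_pos by (simp add: field_simps)
  qed
  also have "exp (- 2) \<le> (1 / 4 :: real)"
  proof -
    have "(2::real) \<le> exp 1"
      using exp_ge_add_one_self[of 1] by simp
    then have "2 * 2 \<le> exp 1 * (exp 1 :: real)"
      by (intro mult_mono) auto
    also have "\<dots> = exp 2"
      by (simp flip: exp_add)
    finally show ?thesis
      by (simp add: exp_minus field_simps)
  qed
  finally have prob: "measure_pmf.prob p {k \<in> space (measure_pmf p). (\<Sum>c\<in>?I. ?X c k) \<le> (\<Sum>c\<in>?I. measure_pmf.expectation p (?X c)) - ?N / 2048} \<le> 1 / 4" .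
  have sub: "{k. card (violations h T C k) \<le> ?N / 2048} \<subseteq>
      {k \<in> space (measure_pmf p). (\<Sum>c\<in>?I. ?X c k) \<le> (\<Sum>c\<in>?I. measure_pmf.expectation p (?X c)) - ?N / 2048}"
    using mean by (auto simp: card_violations)
  have "measure_pmf.prob p {k. card (violations h T C k) \<le> ?N / 2048} \<le> 1 / 4"
    by (rule order_trans[OF measure_pmf.finite_measure_mono[OF sub] prob]) simp
  moreover have "measure_pmf.prob p {k. card (violations h T C k) \<le> ?N / 2048}
      = card {k \<in> keys h. card (violations h T C k) \<le> ?N / 2048} / card (keys h)"
    unfolding p_def using keys_ne by (subst measure_pmf_of_set) (auto simp: Int_def)
  ultimately show ?thesis
    using card_keys_pos[of h] h by (simp add: field_simps)
qed


section \<open>Simulation of samples\<close>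

text \<open>
  A sample is simulated by membership queries to at most \<open>m\<close> uniform points of a superset \<open>U\<close> of the ones;
  if all of them fail, the simulation accepts.
\<close>

primrec reject :: "point set \<Rightarrow> (point \<Rightarrow> dtree pmf) \<Rightarrow> nat \<Rightarrow> dtree pmf" where
  "reject U p 0 = return_pmf (Leaf True)"
| "reject U p (Suc m) = bind_pmf (pmf_of_set U) (\<lambda>z. bind_pmf (p z) (\<lambda>t1.
     bind_pmf (reject U p m) (\<lambda>t0. return_pmf (Node z t1 t0))))"

primrec sim :: "point set \<Rightarrow> nat \<Rightarrow> alg \<Rightarrow> dtree pmf" where
  "sim U m (Output b) = return_pmf (Leaf b)"
| "sim U m (MQ x k) = bind_pmf (sim U m (k True)) (\<lambda>t1. bind_pmf (sim U m (k False)) (\<lambda>t0. return_pmf (Node x t1 t0)))"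
| "sim U m (Samp k) = reject U (\<lambda>z. sim U m (k z)) m"

definition acc :: "(point \<Rightarrow> bool) \<Rightarrow> dtree pmf \<Rightarrow> real" where
  "acc f p = pmf (map_pmf (eval f) p) True"

lemma acc_bounds: "0 \<le> acc f p" "acc f p \<le> 1"
  by (simp_all add: acc_def pmf_le_1)

lemma map_eval_Node:
  "map_pmf (eval f) (bind_pmf p1 (\<lambda>t1. bind_pmf p0 (\<lambda>t0. return_pmf (Node x t1 t0))))
    = map_pmf (eval f) (if f x then p1 else p0)"
  unfolding map_bind_pmf map_return_pmf eval.simps
  by (cases "f x") (simp_all add: bind_pmf_const map_pmf_def)

lemma acc_reject_Suc:
  assumes "finite U" "U \<noteq> {}"
  shows "acc f (reject U p (Suc m)) = (\<Sum>z\<in>U. if f z then acc f (p z) else acc f (reject U p m)) / card U"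
proof -
  have "map_pmf (eval f) (reject U p (Suc m)) = bind_pmf (pmf_of_set U) (\<lambda>z. map_pmf (eval f) (if f z then p z else reject U p m))"
    by (subst reject.simps, subst map_bind_pmf, simp only: map_eval_Node)
  then show ?thesis
    unfolding acc_def using assms
    by (simp add: pmf_bind_pmf_of_set if_distrib[where f = "map_pmf (eval f)"] if_distribR if_distrib[where f = "\<lambda>q. pmf q True"] cong: if_cong)
qed

text \<open>\<open>s\<close> is the acceptance probability after a genuine sample from
  \<open>S\<close>. If all \<open>m\<close> attempts fail, the simulation accepts, so 1 replaces
  \<open>s\<close>.\<close>

lemma acc_reject:
  fixes p :: "point \<Rightarrow> dtree pmf"
  assumes U: "finite U" and S: "{z \<in> U. f z} = S" "S \<noteq> {}"
  defines "s \<equiv> (\<Sum>z\<in>S. acc f (p z)) / card S"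
  shows "acc f (reject U p m) = s + (1 - card S / card U) ^ m * (1 - s)"
proof (induction m)
  case 0
  then show ?case by (simp add: acc_def)
next
  case (Suc m)
  let ?b = "acc f (reject U p m)"
  have fin: "finite S" and sub: "S \<subseteq> U" and U': "U \<noteq> {}"
    using U S by auto
  have cU: "0 < real (card U)" and cS: "0 < real (card S)"
    using U U' fin S(2) by (simp_all add: card_gt_0_iff)
  have diff: "real (card (U - S)) = real (card U) - real (card S)"
    using fin sub U by (simp add: card_Diff_subset of_nat_diff card_mono)
  have "(\<Sum>z\<in>U. if f z then acc f (p z) else ?b) = (\<Sum>z\<in>S. acc f (p z)) + (\<Sum>z\<in>U - S. ?b)"
    using U S(1) by (subst sum.If_cases) (auto simp: Int_def intro!: arg_cong2[where f = "(+)"] sum.cong arg_cong[where f = card])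
  also have "\<dots> = card S * s + (real (card U) - real (card S)) * ?b"
    using cS diff by (simp add: s_def)
  finally have "acc f (reject U p (Suc m)) = (card S * s + (real (card U) - real (card S)) * ?b) / card U"
    by (simp only: acc_reject_Suc[OF U U'])
  also have "\<dots> = s + (1 - card S / card U) * (?b - s)"
    using cU by (simp add: field_simps)
  also have "\<dots> = s + (1 - card S / card U) ^ Suc m * (1 - s)"
    unfolding Suc by simp
  finally show ?case .
qed

text \<open>Membership queries are simulated exactly, and each sample adds at most the probability
  that all attempts fail.\<close>

lemma acc_sim:
  assumes T: "alg_queries_le n T q" and U: "finite U" "U \<subseteq> cube n" and f: "ones n f \<subseteq> U" "ones n f \<noteq> {}"
  shows "\<bar>acc f (sim U m T) - pmf (run_alg n f T) True\<bar> \<le> q * (1 - card (ones n f) / card U) ^ m"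
  using T
proof (induction T arbitrary: q)
  case (Output b)
  have "card (ones n f) \<le> card U"
    using U f by (intro card_mono) auto
  then have "0 \<le> 1 - card (ones n f) / card U"
    by (simp add: divide_le_eq)
  then show ?case
    by (simp add: acc_def)
next
  case (MQ x k)
  have "acc f (sim U m (MQ x k)) = acc f (sim U m (k (f x)))"
    unfolding acc_def sim.simps map_eval_Node by (cases "f x") auto
  moreover have k: "alg_queries_le n (k (f x)) (q - 1)" and "0 < q"
    using MQ.prems by auto
  moreover note MQ.IH[OF _ k, simplified]
  ultimately have "\<bar>acc f (sim U m (MQ x k)) - pmf (run_alg n f (MQ x k)) True\<bar> \<le> (q - 1) * (1 - card (ones n f) / card U) ^ m"
    by (simp add: of_nat_diff)
  also have "\<dots> \<le> q * (1 - card (ones n f) / card U) ^ m"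
  proof -
    have "card (ones n f) \<le> card U"
      using U f by (intro card_mono) auto
    then have "0 \<le> 1 - card (ones n f) / card U"
      by (simp add: divide_le_eq)
    then show ?thesis
      by (intro mult_right_mono) auto
  qed
  finally show ?case .
next
  case (Samp k)
  let ?S = "ones n f"
  let ?\<beta> = "1 - card ?S / card U"
  let ?a = "\<lambda>z. acc f (sim U m (k z))" and ?r = "\<lambda>z. pmf (run_alg n f (k z)) True"
  define s where "s = (\<Sum>z\<in>?S. ?a z) / card ?S"
  have S: "{z \<in> U. f z} = ?S"
    using f U by (auto simp: ones_def)
  have fin: "finite ?S"
    using finite_subset[OF f(1) U(1)] .
  have cS: "0 < real (card ?S)"
    using fin f by (simp add: card_gt_0_iff)
  have "card ?S \<le> card U"
    using U f by (intro card_mono) auto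
  then have \<beta>: "0 \<le> ?\<beta>"
    by (simp add: divide_le_eq)
  have q: "0 < q"
    using Samp.prems by simp
  have "?a z \<le> 1" "0 \<le> ?a z" for z
    by (rule acc_bounds)+
  then have "0 \<le> s" "s \<le> 1"
    using cS sum_mono[of ?S ?a "\<lambda>_. 1"] by (simp_all add: s_def sum_nonneg divide_le_eq)
  then have "\<bar>acc f (sim U m (Samp k)) - s\<bar> \<le> ?\<beta> ^ m"
    unfolding sim.simps acc_reject[OF U(1) S f(2)] s_def[symmetric] using \<beta> by (simp add: abs_mult mult_left_le)
  moreover have "\<bar>s - pmf (run_alg n f (Samp k)) True\<bar> \<le> (q - 1) * ?\<beta> ^ m"
  proof -
    have "pmf (run_alg n f (Samp k)) True = (\<Sum>z\<in>?S. ?r z) / card ?S"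
      using fin f(2) by (simp add: pmf_bind_pmf_of_set)
    then have "\<bar>s - pmf (run_alg n f (Samp k)) True\<bar> = \<bar>\<Sum>z\<in>?S. ?a z - ?r z\<bar> / card ?S"
      by (simp add: s_def diff_divide_distrib[symmetric] sum_subtractf)
    also have "\<dots> \<le> (\<Sum>z\<in>?S. \<bar>?a z - ?r z\<bar>) / card ?S"
      by (intro divide_right_mono sum_abs) auto
    also have "\<dots> \<le> (\<Sum>z\<in>?S. (q - 1) * ?\<beta> ^ m) / card ?S"
    proof (intro divide_right_mono sum_mono)
      fix z assume "z \<in> ?S"
      then have "alg_queries_le n (k z) (q - 1)"
        using Samp.prems by (simp add: ones_def)
      then show "\<bar>?a z - ?r z\<bar> \<le> (q - 1) * ?\<beta> ^ m"
        using Samp.IH[of "k z" "q - 1"] q by (simp add: of_nat_diff)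
    qed simp
    also have "\<dots> = (q - 1) * ?\<beta> ^ m"
      using cS by simp
    finally show ?thesis .
  qed
  ultimately have "\<bar>acc f (sim U m (Samp k)) - pmf (run_alg n f (Samp k)) True\<bar> \<le> ?\<beta> ^ m + (q - 1) * ?\<beta> ^ m"
    by linarith
  also have "\<dots> = q * ?\<beta> ^ m"
    using q by (simp add: of_nat_diff algebra_simps)
  finally show ?case .
qed

lemma depth_reject:
  assumes "finite U" "U \<noteq> {}" "\<And>z t'. z \<in> U \<Longrightarrow> t' \<in> set_pmf (p z) \<Longrightarrow> depth t' \<le> d" "t \<in> set_pmf (reject U p m)"
  shows "depth t \<le> d + m"
  using assms(4)
proof (induction m arbitrary: t)
  case (Suc m)
  then obtain z t1 t0 where "z \<in> U" "t1 \<in> set_pmf (p z)" "t0 \<in> set_pmf (reject U p m)" "t = Node z t1 t0"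
    using assms(1,2) by (auto simp: set_bind_pmf)
  then show ?case
    using Suc.IH[of t0] assms(3)[of z t1] by simp
qed simp

lemma depth_sim:
  assumes "alg_queries_le n T q" "finite U" "U \<noteq> {}" "U \<subseteq> cube n" "1 \<le> m" "t \<in> set_pmf (sim U m T)"
  shows "depth t \<le> q * m"
  using assms(1,6)
proof (induction T arbitrary: q t)
  case (MQ x k)
  then obtain t1 t0 where t: "t1 \<in> set_pmf (sim U m (k True))" "t0 \<in> set_pmf (sim U m (k False))" "t = Node x t1 t0"
    by (auto simp: set_bind_pmf)
  have q: "0 < q" and k: "alg_queries_le n (k b) (q - 1)" for b
    using MQ.prems by auto
  have "depth t1 \<le> (q - 1) * m" "depth t0 \<le> (q - 1) * m"
    using MQ.IH[OF _ k t(1)] MQ.IH[OF _ k t(2)] by auto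
  then have "depth t \<le> 1 + (q - 1) * m"
    by (simp add: t)
  also have "\<dots> \<le> m + (q - 1) * m"
    using assms(5) by simp
  also have "\<dots> = q * m"
    using q by (cases q) auto
  finally show ?case .
next
  case (Samp k)
  have q: "0 < q" and k: "alg_queries_le n (k z) (q - 1)" if "z \<in> cube n" for z
    using Samp.prems that by auto
  have "depth t \<le> (q - 1) * m + m"
  proof (rule depth_reject[OF assms(2,3)])
    show "t \<in> set_pmf (reject U (\<lambda>z. sim U m (k z)) m)"
      using Samp.prems by simp
    fix z t' assume "z \<in> U" "t' \<in> set_pmf (sim U m (k z))"
    then show "depth t' \<le> (q - 1) * m"
      using Samp.IH[OF _ k] assms(4) by blast
  qed
  also have "\<dots> = q * m"
    using q assms(3,4) by (cases q) auto
  finally show ?case .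
qed simp

lemma acc_sim_rand:
  assumes A: "queries_le n A q" and U: "finite U" "U \<subseteq> cube n" and f: "ones n f \<subseteq> U" "ones n f \<noteq> {}"
  shows "\<bar>acc f (bind_pmf A (sim U m)) - pmf (run n f A) True\<bar> \<le> q * (1 - card (ones n f) / card U) ^ m"
proof -
  let ?B = "q * (1 - card (ones n f) / card U) ^ m"
  let ?g = "\<lambda>T. acc f (sim U m T)" and ?r = "\<lambda>T. pmf (run_alg n f T) True"
  have 1: "acc f (bind_pmf A (sim U m)) = measure_pmf.expectation A ?g"
    unfolding acc_def map_bind_pmf pmf_bind by (rule refl)
  have 2: "pmf (run n f A) True = measure_pmf.expectation A ?r"
    unfolding run_def pmf_bind by (rule refl)
  have ig: "integrable (measure_pmf A) ?g" and ir: "integrable (measure_pmf A) ?r"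
    by (auto intro!: measure_pmf.integrable_const_bound[where B = 1] simp: acc_bounds pmf_le_1)
  have "\<bar>measure_pmf.expectation A (\<lambda>T. ?g T - ?r T)\<bar> \<le> measure_pmf.expectation A (\<lambda>T. \<bar>?g T - ?r T\<bar>)"
    by (rule integral_abs_bound)
  also have "\<dots> \<le> measure_pmf.expectation A (\<lambda>_. ?B)"
  proof (rule integral_mono_AE)
    show "AE T in measure_pmf A. \<bar>?g T - ?r T\<bar> \<le> ?B"
      using A acc_sim[OF _ U f] by (intro AE_pmfI) (auto simp: queries_le_def)
  qed (use ig ir in auto)
  also have "\<dots> = ?B"
    by simp
  finally show ?thesis
    unfolding 1 2 using ig ir by simp
qed


section \<open>The lower bound\<close>

text \<open>Good runs are compared for fixed terms and clauses. Bad runs are controlled only on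
  average over all pairs; restriction to the good pairs, at least 1/512 of all, costs a factor of
  512, whence 2048 = 4 * 512.\<close>

lemma sum_accept_yes_le:
  assumes h: "2 \<le> h" and large: "2 ^ 32 * (4*h + 1) ^ 30 \<le> (4::nat) ^ h"
    and K: "1 \<le> K" and depth: "depth t \<le> Q"
    and small: "2 * real K * real Q * sqrt (real Q) / real h \<le> 1"
  shows "(\<Sum>(T, C)\<in>good_pairs h. \<Sum>k\<in>keys h. of_bool (eval (yes_fun h T C k) t))
    \<le> (\<Sum>(T, C)\<in>good_pairs h. \<Sum>k\<in>keys h. of_bool (eval (no_fun h T C k) t))
      + (2 * real K * real Q * sqrt (real Q) / real h + 2048 * real Q ^ 3 / 2 ^ K) * (real (card (good_pairs h)) * real (card (keys h)))"
proof -
  let ?l = "2 * real K * real Q * sqrt (real Q) / real h"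
  let ?G = "good_pairs h" and ?tc = "terms h \<times> clauses h"
  let ?yes = "\<lambda>T C k. eval (yes_fun h T C k) t" and ?no = "\<lambda>T C k. eval (no_fun h T C k) t"
  let ?good = "\<lambda>T C k. good_run h K T C (queried (yes_fun h T C k) t)"
  have Gtc: "?G \<subseteq> ?tc"
    by (auto simp: good_pairs_def)
  have pair: "(\<Sum>k\<in>keys h. of_bool (?yes T C k)) \<le> (\<Sum>k\<in>keys h. of_bool (?no T C k))
      + ?l * card (keys h) + (\<Sum>k\<in>keys h. of_bool (\<not> ?good T C k))" for T C
  proof -
    let ?y = "real (card {k \<in> keys h. ?yes T C k \<and> ?good T C k})"
    have "(\<Sum>k\<in>keys h. of_bool (?yes T C k)) \<le> (\<Sum>k\<in>keys h. of_bool (?yes T C k \<and> ?good T C k) + of_bool (\<not> ?good T C k) :: real)"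
      by (intro sum_mono) (simp add: of_bool_def)
    also have "\<dots> = ?y + (\<Sum>k\<in>keys h. of_bool (\<not> ?good T C k))"
      by (simp only: sum.distrib card_filter_eq_sum[OF finite_keys])
    also have "?y \<le> (\<Sum>k\<in>keys h. of_bool (?no T C k)) + ?l * card (keys h)"
    proof -
      have "(1 - ?l) * ?y \<le> (\<Sum>k\<in>keys h. of_bool (?no T C k))"
        using card_accept_no_ge[OF _ K depth small, of T C] h
        by (simp only: card_filter_eq_sum[OF finite_keys])
      moreover have "?l * ?y \<le> ?l * card (keys h)"
        by (intro mult_left_mono of_nat_mono card_mono) auto
      ultimately show ?thesis
        by (simp add: left_diff_distrib)
    qed
    finally show ?thesis by simp
  qed
  have "(\<Sum>(T, C)\<in>?G. \<Sum>k\<in>keys h. of_bool (?yes T C k))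
      \<le> (\<Sum>(T, C)\<in>?G. (\<Sum>k\<in>keys h. of_bool (?no T C k)) + ?l * card (keys h) + (\<Sum>k\<in>keys h. of_bool (\<not> ?good T C k)))"
    by (intro sum_mono) (use pair in auto)
  also have "\<dots> = (\<Sum>(T, C)\<in>?G. \<Sum>k\<in>keys h. of_bool (?no T C k)) + ?l * (real (card ?G) * card (keys h))
      + (\<Sum>(T, C)\<in>?G. \<Sum>k\<in>keys h. of_bool (\<not> ?good T C k))"
    by (simp only: split_def sum.distrib sum_constant) (simp only: mult_ac)
  also have "(\<Sum>(T, C)\<in>?G. \<Sum>k\<in>keys h. of_bool (\<not> ?good T C k)) \<le> 2048 * real Q ^ 3 / 2 ^ K * (real (card ?G) * card (keys h))"
  proof -
    have "(\<Sum>(T, C)\<in>?G. \<Sum>k\<in>keys h. of_bool (\<not> ?good T C k)) \<le> (\<Sum>(T, C)\<in>?tc. \<Sum>k\<in>keys h. of_bool (\<not> ?good T C k) :: real)"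
      using Gtc by (intro sum_mono2) (auto intro!: sum_nonneg)
    also have "\<dots> = (\<Sum>k\<in>keys h. \<Sum>(T, C)\<in>?tc. of_bool (\<not> ?good T C k))"
      unfolding split_def by (rule sum.swap)
    also have "\<dots> \<le> (\<Sum>k\<in>keys h. 4 * real Q ^ 3 / 2 ^ K * real (card (terms h)) * real (card (clauses h)))"
      using sum_bad_run_le[OF h depth] by (intro sum_mono) (simp only: sum.cartesian_product[symmetric] yes_fun_def)
    also have "\<dots> = 4 * real Q ^ 3 / 2 ^ K * card (keys h) * (real (card (terms h)) * real (card (clauses h)))"
      by simp
    also have "\<dots> \<le> 4 * real Q ^ 3 / 2 ^ K * card (keys h) * (512 * real (card ?G))"
      using card_good_pairs_ge[OF h large] by (intro mult_left_mono) auto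
    also have "\<dots> = 2048 * real Q ^ 3 / 2 ^ K * (real (card ?G) * card (keys h))"
      by simp
    finally show ?thesis .
  qed
  finally show ?thesis
    by (simp add: distrib_right)
qed

lemma sum_acc_eq:
  "(\<Sum>p\<in>G. \<Sum>k\<in>B. acc (f p k) P) = measure_pmf.expectation P (\<lambda>t. \<Sum>p\<in>G. \<Sum>k\<in>B. of_bool (eval (f p k) t))"
proof -
  have int: "integrable (measure_pmf P) (\<lambda>t. of_bool (eval (f p k) t) :: real)" for p k
    by (intro measure_pmf.integrable_const_bound[where B = 1]) auto
  have "acc (f p k) P = measure_pmf.expectation P (\<lambda>t. of_bool (eval (f p k) t))" for p k
  proof -
    have "(\<lambda>t. of_bool (eval (f p k) t) :: real) = indicator {t. eval (f p k) t}"
      by (auto simp: indicator_def of_bool_def)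
    moreover have "eval (f p k) -` {True} = {t. eval (f p k) t}"
      by auto
    ultimately show ?thesis
      by (simp add: acc_def pmf_map)
  qed
  then show ?thesis
    using int by (simp add: Bochner_Integration.integral_sum Bochner_Integration.integrable_sum)
qed

text \<open>The constants 1/16 and 2 of the promise arise here, from \<open>card_upper_ge\<close>
  and \<open>card_upper_le\<close>; their quotient is the density 1/32 of the ones in the sampling
  set.\<close>

lemma glue_promise:
  assumes h: "8 \<le> h"
  defines "N \<equiv> real (layer_size (4*h))"
  shows "glue h T C v \<in> theta_class (4*h) (1/16) 2"
    and "ones (4*h) (glue h T C v) \<subseteq> upper (4*h) (3*h)" "ones (4*h) (glue h T C v) \<noteq> {}"
    and "1 / 32 \<le> real (card (ones (4*h) (glue h T C v))) / real (card (upper (4*h) (3*h)))"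
    and "0 < real (card (ones (4*h) (glue h T C v)))" "real (card (ones (4*h) (glue h T C v))) \<le> 2 * N"
proof -
  let ?o = "ones (4*h) (glue h T C v)" and ?U = "upper (4*h) (3*h)"
  have N: "N = real (4*h choose (3*h))"
    by (simp add: N_def layer_size_def)
  show sub: "?o \<subseteq> ?U"
    by (rule ones_glue_subset)
  have fin: "finite ?o"
    using sub finite_upper finite_subset by blast
  have "4*h choose (3*h) \<le> 16 * card ?o"
    using card_upper_ge[OF h] card_mono[OF fin ones_glue_supset] by (meson le_trans mult_le_mono2)
  then have lower: "N \<le> 16 * real (card ?o)"
    unfolding N by linarith
  have upper: "real (card ?U) \<le> 2 * N"
    using card_upper_le[of h] unfolding N by linarith
  have "card ?o \<le> card ?U"
    using sub by (intro card_mono) auto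
  with upper show up: "real (card ?o) \<le> 2 * N"
    by linarith
  have "0 < N"
    unfolding N by simp
  with lower show pos: "0 < real (card ?o)"
    by linarith
  then show "?o \<noteq> {}"
    by auto
  show "1 / 32 \<le> real (card ?o) / real (card ?U)"
    using lower upper pos \<open>card ?o \<le> card ?U\<close> by (simp add: field_simps)
  show "glue h T C v \<in> theta_class (4*h) (1/16) 2"
    using lower up by (simp add: theta_class_def N_def)
qed

text \<open>In units of 1/96, yes-functions are accepted with average probability at least 63, that
  is 2/3 minus the simulation error. No-functions get at most 24 from keys with few violations plus
  33 from the others. Indistinguishability allows a gap of only 4, but 63 > 57 + 4.\<close>

lemma no_small_tester:
  assumes h: "8 \<le> h" and large: "2 ^ 32 * (4*h + 1) ^ 30 \<le> (4::nat) ^ h"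
    and K: "1 \<le> K" and m: "1 \<le> m" and Q: "Q = q * m"
    and s1: "2 * real K * real Q * sqrt (real Q) / real h \<le> 1 / 48"
    and s2: "2048 * real Q ^ 3 / 2 ^ K \<le> 1 / 48"
    and s3: "real q * (31 / 32) ^ m \<le> 1 / 96"
    and A: "monotonicity_tester (4*h) (1 / 4096) (theta_class (4*h) (1/16) 2) A" "queries_le (4*h) A q"
  shows False
proof -
  let ?G = "good_pairs h" and ?U = "upper (4*h) (3*h)" and ?N = "real (4*h choose (3*h))"
  define P where "P = bind_pmf A (sim ?U m)"
  let ?yes = "\<lambda>p. yes_fun h (fst p) (snd p)" and ?no = "\<lambda>p. no_fun h (fst p) (snd p)"
  let ?R = "real (card ?G) * real (card (keys h))"
  have h2: "2 \<le> h"
    using h by simp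
  have U: "finite ?U" "?U \<subseteq> cube (4*h)" "?U \<noteq> {}"
    using glue_promise(2,3)[OF h] by (simp, simp add: upper_def, blast)
  have finG: "finite ?G"
    by (rule finite_subset[of _ "terms h \<times> clauses h"]) (auto simp: good_pairs_def)
  have "0 < real (card (terms h)) * real (card (clauses h)) / 512"
    using card_terms_pos card_clauses_pos by simp
  then have "0 < real (card ?G)"
    using card_good_pairs_ge[OF h2 large] by linarith
  then have R: "0 < ?R"
    using card_keys_pos[of h] h by simp
  have acc_diff: "\<bar>acc (glue h T C v) P - pmf (run (4*h) (glue h T C v) A) True\<bar> \<le> 1 / 96" for T C v
  proof -
    let ?\<alpha> = "real (card (ones (4*h) (glue h T C v))) / real (card ?U)"
    have "real (card (ones (4*h) (glue h T C v))) \<le> real (card ?U)"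
      using glue_promise(2)[OF h] by (intro of_nat_mono card_mono) auto
    then have "?\<alpha> \<le> 1"
      by (simp add: divide_le_eq)
    moreover have "1 / 32 \<le> ?\<alpha>"
      by (rule glue_promise(4)[OF h])
    ultimately have "(1 - ?\<alpha>) ^ m \<le> (31 / 32) ^ m"
      by (intro power_mono) auto
    then have "real q * (1 - ?\<alpha>) ^ m \<le> 1 / 96"
      using s3 mult_left_mono[of "(1 - ?\<alpha>) ^ m" "(31 / 32) ^ m" "real q"] by linarith
    then show ?thesis
      unfolding P_def using acc_sim_rand[OF A(2) U(1,2) glue_promise(2,3)[OF h]] order_trans by blast
  qed
  have dep: "depth t \<le> Q" if "t \<in> set_pmf P" for t
    using that A(2) depth_sim[OF _ U(1,3,2) m] unfolding P_def Q by (auto simp: queries_le_def set_bind_pmf)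
  have tester: "(monotone_fun (4*h) f \<longrightarrow> pmf (run (4*h) f A) True \<ge> 2/3) \<and>
      (rel_dist_mono (4*h) f \<ge> 1 / 4096 \<longrightarrow> pmf (run (4*h) f A) False \<ge> 2/3)"
    if "f \<in> theta_class (4*h) (1/16) 2" for f
    using A(1) that by (simp add: monotonicity_tester_def)
  have yes: "2/3 - 1/96 \<le> acc (yes_fun h T C k) P" for T C k
  proof -
    have "yes_fun h T C k \<in> theta_class (4*h) (1/16) 2"
      unfolding yes_fun_def by (rule glue_promise(1)[OF h])
    then have "2/3 \<le> pmf (run (4*h) (yes_fun h T C k) A) True"
      using tester monotone_yes_fun by blast
    moreover have "\<bar>acc (yes_fun h T C k) P - pmf (run (4*h) (yes_fun h T C k) A) True\<bar> \<le> 1/96"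
      unfolding yes_fun_def by (rule acc_diff)
    ultimately show ?thesis by linarith
  qed
  have no: "acc (no_fun h T C k) P \<le> 11/32" if "?N / 2048 < card (violations h T C k)" for T C k
  proof -
    let ?o = "real (card (ones (4*h) (no_fun h T C k)))"
    have o: "0 < ?o" "?o \<le> 2 * ?N"
      using glue_promise(5,6)[OF h] by (auto simp: no_fun_def layer_size_def)
    have "1 / 4096 \<le> card (violations h T C k) / ?o"
      using o that by (simp add: field_simps)
    then have "1 / 4096 \<le> rel_dist_mono (4*h) (no_fun h T C k)"
      using rel_dist_mono_no_fun order_trans by blast
    moreover have "no_fun h T C k \<in> theta_class (4*h) (1/16) 2"
      unfolding no_fun_def by (rule glue_promise(1)[OF h])
    ultimately have "2/3 \<le> pmf (run (4*h) (no_fun h T C k) A) False"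
      using tester by blast
    then have "pmf (run (4*h) (no_fun h T C k) A) True \<le> 1/3"
      by (simp add: pmf_False_conv_True)
    moreover have "\<bar>acc (no_fun h T C k) P - pmf (run (4*h) (no_fun h T C k) A) True\<bar> \<le> 1/96"
      unfolding no_fun_def by (rule acc_diff)
    ultimately show ?thesis by linarith
  qed
  have "(2/3 - 1/96) * ?R = (\<Sum>p\<in>?G. \<Sum>k\<in>keys h. 2/3 - 1/96)"
    by simp
  also have "\<dots> \<le> (\<Sum>p\<in>?G. \<Sum>k\<in>keys h. acc (?yes p k) P)"
    by (intro sum_mono yes)
  also have "\<dots> = measure_pmf.expectation P (\<lambda>t. \<Sum>p\<in>?G. \<Sum>k\<in>keys h. of_bool (eval (?yes p k) t))"
    by (rule sum_acc_eq)
  also have "\<dots> \<le> measure_pmf.expectation P (\<lambda>t. (\<Sum>p\<in>?G. \<Sum>k\<in>keys h. of_bool (eval (?no p k) t)) + (1/48 + 1/48) * ?R)"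
  proof (rule integral_mono_AE)
    show "AE t in measure_pmf P. (\<Sum>p\<in>?G. \<Sum>k\<in>keys h. of_bool (eval (?yes p k) t))
        \<le> (\<Sum>p\<in>?G. \<Sum>k\<in>keys h. of_bool (eval (?no p k) t)) + (1/48 + 1/48) * ?R"
    proof (intro AE_pmfI)
      fix t assume "t \<in> set_pmf P"
      then have "(\<Sum>p\<in>?G. \<Sum>k\<in>keys h. of_bool (eval (?yes p k) t)) \<le> (\<Sum>p\<in>?G. \<Sum>k\<in>keys h. of_bool (eval (?no p k) t))
         + (2 * real K * real Q * sqrt (real Q) / real h + 2048 * real Q ^ 3 / 2 ^ K) * ?R"
        using sum_accept_yes_le[OF h2 large K dep] s1 by (simp add: split_def)
      also have "(2 * real K * real Q * sqrt (real Q) / real h + 2048 * real Q ^ 3 / 2 ^ K) * ?R \<le> (1/48 + 1/48) * ?R"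
        using s1 s2 R by (intro mult_right_mono add_mono) auto
      finally show "(\<Sum>p\<in>?G. \<Sum>k\<in>keys h. of_bool (eval (?yes p k) t))
        \<le> (\<Sum>p\<in>?G. \<Sum>k\<in>keys h. of_bool (eval (?no p k) t)) + (1/48 + 1/48) * ?R"
        by simp
    qed
    have int: "integrable (measure_pmf P) (\<lambda>t. of_bool (eval f t) :: real)" for f
      by (intro measure_pmf.integrable_const_bound[where B = 1]) auto
    show "integrable (measure_pmf P) (\<lambda>t. \<Sum>p\<in>?G. \<Sum>k\<in>keys h. of_bool (eval (?yes p k) t) :: real)"
      by (intro Bochner_Integration.integrable_sum int)
    show "integrable (measure_pmf P) (\<lambda>t. (\<Sum>p\<in>?G. \<Sum>k\<in>keys h. of_bool (eval (?no p k) t)) + (1/48 + 1/48) * ?R)"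
      by (intro Bochner_Integration.integrable_add Bochner_Integration.integrable_sum int) simp
  qed
  also have "\<dots> = (\<Sum>p\<in>?G. \<Sum>k\<in>keys h. acc (?no p k) P) + (1/48 + 1/48) * ?R"
  proof -
    have int: "integrable (measure_pmf P) (\<lambda>t. of_bool (eval f t) :: real)" for f
      by (intro measure_pmf.integrable_const_bound[where B = 1]) auto
    have "integrable (measure_pmf P) (\<lambda>t. \<Sum>p\<in>?G. \<Sum>k\<in>keys h. of_bool (eval (?no p k) t) :: real)"
      by (intro Bochner_Integration.integrable_sum int)
    then show ?thesis
      by (subst Bochner_Integration.integral_add) (auto simp: sum_acc_eq[where f = ?no])
  qed
  also have "(\<Sum>p\<in>?G. \<Sum>k\<in>keys h. acc (?no p k) P) \<le> (\<Sum>p\<in>?G. (1/4 + 11/32) * real (card (keys h)))"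
  proof (intro sum_mono)
    fix p assume p: "p \<in> ?G"
    let ?few = "\<lambda>k. card (violations h (fst p) (snd p) k) \<le> ?N / 2048"
    have "(\<Sum>k\<in>keys h. acc (?no p k) P) \<le> (\<Sum>k\<in>keys h. of_bool (?few k) + 11/32)"
    proof (intro sum_mono)
      fix k
      show "acc (?no p k) P \<le> of_bool (?few k) + 11/32"
        using no[of "fst p" "snd p" k] acc_bounds(2)[of "?no p k" P] by (cases "?few k") auto
    qed
    also have "\<dots> = real (card {k \<in> keys h. ?few k}) + 11/32 * real (card (keys h))"
      by (simp only: sum.distrib card_filter_eq_sum[OF finite_keys] sum_constant mult.commute)
    also have "real (card {k \<in> keys h. ?few k}) \<le> real (card (keys h)) / 4"
      using card_few_violations_le[OF h2, of "fst p" "snd p"] p by simp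
    finally show "(\<Sum>k\<in>keys h. acc (?no p k) P) \<le> (1/4 + 11/32) * real (card (keys h))"
      by simp
  qed
  finally have "(2/3 - 1/96) * ?R \<le> (1/4 + 11/32) * ?R + (1/48 + 1/48) * ?R"
    by simp
  then show False
  proof -
    have "False" if "(2/3 - 1/96) * r \<le> (1/4 + 11/32) * r + (1/48 + 1/48) * r" "0 < r" for r :: real
      using that by (simp add: field_simps)
    with R show ?thesis
      using \<open>(2/3 - 1/96) * ?R \<le> _\<close> by blast
  qed
qed

section \<open>Choice of parameters\<close>

text \<open>With \<open>x\<close> as \<open>h\<close>, \<open>B\<close> bounds the number of calls
  and \<open>R\<close> the depth after simulating each sample by about \<open>64 * ln x\<close>
  queries. \<open>R\<close> has order x^(2/3) / (ln x)^2, so with K of order ln x the loss K R^(3/2)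
  / x has order 1 / (ln x)^2; this is where the cube of the logarithm is spent.\<close>

lemma eventually_parameters:
  defines "B \<equiv> \<lambda>x::real. (3 * x) powr (2/3) / (2/3 * ln x) ^ 3"
  defines "R \<equiv> \<lambda>x::real. B x * (64 * ln x + 1)"
  shows "\<forall>\<^sub>F x in at_top. 2 ^ 32 * (4 * x + 1) ^ 30 \<le> 4 powr x \<and>
    2 * (6 * ln x + 1) * R x * sqrt (R x) / x \<le> 1 / 48 \<and>
    2048 * R x ^ 3 / 2 powr (6 * ln x) \<le> 1 / 48 \<and>
    B x * exp (- 2 * ln x) \<le> 1 / 96 \<and> 1 \<le> ln x"
  unfolding eventually_conj_iff
proof (intro conjI)
  show "\<forall>\<^sub>F x::real in at_top. 2 ^ 32 * (4 * x + 1) ^ 30 \<le> 4 powr x"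
    by real_asymp
  show "\<forall>\<^sub>F x in at_top. 2 * (6 * ln x + 1) * R x * sqrt (R x) / x \<le> 1 / 48"
    unfolding R_def B_def by real_asymp
  show "\<forall>\<^sub>F x in at_top. 2048 * R x ^ 3 / 2 powr (6 * ln x) \<le> 1 / 48"
  proof -
    have "((\<lambda>x. 2048 * R x ^ 3 / x ^ 3) \<longlongrightarrow> 0) at_top"
      unfolding R_def B_def by real_asymp
    then have "\<forall>\<^sub>F x in at_top. 2048 * R x ^ 3 / x ^ 3 < 1 / 48"
      by (rule order_tendstoD) simp
    moreover have "\<forall>\<^sub>F x::real in at_top. 1 \<le> ln x"
      by real_asymp
    ultimately show ?thesis
      using eventually_ge_at_top[of 1]
    proof eventually_elim
      case (elim x)
      \<comment> \<open>This makes \<open>2 powr (6 * ln x)\<close> at least \<open>x ^ 3\<close>,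
        whereas \<open>R x ^ 3\<close> is of order x^2 up to logarithms.\<close>
      have "1 / 2 \<le> ln (2::real)"
        using ln2_ge_two_thirds by simp
      have "x ^ 3 = exp (3 * ln x)"
        using elim by (simp add: exp_of_nat_mult[of 3, simplified])
      also have "\<dots> \<le> exp (6 * ln x * ln 2)"
      proof -
        have "6 * ln x * (1 / 2) \<le> 6 * ln x * ln 2"
          using elim \<open>1 / 2 \<le> ln 2\<close> by (intro mult_left_mono) linarith+
        then show ?thesis by simp
      qed
      also have "\<dots> = 2 powr (6 * ln x)"
        by (simp add: powr_def)
      finally have le: "x ^ 3 \<le> 2 powr (6 * ln x)" .
      have "0 \<le> R x"
        using elim unfolding R_def B_def
        by (intro mult_nonneg_nonneg divide_nonneg_nonneg zero_le_power) auto
      then have "2048 * R x ^ 3 / 2 powr (6 * ln x) \<le> 2048 * R x ^ 3 / x ^ 3"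
        using le elim by (intro divide_left_mono mult_pos_pos) auto
      then show ?case
        using elim by linarith
    qed
  qed
  show "\<forall>\<^sub>F x in at_top. B x * exp (- 2 * ln x) \<le> 1 / 96"
    unfolding B_def by real_asymp
  show "\<forall>\<^sub>F x::real in at_top. 1 \<le> ln x"
    by real_asymp
qed

text \<open>The estimates are 4^h and 2^(4h) for the binomial coefficient, with ln 4 at least 1 and
  4 ln 2 below 3.\<close>

lemma ln_layer_size_bounds:
  assumes h: "1 \<le> h"
  shows "real h \<le> ln (real (layer_size (4*h)))" "ln (real (layer_size (4*h))) \<le> 3 * real h"
proof -
  have N: "layer_size (4*h) = 4*h choose (3*h)"
    by (simp add: layer_size_def)
  have pos: "0 < real (4*h choose (3*h))"
    by simp
  have "exp (1::real) \<le> 4"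
    using exp_le by simp
  then have "1 \<le> ln (4::real)"
    by (simp add: ln_ge_iff)
  then have "real h \<le> real h * ln 4"
    by (simp add: mult_le_cancel_left1)
  also have "\<dots> = ln (real (4 ^ h))"
    by (simp add: ln_realpow)
  also have "\<dots> \<le> ln (real (4*h choose (3*h)))"
    using layer_size_ge[OF h] pos by (subst ln_le_cancel_iff) (auto simp only: of_nat_le_iff of_nat_0_less_iff zero_less_power zero_less_numeral)
  finally show "real h \<le> ln (real (layer_size (4*h)))"
    by (simp add: N)
  have "ln (real (4*h choose (3*h))) \<le> ln (real (2 ^ (4*h)))"
    using binomial_le_pow2[of "4*h" "3*h"] pos by (subst ln_le_cancel_iff) (auto simp only: of_nat_le_iff of_nat_0_less_iff zero_less_power zero_less_numeral)
  also have "\<dots> = 4 * real h * ln 2"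
    by (simp add: ln_realpow)
  also have "\<dots> \<le> 4 * real h * (25 / 36)"
    using ln2_le_25_over_36 by (intro mult_left_mono) auto
  finally show "ln (real (layer_size (4*h))) \<le> 3 * real h"
    by (simp add: N)
qed

theorem theorem6p1:
  shows "\<exists>\<epsilon>\<^sub>0>0. \<exists>c\<^sub>1>0. \<exists>c\<^sub>2>0. \<exists>C>0. \<exists>(k::nat) (n\<^sub>0::nat).
    \<forall>n\<ge>n\<^sub>0. 4 dvd n \<longrightarrow>
      (\<forall>A q. monotonicity_tester n \<epsilon>\<^sub>0 (theta_class n c\<^sub>1 c\<^sub>2) A \<and> queries_le n A q \<longrightarrow>
         (let L = ln (real (layer_size n)) powr (2/3)
          in real q \<ge> C * L / (ln L) ^ k))"
proof -
  define B where "B x = (3 * x) powr (2/3) / (2/3 * ln x) ^ 3" for x :: real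
  define R where "R x = B x * (64 * ln x + 1)" for x :: real
  obtain x\<^sub>0 where x0: "2 ^ 32 * (4 * x + 1) ^ 30 \<le> 4 powr x"
      "2 * (6 * ln x + 1) * R x * sqrt (R x) / x \<le> 1 / 48"
      "2048 * R x ^ 3 / 2 powr (6 * ln x) \<le> 1 / 48"
      "B x * exp (- 2 * ln x) \<le> 1 / 96" "1 \<le> ln x" if "x\<^sub>0 \<le> x" for x
    using eventually_parameters unfolding eventually_at_top_linorder B_def R_def by blast
  \<comment> \<open>Makes \<open>h = n / 4\<close> at least 8, for counting the ones, and at least
    \<open>x\<^sub>0\<close>, for the asymptotic estimates.\<close>
  define n\<^sub>0 where "n\<^sub>0 = 4 * max 8 (nat \<lceil>x\<^sub>0\<rceil>)"
  have bound: "real q \<ge> 1 * (ln (real (layer_size n)) powr (2/3)) / (ln (ln (real (layer_size n)) powr (2/3))) ^ 3"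
    if n: "n\<^sub>0 \<le> n" "4 dvd n" and A: "monotonicity_tester n (1 / 4096) (theta_class n (1/16) 2) A" "queries_le n A q"
    for n A q
  proof (rule ccontr)
    define L where "L = ln (real (layer_size n)) powr (2/3)"
    assume "\<not> ?thesis"
    then have q: "real q < L / (ln L) ^ 3"
      by (simp add: L_def)
    obtain h where nh: "n = 4 * h"
      using n(2) by blast
    have h: "8 \<le> h" and hx: "x\<^sub>0 \<le> real h"
      using n(1) unfolding nh n\<^sub>0_def by linarith+
    note par = x0[OF hx]
    have lnN: "real h \<le> ln (real (layer_size n))" "ln (real (layer_size n)) \<le> 3 * real h"
      using ln_layer_size_bounds[of h] h by (simp_all add: nh)
    have L_le: "L \<le> (3 * real h) powr (2/3)"
      unfolding L_def using lnN h by (intro powr_mono2) auto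
    have "real h powr (2/3) \<le> L"
      unfolding L_def using lnN by (intro powr_mono2) auto
    then have "ln (real h powr (2/3)) \<le> ln L"
      using h by (subst ln_le_cancel_iff) (auto intro: less_le_trans[of 0 "real h powr (2/3)"])
    then have lnL: "2/3 * ln (real h) \<le> ln L"
      using h by (simp add: ln_powr)
    have "L / (ln L) ^ 3 \<le> B (real h)"
      unfolding B_def using L_le lnL par(5) by (intro frac_le power_mono zero_less_power) (auto simp: L_def)
    then have qB: "real q \<le> B (real h)"
      using q by linarith
    \<comment> \<open>\<open>(31/32)^m \<le> exp (- m/32) \<le> h^-2\<close> makes the simulation
      error small even after multiplication by \<open>q\<close>. With \<open>K\<close> below, 2^K is
      at least h^3, which outweighs the cube of the depth.\<close>
    define m where "m = nat \<lceil>64 * ln (real h)\<rceil>"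
    define K where "K = nat \<lceil>6 * ln (real h)\<rceil>"
    have m: "64 * ln (real h) \<le> m" "real m \<le> 64 * ln (real h) + 1" "1 \<le> m"
      and K: "6 * ln (real h) \<le> K" "real K \<le> 6 * ln (real h) + 1" "1 \<le> K"
      using par(5) unfolding m_def K_def by linarith+
    have QR: "real (q * m) \<le> R (real h)"
      unfolding R_def of_nat_mult using qB m by (intro mult_mono) auto
    have R0: "0 \<le> R (real h)"
      using QR of_nat_0_le_iff order_trans by blast
    show False
    proof (rule no_small_tester[OF h _ K(3) m(3) refl])
      show "monotonicity_tester (4*h) (1 / 4096) (theta_class (4*h) (1/16) 2) A" "queries_le (4*h) A q"
        using A by (simp_all add: nh)
      have "real (2 ^ 32 * (4*h + 1) ^ 30) \<le> real (4 ^ h)"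
        using par(1) h by (simp add: powr_realpow add.commute)
      then show "2 ^ 32 * (4*h + 1) ^ 30 \<le> (4::nat) ^ h"
        by (simp only: of_nat_le_iff)
      have "2 * real K * real (q * m) * sqrt (real (q * m)) / real h
          \<le> 2 * (6 * ln (real h) + 1) * R (real h) * sqrt (R (real h)) / real h"
        using QR R0 K(2) par(5) by (intro divide_right_mono mult_mono) auto
      then show "2 * real K * real (q * m) * sqrt (real (q * m)) / real h \<le> 1 / 48"
        using par(2) by linarith
      have "2 powr (6 * ln (real h)) \<le> (2::real) ^ K"
        using K(1) by (simp flip: powr_realpow)
      then have "2048 * real (q * m) ^ 3 / 2 ^ K \<le> 2048 * R (real h) ^ 3 / 2 powr (6 * ln (real h))"
        using QR R0 by (intro frac_le mult_left_mono power_mono) auto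
      then show "2048 * real (q * m) ^ 3 / 2 ^ K \<le> 1 / 48"
        using par(3) by linarith
      have "(31 / 32 :: real) ^ m \<le> exp (- (1 / 32)) ^ m"
        using exp_ge_add_one_self[of "- (1 / 32)"] by (intro power_mono) auto
      also have "\<dots> = exp (- (real m / 32))"
        by (simp flip: exp_of_nat_mult)
      also have "\<dots> \<le> exp (- 2 * ln (real h))"
        using m(1) by simp
      finally have "real q * (31 / 32) ^ m \<le> B (real h) * exp (- 2 * ln (real h))"
        using qB by (intro mult_mono) (auto intro: order_trans[of 0 "real q"])
      then show "real q * (31 / 32) ^ m \<le> 1 / 96"
        using par(4) by linarith
    qed
  qed
  show ?thesis
    unfolding Let_def
    by (rule exI[of _ "1 / 4096"], rule conjI, simp, rule exI[of _ "1 / 16"], rule conjI, simp,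
        rule exI[of _ 2], rule conjI, simp, rule exI[of _ 1], rule conjI, simp,
        rule exI[of _ 3], rule exI[of _ n\<^sub>0]) (use bound in blast)
qed

end
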